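(* Let $F$ denote Thompson's group, with commutator subgroup $[F,F]$, and let $\mathcal{M} \le L(F)$ be a von Neumann subalgebra invariant under conjugation by $[F,F]$, i.e. $\lambda(g)\,\mathcal{M}\,\lambda(g)^* = \mathcal{M}$ for every $g \in [F,F]$. Then there exists a normal subgroup $N \trianglelefteq F$ such that $\mathcal{M} = L(N)$.
   Context: Thompson's group $F$ is the group (under composition) of orientation-preserving piecewise linear homeomorphisms $g \colon [0,1] \to [0,1]$ with finitely many breakpoints such that every breakpoint lies in the dyadic rationals $\mathbb{Z}[1/2] \cap [0,1]$ and the slope at every point of differentiability lies in $\{2^k : k \in \mathbb{Z}\}$. The group $[F,F]$ is its commutator (derived) subgroup. For a countable discrete group $\Gamma$, $\lambda \colon \Gamma \to B(\ell^2\Gamma)$, $\lambda(g)\delta_h = \delta_{gh}$, is the left regular representation, and $L(\Gamma)$ is the weak operator closure of the linear span of $\{\lambda(g) : g \in \Gamma\}$ in $B(\ell^2\Gamma)$. For a subgroup $N \le \Gamma$, $L(N)$ is regarded as the von Neumann subalgebra of $L(\Gamma)$ generated by $\{\lambda(g) : g \in N\}$. Von Neumann subalgebras are, as usual, weak operator closed $*$-subalgebras containing the unit of the ambient algebra. *)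

theory Defs
  imports
    "HOL-Analysis.Analysis"
    "HOL-Algebra.Bij"
    "HOL-Algebra.Generated_Groups"
begin

section \<open>The Hilbert space of square-summable functions\<close>

typedef 'a ell2 = "{f :: 'a \<Rightarrow> complex. (\<lambda>x. (cmod (f x))\<^sup>2) summable_on UNIV}"
  morphisms ell2_apply Abs_ell2
  by (rule exI[of _ "\<lambda>_. 0"]) simp

setup_lifting type_definition_ell2

lemma ell2_eqI: "(\<And>x. ell2_apply f x = ell2_apply g x) \<Longrightarrow> f = g"
  by (simp add: ell2_apply_inject[symmetric] fun_eq_iff)

lemma square_summable_add:
  fixes f g :: "'a \<Rightarrow> complex"
  assumes "(\<lambda>x. (cmod (f x))\<^sup>2) summable_on A" "(\<lambda>x. (cmod (g x))\<^sup>2) summable_on A"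
  shows "(\<lambda>x. (cmod (f x + g x))\<^sup>2) summable_on A"
proof (rule summable_on_comparison_test)
  show "(\<lambda>x. 2 * (cmod (f x))\<^sup>2 + 2 * (cmod (g x))\<^sup>2) summable_on A"
    by (intro summable_on_add summable_on_cmult_right assms)
  fix x
  have "(cmod (f x + g x))\<^sup>2 \<le> (cmod (f x) + cmod (g x))\<^sup>2"
    by (intro power_mono norm_triangle_ineq) auto
  also have "\<dots> \<le> 2 * (cmod (f x))\<^sup>2 + 2 * (cmod (g x))\<^sup>2"
    using sum_squares_bound[of "cmod (f x)" "cmod (g x)"] by (simp add: power2_sum)
  finally show "(cmod (f x + g x))\<^sup>2 \<le> 2 * (cmod (f x))\<^sup>2 + 2 * (cmod (g x))\<^sup>2" .
qed auto

lemma square_summable_scale: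
  fixes f :: "'a \<Rightarrow> complex"
  assumes "(\<lambda>x. (cmod (f x))\<^sup>2) summable_on A"
  shows "(\<lambda>x. (cmod (c * f x))\<^sup>2) summable_on A"
  using summable_on_cmult_right[OF assms, of "(cmod c)\<^sup>2"]
  by (simp add: norm_mult power_mult_distrib)

lemma square_summable_mult_cnj:
  fixes f g :: "'a \<Rightarrow> complex"
  assumes "(\<lambda>x. (cmod (f x))\<^sup>2) summable_on A" "(\<lambda>x. (cmod (g x))\<^sup>2) summable_on A"
  shows "(\<lambda>x. f x * cnj (g x)) summable_on A"
proof (rule Infinite_Sum.abs_summable_summable, rule Infinite_Sum.abs_summable_on_comparison_test')
  show "(\<lambda>x. (cmod (f x))\<^sup>2 + (cmod (g x))\<^sup>2) summable_on A"
    by (intro summable_on_add assms)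
  fix x
  have "0 \<le> cmod (f x) * cmod (g x)" by simp
  then show "cmod (f x * cnj (g x)) \<le> (cmod (f x))\<^sup>2 + (cmod (g x))\<^sup>2"
    using sum_squares_bound[of "cmod (f x)" "cmod (g x)"] unfolding norm_mult complex_mod_cnj
    by linarith
qed

lift_definition scale_ell2 :: "complex \<Rightarrow> 'a ell2 \<Rightarrow> 'a ell2" (infixr \<open>\<cdot>\<^sub>C\<close> 75)
  is "\<lambda>c f x. c * f x"
  by (simp add: square_summable_scale)

lift_definition cinner :: "'a ell2 \<Rightarrow> 'a ell2 \<Rightarrow> complex"
  is "\<lambda>f g. \<Sum>\<^sub>\<infinity>x. f x * cnj (g x)" .

instantiation ell2 :: (type) real_vector
begin
lift_definition zero_ell2 :: "'a ell2" is "\<lambda>_. 0" by simp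
lift_definition plus_ell2 :: "'a ell2 \<Rightarrow> 'a ell2 \<Rightarrow> 'a ell2" is "\<lambda>f g x. f x + g x"
  by (simp add: square_summable_add)
lift_definition uminus_ell2 :: "'a ell2 \<Rightarrow> 'a ell2" is "\<lambda>f x. - f x" by simp
definition minus_ell2 :: "'a ell2 \<Rightarrow> 'a ell2 \<Rightarrow> 'a ell2" where "f - g = f + - g" for f g :: "'a ell2"
definition scaleR_ell2 :: "real \<Rightarrow> 'a ell2 \<Rightarrow> 'a ell2" where "r *\<^sub>R f = complex_of_real r \<cdot>\<^sub>C f" for f :: "'a ell2"
instance
proof
  fix f g h :: "'a ell2" and r s :: real
  show "f + g + h = f + (g + h)" "f + g = g + f" "0 + f = f" "- f + f = 0"
    by (transfer, simp add: algebra_simps fun_eq_iff)+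
  show "f - g = f + - g" by (fact minus_ell2_def)
  show "r *\<^sub>R (f + g) = r *\<^sub>R f + r *\<^sub>R g" "(r + s) *\<^sub>R f = r *\<^sub>R f + s *\<^sub>R f"
    "r *\<^sub>R s *\<^sub>R f = (r * s) *\<^sub>R f" "1 *\<^sub>R f = f"
    unfolding scaleR_ell2_def by (transfer, simp add: algebra_simps fun_eq_iff)+
qed
end

lemma cinner_summable: "(\<lambda>x. ell2_apply f x * cnj (ell2_apply g x)) summable_on UNIV"
  using ell2_apply[of f] ell2_apply[of g] by (intro square_summable_mult_cnj) auto

lemma cinner_commute: "cinner g f = cnj (cinner f g)"
  unfolding cinner.rep_eq infsum_cnj[symmetric] by (simp add: mult.commute)

lemma cinner_add_left: "cinner (f + g) h = cinner f h + cinner g h"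
  unfolding cinner.rep_eq plus_ell2.rep_eq distrib_right
  by (rule infsum_add) (rule cinner_summable)+

lemma cinner_scale_left: "cinner (c \<cdot>\<^sub>C f) g = c * cinner f g"
  unfolding cinner.rep_eq scale_ell2.rep_eq mult.assoc by (rule infsum_cmult_right')

lemma cinner_self: "cinner f f = of_real (\<Sum>\<^sub>\<infinity>x. (cmod (ell2_apply f x))\<^sup>2)"
proof -
  have "((\<lambda>x. (cmod (ell2_apply f x))\<^sup>2) has_sum (\<Sum>\<^sub>\<infinity>x. (cmod (ell2_apply f x))\<^sup>2)) UNIV"
    using ell2_apply[of f] by auto
  then have "((\<lambda>x. complex_of_real ((cmod (ell2_apply f x))\<^sup>2)) has_sum
      of_real (\<Sum>\<^sub>\<infinity>x. (cmod (ell2_apply f x))\<^sup>2)) UNIV"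
    by (simp only: has_sum_of_real_iff)
  then show ?thesis
    unfolding cinner.rep_eq complex_norm_square by (rule infsumI)
qed

instantiation ell2 :: (type) real_inner
begin
definition inner_ell2 :: "'a ell2 \<Rightarrow> 'a ell2 \<Rightarrow> real" where "inner_ell2 f g = Re (cinner f g)"
definition norm_ell2 :: "'a ell2 \<Rightarrow> real" where "norm_ell2 f = sqrt (inner f f)"
definition dist_ell2 :: "'a ell2 \<Rightarrow> 'a ell2 \<Rightarrow> real" where "dist_ell2 f g = norm (f - g)"
definition sgn_ell2 :: "'a ell2 \<Rightarrow> 'a ell2" where "sgn_ell2 f = f /\<^sub>R norm f"
definition uniformity_ell2 :: "('a ell2 \<times> 'a ell2) filter"
  where "uniformity_ell2 = (INF e\<in>{0<..}. principal {(f, g). dist f g < e})"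
definition open_ell2 :: "'a ell2 set \<Rightarrow> bool"
  where "open_ell2 U = (\<forall>f\<in>U. \<forall>\<^sub>F (f', g) in uniformity. f' = f \<longrightarrow> g \<in> U)"
instance
proof
  fix f g h :: "'a ell2" and r :: real and U :: "'a ell2 set"
  show "inner f g = inner g f"
    unfolding inner_ell2_def by (subst cinner_commute) simp
  show "inner (f + g) h = inner f h + inner g h" "inner (r *\<^sub>R f) g = r * inner f g"
    unfolding inner_ell2_def scaleR_ell2_def by (simp_all add: cinner_add_left cinner_scale_left)
  show "0 \<le> inner f f"
    unfolding inner_ell2_def cinner_self by (simp add: infsum_nonneg)
  show "inner f f = 0 \<longleftrightarrow> f = 0"
  proof
    assume "inner f f = 0"
    then have "(\<Sum>\<^sub>\<infinity>x. (cmod (ell2_apply f x))\<^sup>2) \<le> 0"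
      by (simp add: inner_ell2_def cinner_self)
    then have "(cmod (ell2_apply f x))\<^sup>2 = 0" for x
      using ell2_apply[of f] by (intro nonneg_infsum_le_0D[where A = UNIV]) auto
    then show "f = 0" by (intro ell2_eqI) (simp add: zero_ell2.rep_eq)
  qed (simp add: inner_ell2_def cinner_self zero_ell2.rep_eq)
qed (simp_all add: norm_ell2_def dist_ell2_def sgn_ell2_def uniformity_ell2_def open_ell2_def)
end

lift_definition delta :: "'a \<Rightarrow> 'a ell2" is "\<lambda>x y. of_bool (y = x)"
proof -
  fix x :: 'a
  have "(\<lambda>y. (cmod (of_bool (y = x)))\<^sup>2) summable_on {x}" by simp
  then show "(\<lambda>y. (cmod (of_bool (y = x)))\<^sup>2) summable_on UNIV"
    by (rule summable_on_cong_neutral[THEN iffD1, rotated -1]) auto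
qed


section \<open>Operators\<close>

text \<open>The library type of bounded operators is real-linear; the bounded operators on the complex
  Hilbert space are those that commute with all complex scalars.\<close>

definition bounded_ops :: "('a ell2 \<Rightarrow>\<^sub>L 'a ell2) set"
  where "bounded_ops = {T. \<forall>c f. blinfun_apply T (c \<cdot>\<^sub>C f) = c \<cdot>\<^sub>C blinfun_apply T f}"

lemma norm_scale_ell2: "norm (c \<cdot>\<^sub>C f) = cmod c * norm f"
proof -
  have "cinner (c \<cdot>\<^sub>C f) (c \<cdot>\<^sub>C f) = c * cnj c * cinner f f"
    by (subst cinner_scale_left, subst cinner_commute)
      (simp add: cinner_scale_left cinner_commute[of f f, symmetric])
  then have "inner (c \<cdot>\<^sub>C f) (c \<cdot>\<^sub>C f) = (cmod c)\<^sup>2 * inner f f"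
    unfolding inner_ell2_def
    by (simp add: complex_norm_square[symmetric] cinner_self del: of_real_power)
  then show ?thesis by (simp add: norm_ell2_def real_sqrt_mult)
qed

definition scale_op :: "complex \<Rightarrow> ('a ell2 \<Rightarrow>\<^sub>L 'a ell2) \<Rightarrow> ('a ell2 \<Rightarrow>\<^sub>L 'a ell2)"
  where "scale_op c T = Blinfun (\<lambda>f. c \<cdot>\<^sub>C blinfun_apply T f)"

lemma bounded_linear_scale_ell2: "bounded_linear ((\<cdot>\<^sub>C) c)"
proof
  fix f g :: "'a ell2" and r :: real
  show "c \<cdot>\<^sub>C (f + g) = c \<cdot>\<^sub>C f + c \<cdot>\<^sub>C g" by transfer (simp add: algebra_simps)
  show "c \<cdot>\<^sub>C (r *\<^sub>R f) = r *\<^sub>R (c \<cdot>\<^sub>C f)"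
    unfolding scaleR_ell2_def by transfer (simp add: algebra_simps)
  show "\<exists>K. \<forall>f :: 'a ell2. norm (c \<cdot>\<^sub>C f) \<le> norm f * K"
    by (rule exI[of _ "cmod c"]) (simp add: norm_scale_ell2 mult.commute)
qed

lemma scale_op_apply: "blinfun_apply (scale_op c T) f = c \<cdot>\<^sub>C blinfun_apply T f"
  unfolding scale_op_def
  by (subst bounded_linear_Blinfun_apply)
    (auto intro: bounded_linear_compose[OF bounded_linear_scale_ell2 blinfun.bounded_linear_right])

global_interpretation ops: vector_space scale_op
proof
  fix a b :: complex and S T :: "'a ell2 \<Rightarrow>\<^sub>L 'a ell2"
  show "scale_op a (S + T) = scale_op a S + scale_op a T"
    by (rule blinfun_eqI, simp add: scale_op_apply blinfun.add_left, transfer)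
      (simp add: algebra_simps)
  show "scale_op (a + b) T = scale_op a T + scale_op b T"
    by (rule blinfun_eqI, simp add: scale_op_apply blinfun.add_left, transfer)
      (simp add: algebra_simps)
  show "scale_op a (scale_op b T) = scale_op (a * b) T"
    by (rule blinfun_eqI, simp add: scale_op_apply, transfer) (simp add: algebra_simps)
  show "scale_op 1 T = T"
    by (rule blinfun_eqI, simp add: scale_op_apply, transfer) simp
qed

definition adj :: "('a ell2 \<Rightarrow>\<^sub>L 'a ell2) \<Rightarrow> ('a ell2 \<Rightarrow>\<^sub>L 'a ell2)"
  where "adj T = (THE S. \<forall>f g. cinner (blinfun_apply T f) g = cinner f (blinfun_apply S g))"

lemma cinner_eqI: "(\<And>f. cinner f g = cinner f h) \<Longrightarrow> g = h"
proof -
  assume "\<And>f. cinner f g = cinner f h"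
  then have "inner (g - h) g = inner (g - h) h" by (simp add: inner_ell2_def)
  then have "inner (g - h) (g - h) = 0" by (simp add: inner_diff_right)
  then show "g = h" by simp
qed

lemma adjI:
  assumes "\<And>f g. cinner (blinfun_apply T f) g = cinner f (blinfun_apply S g)"
  shows "adj T = S"
  unfolding adj_def
proof (rule the_equality)
  fix S' assume "\<forall>f g. cinner (blinfun_apply T f) g = cinner f (blinfun_apply S' g)"
  then show "S' = S" by (intro blinfun_eqI cinner_eqI) (simp add: assms[symmetric])
qed (simp add: assms)

text \<open>The coarsest topology on the bounded operators for which all matrix coefficients are
  continuous (cf. the library's strong operator topology).\<close>

definition weak_operator_topology :: "('a ell2 \<Rightarrow>\<^sub>L 'a ell2) topology"
  where "weak_operator_topology =
    pullback_topology bounded_ops (\<lambda>T (f, g). cinner (blinfun_apply T f) g) euclidean"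


section \<open>Group von Neumann algebras\<close>

text \<open>Throughout, \<open>G\<close> is a group whose carrier is all of its type, so that \<open>'a ell2\<close> is the
  Hilbert space of the group.\<close>

definition left_reg :: "('a, 'b) monoid_scheme \<Rightarrow> 'a \<Rightarrow> ('a ell2 \<Rightarrow>\<^sub>L 'a ell2)"
  where "left_reg G g =
    Blinfun (\<lambda>f. Abs_ell2 (\<lambda>h. ell2_apply f (inv\<^bsub>G\<^esub> g \<otimes>\<^bsub>G\<^esub> h)))"

context
  fixes G :: "('a, 'b) monoid_scheme"
  assumes G: "group G" and UNIV: "carrier G = UNIV"
begin

interpretation group G by (rule G)

private lemma bij_left_mult: "bij (\<lambda>h. g \<otimes>\<^bsub>G\<^esub> h)"
  by (rule o_bij[where g = "\<lambda>h. inv\<^bsub>G\<^esub> g \<otimes>\<^bsub>G\<^esub> h"])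
    (auto simp: fun_eq_iff UNIV m_assoc[symmetric])

private lemma shift_ell2:
  "ell2_apply (Abs_ell2 (\<lambda>h. ell2_apply f (g \<otimes>\<^bsub>G\<^esub> h))) h = ell2_apply f (g \<otimes>\<^bsub>G\<^esub> h)"
proof (subst Abs_ell2_inverse)
  show "(\<lambda>h. ell2_apply f (g \<otimes>\<^bsub>G\<^esub> h)) \<in> {f. (\<lambda>x. (cmod (f x))\<^sup>2) summable_on UNIV}"
    using ell2_apply[of f]
      summable_on_reindex_bij_betw[OF bij_left_mult, of "\<lambda>x. (cmod (ell2_apply f x))\<^sup>2" g]
    by simp
qed simp

lemma left_reg_apply:
  "ell2_apply (blinfun_apply (left_reg G g) f) h = ell2_apply f (inv\<^bsub>G\<^esub> g \<otimes>\<^bsub>G\<^esub> h)"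
proof -
  define S where "S = (\<lambda>f. Abs_ell2 (\<lambda>h. ell2_apply f (inv\<^bsub>G\<^esub> g \<otimes>\<^bsub>G\<^esub> h)))"
  have S: "ell2_apply (S f) h = ell2_apply f (inv\<^bsub>G\<^esub> g \<otimes>\<^bsub>G\<^esub> h)" for f h
    by (simp add: S_def shift_ell2)
  have "bounded_linear S"
  proof
    fix f f' and r :: real
    show "S (f + f') = S f + S f'"
      by (rule ell2_eqI) (simp add: S plus_ell2.rep_eq)
    show "S (r *\<^sub>R f) = r *\<^sub>R S f"
      by (rule ell2_eqI) (simp add: S scaleR_ell2_def scale_ell2.rep_eq)
    have "norm (S f) = norm f" for f
      unfolding norm_ell2_def inner_ell2_def cinner_self S
      using infsum_reindex_bij_betw[OF bij_left_mult, of "\<lambda>x. (cmod (ell2_apply f x))\<^sup>2"] by simp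
    then show "\<exists>K. \<forall>f. norm (S f) \<le> norm f * K"
      by (intro exI[of _ 1]) simp
  qed
  then show ?thesis
    unfolding left_reg_def S_def[symmetric] by (simp add: bounded_linear_Blinfun_apply S)
qed

lemma left_reg_delta: "blinfun_apply (left_reg G g) (delta h) = delta (g \<otimes>\<^bsub>G\<^esub> h)"
proof (rule ell2_eqI)
  fix x
  have "inv\<^bsub>G\<^esub> g \<otimes>\<^bsub>G\<^esub> x = h \<longleftrightarrow> x = g \<otimes>\<^bsub>G\<^esub> h"
    using inv_solve_left'[of h g x] by (auto simp: UNIV)
  then show "ell2_apply (blinfun_apply (left_reg G g) (delta h)) x = ell2_apply (delta (g \<otimes>\<^bsub>G\<^esub> h)) x"
    by (simp add: left_reg_apply delta.rep_eq)
qed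

lemma left_reg_bounded_ops: "left_reg G g \<in> bounded_ops"
  unfolding bounded_ops_def
  by (auto intro!: ell2_eqI simp: left_reg_apply scale_ell2.rep_eq)

lemma adj_left_reg: "adj (left_reg G g) = left_reg G (inv\<^bsub>G\<^esub> g)"
proof (rule adjI)
  fix f f' :: "'a ell2"
  show "cinner (blinfun_apply (left_reg G g) f) f' = cinner f (blinfun_apply (left_reg G (inv\<^bsub>G\<^esub> g)) f')"
    unfolding cinner.rep_eq left_reg_apply
    using infsum_reindex_bij_betw[OF bij_left_mult,
        of "\<lambda>h. ell2_apply f (inv\<^bsub>G\<^esub> g \<otimes>\<^bsub>G\<^esub> h) * cnj (ell2_apply f' h)" g]
    by (simp add: UNIV m_assoc[symmetric])
qed

end

definition group_vN :: "('a, 'b) monoid_scheme \<Rightarrow> ('a ell2 \<Rightarrow>\<^sub>L 'a ell2) set"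
  where "group_vN G = weak_operator_topology closure_of ops.span (left_reg G ` carrier G)"

definition vN_subalgebra :: "('a, 'b) monoid_scheme \<Rightarrow> ('a ell2 \<Rightarrow>\<^sub>L 'a ell2) set \<Rightarrow> bool"
  where "vN_subalgebra G M \<longleftrightarrow>
    M \<subseteq> group_vN G \<and>
    id_blinfun \<in> M \<and>
    ops.subspace M \<and>
    (\<forall>S\<in>M. \<forall>T\<in>M. S o\<^sub>L T \<in> M) \<and>
    (\<forall>T\<in>M. adj T \<in> M) \<and>
    closedin weak_operator_topology M"

definition subgroup_vN :: "('a, 'b) monoid_scheme \<Rightarrow> 'a set \<Rightarrow> ('a ell2 \<Rightarrow>\<^sub>L 'a ell2) set"
  where "subgroup_vN G N = \<Inter> {A. vN_subalgebra G A \<and> left_reg G ` N \<subseteq> A}"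


section \<open>Thompson's group\<close>

definition dyadic_rationals :: "real set"
  where "dyadic_rationals = {x. \<exists>(m :: int) (n :: nat). x = of_int m / 2 ^ n}"

definition breakpoints :: "(real \<Rightarrow> real) \<Rightarrow> real set"
  where "breakpoints g = {x \<in> {0..1}. \<not> g differentiable (at x within {0..1})}"

definition affine_off :: "real set \<Rightarrow> (real \<Rightarrow> real) \<Rightarrow> bool"
  where "affine_off S g \<longleftrightarrow>
    (\<forall>a b. 0 \<le> a \<and> a < b \<and> b \<le> 1 \<and> {a<..<b} \<inter> S = {} \<longrightarrow> (\<exists>m c. \<forall>x\<in>{a..b}. g x = m * x + c))"

text \<open>The finite set in the definition of piecewise linearity may contain points that are not
  breakpoints; only the actual breakpoints are required to be dyadic.\<close>

definition piecewise_linear :: "(real \<Rightarrow> real) \<Rightarrow> bool"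
  where "piecewise_linear g \<longleftrightarrow> (\<exists>S. finite S \<and> affine_off S g)"

text \<open>Maps of the unit interval are represented extensionally, as in \<^term>\<open>Bij {0..1}\<close>.\<close>

definition thompson_maps :: "(real \<Rightarrow> real) set"
  where "thompson_maps = {g \<in> extensional {0..1}.
    (\<exists>h. homeomorphism {0..1} {0..1} g h) \<and>
    strict_mono_on {0..1} g \<and>
    piecewise_linear g \<and>
    breakpoints g \<subseteq> dyadic_rationals \<and>
    (\<forall>x\<in>{0..1}. \<forall>D. (g has_real_derivative D) (at x within {0..1}) \<longrightarrow> (\<exists>k :: int. D = 2 powi k))}"

subsection \<open>Closure under composition and inverses\<close>

lemma dyadic_of_int: "of_int m \<in> dyadic_rationals"
  unfolding dyadic_rationals_def by (auto intro!: exI[of _ m] exI[of _ "0 :: nat"])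

lemma dyadic_mult: "x \<in> dyadic_rationals \<Longrightarrow> y \<in> dyadic_rationals \<Longrightarrow> x * y \<in> dyadic_rationals"
proof -
  assume "x \<in> dyadic_rationals" "y \<in> dyadic_rationals"
  then obtain m n m' n' where "x = of_int m / 2 ^ n" "y = of_int m' / 2 ^ n'"
    unfolding dyadic_rationals_def by blast
  then have "x * y = of_int (m * m') / 2 ^ (n + n')" by (simp add: power_add)
  then show ?thesis unfolding dyadic_rationals_def by blast
qed

lemma dyadic_add: "x \<in> dyadic_rationals \<Longrightarrow> y \<in> dyadic_rationals \<Longrightarrow> x + y \<in> dyadic_rationals"
proof -
  assume "x \<in> dyadic_rationals" "y \<in> dyadic_rationals"
  then obtain m n m' n' where xy: "x = of_int m / 2 ^ n" "y = of_int m' / 2 ^ n'"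
    unfolding dyadic_rationals_def by blast
  have "x + y = of_int (m * 2 ^ n' + m' * 2 ^ n) / 2 ^ (n + n')"
    unfolding xy by (simp add: power_add field_simps)
  then show ?thesis unfolding dyadic_rationals_def by blast
qed

lemma dyadic_diff: "x \<in> dyadic_rationals \<Longrightarrow> y \<in> dyadic_rationals \<Longrightarrow> x - y \<in> dyadic_rationals"
  using dyadic_add[of x "of_int (-1) * y"] dyadic_mult[OF dyadic_of_int, of y "-1"] by simp

lemma dyadic_powi: "2 powi k \<in> dyadic_rationals"
proof (cases "k \<ge> 0")
  case True
  then show ?thesis using dyadic_of_int[of "2 ^ nat k"] by (simp add: power_int_def)
next
  case False
  then have "2 powi k = of_int 1 / (2 :: real) ^ nat (- k)"
    by (simp add: power_int_def field_simps)
  then show ?thesis unfolding dyadic_rationals_def by blast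
qed

definition dyadic_affine_off :: "real set \<Rightarrow> (real \<Rightarrow> real) \<Rightarrow> bool"
  where "dyadic_affine_off S g \<longleftrightarrow> finite S \<and> S \<subseteq> dyadic_rationals \<and>
    (\<forall>a b. 0 \<le> a \<and> a < b \<and> b \<le> 1 \<and> {a<..<b} \<inter> S = {} \<longrightarrow>
      (\<exists>(k :: int) c. \<forall>x\<in>{a..b}. g x = 2 powi k * x + c))"

lemma dyadic_affine_offD:
  assumes "dyadic_affine_off S g" "0 \<le> a" "a < b" "b \<le> 1" "{a<..<b} \<inter> S = {}"
  obtains k :: int and c where "\<And>x. x \<in> {a..b} \<Longrightarrow> g x = 2 powi k * x + c"
proof -
  have "\<exists>(k :: int) c. \<forall>x\<in>{a..b}. g x = 2 powi k * x + c"
    using assms unfolding dyadic_affine_off_def by simp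
  then show ?thesis using that by blast
qed

lemma slope_unique:
  assumes D: "(g has_real_derivative D) (at x within {0..1})"
    and g: "\<And>y. y \<in> {a..b} \<Longrightarrow> g y = m * y + c"
    and ab: "0 \<le> a" "a < b" "b \<le> 1" "x \<in> {a..b}"
  shows "D = m"
proof -
  have "(g has_real_derivative D) (at x within {a..b})"
    by (rule DERIV_subset[OF D]) (use ab in auto)
  moreover have "((\<lambda>y. m * y + c) has_real_derivative m) (at x within {a..b})"
    by (auto intro!: derivative_eq_intros)
  then have "(g has_real_derivative m) (at x within {a..b})"
    by (rule has_field_derivative_transform_within[OF _ zero_less_one]) (use g ab in auto)
  ultimately show ?thesis
    using ab
    by (auto simp: has_real_derivative_iff_has_vector_derivative
        intro!: vector_derivative_unique_within_closed_interval[of a b x])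
qed

lemma affine_off_remove:
  assumes aff: "affine_off S g" and s: "s \<notin> breakpoints g"
  shows "affine_off (S - {s}) g"
  unfolding affine_off_def
proof (intro allI impI, elim conjE)
  fix a b :: real
  assume ab: "0 \<le> a" "a < b" "b \<le> 1" "{a<..<b} \<inter> (S - {s}) = {}"
  show "\<exists>m c. \<forall>x\<in>{a..b}. g x = m * x + c"
  proof (cases "s \<in> {a<..<b}")
    case False
    then have "{a<..<b} \<inter> S = {}" using ab by blast
    then show ?thesis using aff ab unfolding affine_off_def by blast
  next
    case True
    have "{a<..<s} \<inter> S = {}" "{s<..<b} \<inter> S = {}"
      using ab(4) True by (force simp: set_eq_iff)+
    then obtain m c m' c' where
      l: "\<And>x. x \<in> {a..s} \<Longrightarrow> g x = m * x + c" and r: "\<And>x. x \<in> {s..b} \<Longrightarrow> g x = m' * x + c'"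
      using aff ab True unfolding affine_off_def
      by (metis greaterThanLessThan_iff order.strict_trans2 less_imp_le order.trans)
    obtain D where "(g has_real_derivative D) (at s within {0..1})"
      using s ab True by (auto simp: breakpoints_def real_differentiable_def)
    then have "m = D" "m' = D"
      using slope_unique[OF _ l, of D s] slope_unique[OF _ r, of D s] ab True by auto
    moreover have "m * s + c = m' * s + c'" using l[of s] r[of s] ab True by simp
    ultimately have "g x = m * x + c" if "x \<in> {a..b}" for x
      using l[of x] r[of x] that by (cases "x \<le> s") auto
    then show ?thesis by blast
  qed
qed

lemma affine_off_breakpoints:
  assumes "finite S" "affine_off S g"
  shows "affine_off (S \<inter> breakpoints g) g"
proof -
  have "affine_off (S - R) g" if "finite R" "R \<inter> breakpoints g = {}" for R
    using that
  proof (induction R)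
    case (insert s R)
    then have "affine_off (S - R - {s}) g" by (intro affine_off_remove) auto
    then show ?case by (simp only: Diff_insert[symmetric])
  qed (simp add: assms)
  note rm = this
  have "affine_off (S - (S - breakpoints g)) g"
    by (rule rm) (use assms(1) in auto)
  then show ?thesis by (simp only: Diff_Diff_Int)
qed

lemma right_gap:
  fixes S :: "real set"
  assumes "finite S" "x < 1"
  obtains b where "x < b" "b \<le> 1" "{x<..<b} \<inter> S = {}"
proof -
  obtain d where d: "d > 0" "\<And>y. y \<in> S \<Longrightarrow> y \<noteq> x \<Longrightarrow> d \<le> dist x y"
    using finite_set_avoid[OF assms(1), of x] by blast
  have "y \<notin> S" if "y \<in> {x<..<min 1 (x + d)}" for y
    using d(2)[of y] that by (auto simp: dist_real_def)
  then show ?thesis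
    using d(1) assms(2) by (intro that[of "min 1 (x + d)"]) auto
qed

lemma left_gap:
  fixes S :: "real set"
  assumes "finite S" "0 < x"
  obtains a where "0 \<le> a" "a < x" "{a<..<x} \<inter> S = {}"
proof -
  obtain d where d: "d > 0" "\<And>y. y \<in> S \<Longrightarrow> y \<noteq> x \<Longrightarrow> d \<le> dist x y"
    using finite_set_avoid[OF assms(1), of x] by blast
  have "y \<notin> S" if "y \<in> {max 0 (x - d)<..<x}" for y
    using d(2)[of y] that by (auto simp: dist_real_def)
  then show ?thesis
    using d(1) assms(2) by (intro that[of "max 0 (x - d)"]) auto
qed

lemma affine_imp_derivative:
  assumes x: "x \<in> {a<..<b} \<or> (x = 0 \<and> a = 0) \<or> (x = 1 \<and> b = 1)" and ab: "a \<le> x" "x \<le> b" "a < b" "0 \<le> a" "b \<le> 1"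
    and g: "\<And>y. y \<in> {a..b} \<Longrightarrow> g y = m * y + c"
  shows "(g has_real_derivative m) (at x within {0..1})"
proof -
  obtain e where e: "e > 0" "\<And>y. y \<in> {0..1} \<Longrightarrow> dist y x < e \<Longrightarrow> y \<in> {a..b}"
  proof -
    consider "x \<in> {a<..<b}" | "x = 0" "a = 0" | "x = 1" "b = 1" using x by blast
    then show ?thesis
    proof cases
      case 1 then show ?thesis by (intro that[of "min (x - a) (b - x)"]) (auto simp: dist_real_def abs_less_iff)
    next
      case 2 then show ?thesis using ab by (intro that[of b]) (auto simp: dist_real_def)
    next
      case 3 then show ?thesis using ab by (intro that[of "1 - a"]) (auto simp: dist_real_def)
    qed
  qed
  have "((\<lambda>y. m * y + c) has_real_derivative m) (at x within {0..1})"
    by (auto intro!: derivative_eq_intros)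
  then show ?thesis
    by (rule has_field_derivative_transform_within[OF _ e(1)]) (use e g ab in auto)
qed

lemma thompson_maps_imp_dyadic_affine_off:
  assumes "g \<in> thompson_maps"
  obtains S where "dyadic_affine_off S g"
proof -
  obtain S where S: "finite S" "affine_off S g"
    using assms by (auto simp: thompson_maps_def piecewise_linear_def)
  have aff: "affine_off (S \<inter> breakpoints g) g" using affine_off_breakpoints[OF S] .
  have "\<exists>(k :: int) c. \<forall>x\<in>{a..b}. g x = 2 powi k * x + c"
    if ab: "0 \<le> a" "a < b" "b \<le> 1" "{a<..<b} \<inter> (S \<inter> breakpoints g) = {}" for a b
  proof -
    obtain m c where mc: "\<And>x. x \<in> {a..b} \<Longrightarrow> g x = m * x + c"
      using aff ab unfolding affine_off_def by blast
    have "(g has_real_derivative m) (at ((a + b) / 2) within {0..1})"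
      by (rule affine_imp_derivative[OF _ _ _ _ _ _ mc]) (use ab in auto)
    then obtain k :: int where "m = 2 powi k"
      using assms ab unfolding thompson_maps_def by force
    then show ?thesis using mc by blast
  qed
  then have "dyadic_affine_off (S \<inter> breakpoints g) g"
    using S(1) assms unfolding dyadic_affine_off_def thompson_maps_def by auto
  then show ?thesis by (rule that)
qed

lemma thompson_mapsI:
  assumes g: "g \<in> extensional {0..1}" "homeomorphism {0..1} {0..1} g h" "strict_mono_on {0..1} g"
    and aff: "dyadic_affine_off S g"
  shows "g \<in> thompson_maps"
proof -
  have fin: "finite S" and dy: "S \<subseteq> dyadic_rationals"
    using aff by (auto simp: dyadic_affine_off_def)
  have "affine_off S g"
    unfolding affine_off_def using aff unfolding dyadic_affine_off_def by blast
  then have pl: "piecewise_linear g" using fin by (auto simp: piecewise_linear_def)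
  have "x \<in> S" if x: "x \<in> breakpoints g" for x
  proof (rule ccontr)
    assume "x \<notin> S"
    from x have x01: "0 \<le> x" "x \<le> 1" and nd: "\<not> g differentiable (at x within {0..1})"
      by (auto simp: breakpoints_def)
    have "\<exists>a. 0 \<le> a \<and> a \<le> x \<and> {a<..<x} \<inter> S = {} \<and> (a < x \<or> x = 0 \<and> a = 0)"
    proof (cases "x = 0")
      case False
      then obtain a where "0 \<le> a" "a < x" "{a<..<x} \<inter> S = {}"
        using left_gap[OF fin, of x] x01 by auto
      then show ?thesis by (intro exI[of _ a]) auto
    qed (auto intro: exI[of _ 0])
    then obtain a where a: "0 \<le> a" "a \<le> x" "{a<..<x} \<inter> S = {}" "a < x \<or> x = 0 \<and> a = 0"
      by blast
    have "\<exists>b. b \<le> 1 \<and> x \<le> b \<and> {x<..<b} \<inter> S = {} \<and> (x < b \<or> x = 1 \<and> b = 1)"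
    proof (cases "x = 1")
      case False
      then obtain b where "x < b" "b \<le> 1" "{x<..<b} \<inter> S = {}"
        using right_gap[OF fin, of x] x01 by auto
      then show ?thesis by (intro exI[of _ b]) auto
    qed (auto intro: exI[of _ 1])
    then obtain b where b: "b \<le> 1" "x \<le> b" "{x<..<b} \<inter> S = {}" "x < b \<or> x = 1 \<and> b = 1"
      by blast
    have "{a<..<b} \<inter> S = {}"
      using a(3) b(3) \<open>x \<notin> S\<close> by (force simp: set_eq_iff neq_iff)
    moreover have "a < b" using a b by auto
    ultimately obtain k :: int and c where kc: "\<And>y. y \<in> {a..b} \<Longrightarrow> g y = 2 powi k * y + c"
      using dyadic_affine_offD[OF aff] a b by metis
    have "(g has_real_derivative 2 powi k) (at x within {0..1})"
      by (rule affine_imp_derivative[OF _ _ _ _ _ _ kc]) (use a b \<open>a < b\<close> in auto)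
    then show False using nd by (auto simp: real_differentiable_def)
  qed
  then have bp: "breakpoints g \<subseteq> dyadic_rationals" using dy by auto
  have "\<exists>k :: int. D = 2 powi k"
    if x: "x \<in> {0..1}" and D: "(g has_real_derivative D) (at x within {0..1})" for x D
  proof (cases "x = 1")
    case False
    then obtain b where b: "x < b" "b \<le> 1" "{x<..<b} \<inter> S = {}"
      using right_gap[OF fin, of x] x by auto
    then obtain k :: int and c where kc: "\<And>y. y \<in> {x..b} \<Longrightarrow> g y = 2 powi k * y + c"
      using dyadic_affine_offD[OF aff, of x b] x by (metis atLeastAtMost_iff)
    then show ?thesis using slope_unique[OF D kc] x b by auto
  next
    case True
    then obtain a where a: "0 \<le> a" "a < x" "{a<..<x} \<inter> S = {}"
      using left_gap[OF fin, of x] by auto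
    then obtain k :: int and c where kc: "\<And>y. y \<in> {a..x} \<Longrightarrow> g y = 2 powi k * y + c"
      using dyadic_affine_offD[OF aff, of a x] True by (metis order_refl)
    then show ?thesis using slope_unique[OF D kc] True a by auto
  qed
  then show ?thesis using g pl bp unfolding thompson_maps_def by blast
qed

lemma unit_homeomorphism_zero:
  assumes "homeomorphism {0..1} {0..1} g h" "strict_mono_on {0..1} (g :: real \<Rightarrow> real)"
  shows "g 0 = 0"
proof (rule antisym)
  have img: "g ` {0..1} = {0..1}" using assms(1) by (simp add: homeomorphism_def)
  then obtain x where x: "x \<in> {0..1}" "g x = 0" by (metis atLeastAtMost_iff imageE order_refl zero_le_one)
  show "g 0 \<le> 0"
    using strict_mono_onD[OF assms(2), of 0 x] x by (cases "x = 0") auto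
  have "g 0 \<in> {0..1}" using img by force
  then show "0 \<le> g 0" by simp
qed

lemma dyadic_image:
  assumes aff: "dyadic_affine_off S g" and g0: "g 0 = 0"
  shows "x \<in> dyadic_rationals \<Longrightarrow> 0 \<le> x \<Longrightarrow> x \<le> 1 \<Longrightarrow> g x \<in> dyadic_rationals"
proof (induction "card (S \<inter> {0<..<x})" arbitrary: x rule: less_induct)
  case less
  have fin: "finite S" and dy: "S \<subseteq> dyadic_rationals"
    using aff by (auto simp: dyadic_affine_off_def)
  have "\<exists>p. 0 \<le> p \<and> p < x \<and> {p<..<x} \<inter> S = {} \<and> p \<in> dyadic_rationals \<and> g p \<in> dyadic_rationals"
    if x: "0 < x"
  proof (cases "S \<inter> {0<..<x} = {}")
    case True
    then show ?thesis using x g0 dyadic_of_int[of 0] by (intro exI[of _ 0]) auto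
  next
    case False
    define p where "p = Max (S \<inter> {0<..<x})"
    have p: "p \<in> S \<inter> {0<..<x}" unfolding p_def using fin False by (intro Max_in) auto
    have gap: "{p<..<x} \<inter> S = {}"
    proof (rule ccontr)
      assume "{p<..<x} \<inter> S \<noteq> {}"
      then obtain y where y: "y \<in> S" "p < y" "y < x" by auto
      then have "y \<in> S \<inter> {0<..<x}" using p by auto
      then have "y \<le> p" unfolding p_def using fin by (intro Max_ge) auto
      then show False using y by simp
    qed
    have "S \<inter> {0<..<p} \<subset> S \<inter> {0<..<x}" using p by auto
    then have "card (S \<inter> {0<..<p}) < card (S \<inter> {0<..<x})" using fin by (intro psubset_card_mono) auto
    then have "g p \<in> dyadic_rationals" using less.hyps[of p] less.prems p dy by auto
    then show ?thesis using p gap dy by (intro exI[of _ p]) auto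
  qed
  then consider "x = 0" | p where "0 \<le> p" "p < x" "{p<..<x} \<inter> S = {}" "p \<in> dyadic_rationals"
      "g p \<in> dyadic_rationals"
    using less.prems by fastforce
  then show ?case
  proof cases
    case 1 then show ?thesis using g0 dyadic_of_int[of 0] by simp
  next
    case 2
    obtain k :: int and c where kc: "\<And>y. y \<in> {p..x} \<Longrightarrow> g y = 2 powi k * y + c"
      using dyadic_affine_offD[OF aff 2(1,2) less.prems(3) 2(3)] by metis
    have "g x = g p + 2 powi k * (x - p)"
      using kc[of x] kc[of p] 2 by (simp add: algebra_simps)
    then show ?thesis
      using 2 less.prems by (auto intro!: dyadic_add dyadic_mult dyadic_powi dyadic_diff)
  qed
qed

lemma inverse_strict_mono:
  assumes "homeomorphism {0..1} {0..1} g h" "strict_mono_on {0..1} (g :: real \<Rightarrow> real)"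
  shows "strict_mono_on {0..1} h"
proof (rule strict_mono_onI)
  fix x y :: real assume xy: "x \<in> {0..1}" "y \<in> {0..1}" "x < y"
  have h: "h x \<in> {0..1}" "h y \<in> {0..1}" "g (h x) = x" "g (h y) = y"
    using assms(1) xy by (auto simp: homeomorphism_def)
  show "h x < h y"
  proof (rule ccontr)
    assume "\<not> h x < h y"
    then consider "h x = h y" | "h y < h x" by linarith
    then have "g (h y) \<le> g (h x)"
      using strict_mono_onD[OF assms(2) h(2,1)] by cases auto
    then show False unfolding h(3,4) using xy(3) by simp
  qed
qed

lemma inverse_dyadic_affine_off:
  assumes aff: "dyadic_affine_off S g"
    and hom: "homeomorphism {0..1} {0..1} g h" and mono: "strict_mono_on {0..1} g"
  shows "dyadic_affine_off (g ` (S \<inter> {0..1})) h"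
  unfolding dyadic_affine_off_def
proof (intro conjI allI impI)
  show "finite (g ` (S \<inter> {0..1}))" using aff by (auto simp: dyadic_affine_off_def)
  show "g ` (S \<inter> {0..1}) \<subseteq> dyadic_rationals"
    using dyadic_image[OF aff unit_homeomorphism_zero[OF hom mono]] aff
    by (auto simp: dyadic_affine_off_def)
  have h: "h y \<in> {0..1}" "g (h y) = y" if "y \<in> {0..1}" for y
    using hom that by (auto simp: homeomorphism_def)
  note hmono = strict_mono_onD[OF inverse_strict_mono[OF hom mono]]
  fix a b :: real
  assume ab: "0 \<le> a \<and> a < b \<and> b \<le> 1 \<and> {a<..<b} \<inter> g ` (S \<inter> {0..1}) = {}"
  have hab: "h a < h b" using ab by (intro hmono) auto
  have ha: "h a \<in> {0..1}" "h b \<in> {0..1}" "g (h a) = a" "g (h b) = b" using h ab by auto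
  have "{h a<..<h b} \<inter> S = {}"
  proof (rule ccontr)
    assume "{h a<..<h b} \<inter> S \<noteq> {}"
    then obtain s where s: "s \<in> S" "h a < s" "s < h b" by auto
    then have "s \<in> {0..1}" using ha by auto
    then have "a < g s" "g s < b"
      using strict_mono_onD[OF mono, of "h a" s] strict_mono_onD[OF mono, of s "h b"] s ha by auto
    then show False using ab s \<open>s \<in> {0..1}\<close> by force
  qed
  then obtain k :: int and c where kc: "\<And>y. y \<in> {h a..h b} \<Longrightarrow> g y = 2 powi k * y + c"
    using dyadic_affine_offD[OF aff, of "h a" "h b"] hab ha by (metis atLeastAtMost_iff)
  have "h y = 2 powi (- k) * y + - (2 powi (- k) * c)" if y: "y \<in> {a..b}" for y
  proof -
    have y01: "y \<in> {0..1}" using y ab by auto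
    have "h a \<le> h y" using hmono[of a y] y y01 ab by (cases "a = y") auto
    moreover have "h y \<le> h b" using hmono[of y b] y y01 ab by (cases "y = b") auto
    ultimately have "y = 2 powi k * h y + c" using kc[of "h y"] h[OF y01] by simp
    then have "2 powi (- k) * y = h y + 2 powi (- k) * c"
      by (metis (no_types) power_int_minus distrib_left mult.assoc mult_1 left_inverse
          power_int_not_zero zero_neq_numeral)
    then show ?thesis by simp
  qed
  then show "\<exists>(k :: int) c. \<forall>x\<in>{a..b}. h x = 2 powi k * x + c" by blast
qed

lemma homeomorphism_restrict:
  "homeomorphism {0..1} {0..1} g h \<Longrightarrow> homeomorphism {0..1} {0..1} (restrict g {0..1}) h"
  for g h :: "real \<Rightarrow> real"
  by (erule homeomorphism_cong[OF _ refl refl]) simp_all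

lemma thompson_maps_id: "restrict (\<lambda>x. x) {0..1} \<in> thompson_maps"
proof (rule thompson_mapsI)
  show "homeomorphism {0..1} {0..1} (restrict (\<lambda>x. x) {0..1}) (\<lambda>x :: real. x)"
    by (rule homeomorphism_restrict) (auto simp: homeomorphism_def)
  show "dyadic_affine_off {} (restrict (\<lambda>x. x) {0..1})"
    by (auto simp: dyadic_affine_off_def intro!: exI[of _ "0 :: int"] exI[of _ "0 :: real"])
qed (auto simp: strict_mono_on_def)

lemma thompson_maps_inverse:
  assumes "g \<in> thompson_maps" "homeomorphism {0..1} {0..1} g h"
  shows "restrict h {0..1} \<in> thompson_maps"
proof -
  obtain S where S: "dyadic_affine_off S g"
    using thompson_maps_imp_dyadic_affine_off[OF assms(1)] .
  have mono: "strict_mono_on {0..1} g" using assms(1) by (simp add: thompson_maps_def)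
  show ?thesis
  proof (rule thompson_mapsI)
    show "homeomorphism {0..1} {0..1} (restrict h {0..1}) g"
      using assms(2) by (intro homeomorphism_restrict) (simp add: homeomorphism_symD)
    show "strict_mono_on {0..1} (restrict h {0..1})"
      using inverse_strict_mono[OF assms(2) mono] by (auto simp: strict_mono_on_def)
    have "dyadic_affine_off (g ` (S \<inter> {0..1})) h"
      using inverse_dyadic_affine_off[OF S assms(2) mono] .
    then show "dyadic_affine_off (g ` (S \<inter> {0..1})) (restrict h {0..1})"
      unfolding dyadic_affine_off_def by (simp add: Ball_def cong: conj_cong)
  qed simp
qed

lemma thompson_maps_compose:
  assumes f: "f \<in> thompson_maps" and g: "g \<in> thompson_maps"
  shows "compose {0..1} f g \<in> thompson_maps"
proof -
  obtain S where S: "dyadic_affine_off S f" using thompson_maps_imp_dyadic_affine_off[OF f] .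
  obtain R where R: "dyadic_affine_off R g" using thompson_maps_imp_dyadic_affine_off[OF g] .
  obtain f' where f': "homeomorphism {0..1} {0..1} f f'" and fm: "strict_mono_on {0..1} f"
    using f by (auto simp: thompson_maps_def)
  obtain g' where g': "homeomorphism {0..1} {0..1} g g'" and gm: "strict_mono_on {0..1} g"
    using g by (auto simp: thompson_maps_def)
  have g01: "g x \<in> {0..1}" "g' (g x) = x" if "x \<in> {0..1}" for x
    using g' that by (auto simp: homeomorphism_def)
  have g'01: "g' x \<in> {0..1}" "g (g' x) = x" if "x \<in> {0..1}" for x
    using g' that by (auto simp: homeomorphism_def)
  have g'm: "strict_mono_on {0..1} g'" using inverse_strict_mono[OF g' gm] .
  have g'0: "g' 0 = 0"
    using unit_homeomorphism_zero[OF homeomorphism_symD[OF g'] g'm] .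
  define Q where "Q = R \<union> g' ` (S \<inter> {0..1})"
  have *: "compose {0..1} f g = restrict (f \<circ> g) {0..1}" by (simp add: compose_def o_def)
  show ?thesis
    unfolding *
  proof (rule thompson_mapsI)
    show "homeomorphism {0..1} {0..1} (restrict (f \<circ> g) {0..1}) (g' \<circ> f')"
      by (intro homeomorphism_restrict homeomorphism_compose[OF g' f'])
    show "strict_mono_on {0..1} (restrict (f \<circ> g) {0..1})"
    proof (rule strict_mono_onI)
      fix x y :: real assume xy: "x \<in> {0..1}" "y \<in> {0..1}" "x < y"
      then have "f (g x) < f (g y)"
        using strict_mono_onD[OF gm xy] strict_mono_onD[OF fm] g01 by blast
      then show "restrict (f \<circ> g) {0..1} x < restrict (f \<circ> g) {0..1} y" using xy by simp
    qed
    show "dyadic_affine_off Q (restrict (f \<circ> g) {0..1})"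
      unfolding dyadic_affine_off_def
    proof (intro conjI allI impI)
      show "finite Q" using S R by (auto simp: Q_def dyadic_affine_off_def)
      show "Q \<subseteq> dyadic_rationals"
        using dyadic_image[OF inverse_dyadic_affine_off[OF R g' gm] g'0] S R
        by (auto simp: Q_def dyadic_affine_off_def)
      fix a b :: real assume ab: "0 \<le> a \<and> a < b \<and> b \<le> 1 \<and> {a<..<b} \<inter> Q = {}"
      obtain k :: int and c where kc: "\<And>y. y \<in> {a..b} \<Longrightarrow> g y = 2 powi k * y + c"
        using dyadic_affine_offD[OF R, of a b] ab unfolding Q_def by (metis Int_Un_distrib Un_empty)
      have gab: "g a < g b" using strict_mono_onD[OF gm, of a b] ab by auto
      have gab01: "g a \<in> {0..1}" "g b \<in> {0..1}" using ab g01(1)[of a] g01(1)[of b] by auto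
      have "{g a<..<g b} \<inter> S = {}"
      proof (rule ccontr)
        assume "{g a<..<g b} \<inter> S \<noteq> {}"
        then obtain s where s: "s \<in> S" "g a < s" "s < g b" by auto
        then have s01: "s \<in> {0..1}" using gab01 by auto
        have "g' (g a) < g' s" "g' s < g' (g b)"
          using strict_mono_onD[OF g'm, of "g a" s] strict_mono_onD[OF g'm, of s "g b"] s s01 gab01
          by auto
        then have "g' s \<in> {a<..<b}" using g01(2)[of a] g01(2)[of b] ab by simp
        moreover have "g' s \<in> Q" using s s01 by (auto simp: Q_def)
        ultimately show False using ab by blast
      qed
      then obtain l :: int and d where ld: "\<And>y. y \<in> {g a..g b} \<Longrightarrow> f y = 2 powi l * y + d"
        using dyadic_affine_offD[OF S, of "g a" "g b"] gab gab01 by (metis atLeastAtMost_iff)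
      have "restrict (f \<circ> g) {0..1} x = 2 powi (l + k) * x + (2 powi l * c + d)"
        if x: "x \<in> {a..b}" for x
      proof -
        have x01: "x \<in> {0..1}" using x ab by auto
        have "g a \<le> g x" using strict_mono_onD[OF gm, of a x] x x01 ab by (cases "a = x") auto
        moreover have "g x \<le> g b" using strict_mono_onD[OF gm, of x b] x x01 ab by (cases "x = b") auto
        ultimately have "f (g x) = 2 powi l * g x + d" by (intro ld) simp
        then show ?thesis using x01 kc[OF x] by (simp add: power_int_add algebra_simps)
      qed
      then show "\<exists>(k :: int) c. \<forall>x\<in>{a..b}. restrict (f \<circ> g) {0..1} x = 2 powi k * x + c" by blast
    qed
  qed simp
qed

subsection \<open>The group\<close>

typedef thompson = thompson_maps
  using thompson_maps_id by blast

setup_lifting type_definition_thompson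

lift_definition thompson_mult :: "thompson \<Rightarrow> thompson \<Rightarrow> thompson"
  is "compose {0..1}" by (rule thompson_maps_compose)

lift_definition thompson_one :: thompson
  is "restrict (\<lambda>x. x) {0..1}" by (rule thompson_maps_id)

definition thompson_F :: "thompson monoid"
  where "thompson_F = \<lparr>carrier = UNIV, monoid.mult = thompson_mult, one = thompson_one\<rparr>"

lemma thompson_maps_Bij: "g \<in> thompson_maps \<Longrightarrow> g \<in> Bij {0..1}"
  by (auto simp: thompson_maps_def Bij_def bij_betw_def homeomorphism_def intro: inj_on_inverseI)

lemma group_thompson_F: "group thompson_F"
proof (rule groupI)
  fix f g h :: thompson
  show "f \<otimes>\<^bsub>thompson_F\<^esub> g \<otimes>\<^bsub>thompson_F\<^esub> h = f \<otimes>\<^bsub>thompson_F\<^esub> (g \<otimes>\<^bsub>thompson_F\<^esub> h)"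
    unfolding thompson_F_def
    by simp (transfer, simp add: compose_assoc[OF Bij_imp_funcset[OF thompson_maps_Bij]])
  show "\<one>\<^bsub>thompson_F\<^esub> \<otimes>\<^bsub>thompson_F\<^esub> g = g"
    unfolding thompson_F_def
    by simp (transfer,
      simp add: Id_compose Bij_imp_funcset Bij_imp_extensional thompson_maps_Bij)
  show "\<exists>k\<in>carrier thompson_F. k \<otimes>\<^bsub>thompson_F\<^esub> g = \<one>\<^bsub>thompson_F\<^esub>"
  proof -
    obtain h where h: "homeomorphism {0..1} {0..1} (Rep_thompson g) h"
      using Rep_thompson[of g] by (auto simp: thompson_maps_def)
    have "compose {0..1} (restrict h {0..1}) (Rep_thompson g) = restrict (\<lambda>x. x) {0..1}"
      using h by (auto simp: compose_def homeomorphism_def fun_eq_iff restrict_def)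
    then have "thompson_mult (Abs_thompson (restrict h {0..1})) g = thompson_one"
      using thompson_maps_inverse[OF Rep_thompson h]
      by (simp add: Rep_thompson_inject[symmetric] thompson_mult.rep_eq thompson_one.rep_eq
          Abs_thompson_inverse)
    then show ?thesis by (auto simp: thompson_F_def)
  qed
qed (simp_all add: thompson_F_def)

end

theory Submission
  imports Defs
begin

text \<open>Write \<open>F'\<close> for the commutator subgroup of Thompson's group \<open>F\<close>, \<open>E\<close> for the conditional expectation
  onto \<open>M\<close>, and \<open>\<lambda>(g)\<close> for the unitaries of the left regular representation. For \<open>g\<close> in \<open>F'\<close>, the
  element \<open>y = \<lambda>(g) E(\<lambda>(g))\<^sup>*\<close> commutes with \<open>M\<close>, hence with all \<open>F'\<close>-conjugates of
  \<open>x = E(\<lambda>(g))\<close>. Elements of \<open>F'\<close> can squeeze any compact part of the open unit interval into an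
  arbitrary small interval, and this makes two commuting families of \<open>F'\<close>-conjugates impossible
  unless \<open>x\<close> or \<open>y\<close> is a scalar; therefore \<open>E(\<lambda>(g))\<close> is \<open>0\<close> or \<open>\<lambda>(g)\<close>. If the latter happens for some
  \<open>g \<noteq> 1\<close>, then \<open>M\<close> contains \<open>L(F')\<close> by Higman's simplicity argument, and since all \<open>F'\<close>-conjugacy
  classes of non-trivial elements are infinite, \<open>E(\<lambda>(g))\<close> is a multiple of \<open>\<lambda>(g)\<close> for every \<open>g\<close> in \<open>F\<close>.
  Otherwise \<open>E\<close> kills \<open>F' - {1}\<close>, and for \<open>g \<noteq> 1\<close> the vectors \<open>\<lambda>(k)\<^sup>* E(\<lambda>(k))\<close>, with \<open>k\<close> ranging over
  the \<open>F'\<close>-conjugates of \<open>g\<close>, are orthogonal with the same inner product with the unit vector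
  at \<open>1\<close>, which forces \<open>E(\<lambda>(g)) = 0\<close>. Instead of \<open>E\<close>, the proof uses the orthogonal projection onto
  the closure of \<open>M \<delta>\<^sub>1\<close>; elements of \<open>M\<close> are recovered from their vectors by the double commutant
  theorem.\<close>

text \<open>Squeezing works by looking at a single coefficient. Let \<open>k\<close> and
  \<open>l\<close>, both different from 1, carry nonzero coefficients of \<open>y\<close> and
  \<open>x\<close>. Take an interval that \<open>k\<close> moves off itself and conjugate
  \<open>l\<close> into it by some \<open>t\<close> in \<open>F'\<close>. If the interval is fine
  enough for the finitely many relevant elements, the coefficient at
  \<open>k (t l t\<^sup>-1)\<close> of \<open>y\<close> times the conjugate of \<open>x\<close>
  comes from the pair \<open>(k, l)\<close> alone, and the product in the other order has no term
  there at all.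

  The obstacle is that only elements that are the identity near 0 and 1 can be squeezed, so
  \<open>x\<close> must first be known to live on them. It does because \<open>g\<close> in
  \<open>F'\<close> is itself the identity near 0 and 1: elements of \<open>F'\<close> supported
  near an end point commute with \<open>g\<close>, so conjugation by them fixes \<open>x\<close>; an
  element that is not the identity near both end points has infinitely many such conjugates, and a
  square-summable function that is constant on an infinite set vanishes there.

  Two square-summable vectors have a convolution that need not be square-summable, so commutation is
  expressed coefficient by coefficient.\<close>

section \<open>Orthogonal projections\<close>

text \<open>A minimizing sequence for the distance to \<open>V\<close> is Cauchy by the
  parallelogram law, and a variation around its limit gives orthogonality.\<close>

lemma closed_subspace_decomposition:
  fixes V :: "'a::{real_inner, complete_space} set"
  assumes sub: "subspace V" and cl: "closed V"
  obtains v where "v \<in> V" "\<And>w. w \<in> V \<Longrightarrow> inner (x - v) w = 0"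
proof -
  define d where "d = infdist x V"
  have ne: "V \<noteq> {}" using subspace_0[OF sub] by auto
  have d0: "0 \<le> d" unfolding d_def by (rule infdist_nonneg)
  have dle: "d \<le> norm (x - w)" if "w \<in> V" for w
    using infdist_le[OF that, of x] by (simp add: d_def dist_norm)
  have "\<exists>w\<in>V. norm (x - w) < d + 1 / Suc n" for n
  proof (rule ccontr)
    assume "\<not> ?thesis"
    then have "d + 1 / Suc n \<le> infdist x V"
      using ne by (auto simp: infdist_def dist_norm not_less intro!: cINF_greatest)
    then show False by (simp add: d_def)
  qed
  then obtain v where v: "\<And>n. v n \<in> V" "\<And>n. norm (x - v n) < d + 1 / Suc n"
    by metis
  \<comment> \<open>The midpoint of \<open>a\<close> and \<open>b\<close> lies in \<open>V\<close>,
    hence at distance at least \<open>d\<close> from \<open>x\<close>; the rest is the parallelogram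
    law for \<open>x - a\<close> and \<open>x - b\<close>.\<close>
  have key: "(norm (a - b))\<^sup>2 \<le> 2 * (norm (x - a))\<^sup>2 + 2 * (norm (x - b))\<^sup>2 - 4 * d\<^sup>2"
    if "a \<in> V" "b \<in> V" for a b
  proof -
    have "(1/2) *\<^sub>R (a + b) \<in> V"
      using sub that by (intro subspace_scale subspace_add)
    then have "d\<^sup>2 \<le> (norm (x - (1/2) *\<^sub>R (a + b)))\<^sup>2"
      using dle d0 by (intro power_mono) auto
    moreover have "4 * (norm (x - (1/2) *\<^sub>R (a + b)))\<^sup>2 =
        2 * (norm (x - a))\<^sup>2 + 2 * (norm (x - b))\<^sup>2 - (norm (a - b))\<^sup>2"
      unfolding power2_norm_eq_inner
      by (simp add: inner_commute algebra_simps)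
    ultimately show ?thesis by linarith
  qed
  have "Cauchy v"
  proof (rule metric_CauchyI)
    fix e :: real assume e: "0 < e"
    \<comment> \<open>\<open>K\<close> is \<open>4 * (2 * d + 1)\<close>: two squared distances,
      each doubled and each exceeding \<open>d\<^sup>2\<close> by at most
      \<open>(2 * d + 1) / Suc N\<close>.\<close>
    define K where "K = 8 * d + 4"
    have K: "0 < K" using d0 by (simp add: K_def)
    obtain N :: nat where N: "K / e\<^sup>2 < N" using reals_Archimedean2 by blast
    have "dist (v m) (v n) < e" if mn: "m \<ge> N" "n \<ge> N" for m n
    proof -
      have sq: "(norm (x - v k))\<^sup>2 \<le> d\<^sup>2 + (2 * d + 1) / Suc N" if "k \<ge> N" for k
      proof -
        have "1 / real (Suc k) \<le> 1 / Suc N" using that by (simp add: frac_le)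
        then have "norm (x - v k) \<le> d + 1 / Suc N" using v(2)[of k] by linarith
        then have "(norm (x - v k))\<^sup>2 \<le> (d + 1 / Suc N)\<^sup>2" by (intro power_mono) auto
        also have "\<dots> = d\<^sup>2 + 2 * d / Suc N + (1 / Suc N) * (1 / Suc N)"
          by (simp add: power2_eq_square algebra_simps)
        also have "(1 / real (Suc N)) * (1 / Suc N) \<le> 1 * (1 / Suc N)"
          by (intro mult_right_mono) auto
        finally show ?thesis by (simp add: add_divide_distrib)
      qed
      have "(norm (v m - v n))\<^sup>2 \<le> 2 * (norm (x - v m))\<^sup>2 + 2 * (norm (x - v n))\<^sup>2 - 4 * d\<^sup>2"
        by (rule key[OF v(1) v(1)])
      also have "\<dots> \<le> 4 * ((2 * d + 1) / Suc N)"
        using sq[OF mn(1)] sq[OF mn(2)] by linarith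
      also have "\<dots> = K / Suc N" by (simp add: K_def)
      also have "\<dots> < e\<^sup>2"
      proof -
        have "K < real N * e\<^sup>2" using N e by (simp add: divide_less_eq)
        also have "\<dots> \<le> Suc N * e\<^sup>2" by (intro mult_right_mono) auto
        finally show ?thesis by (simp add: divide_less_eq mult.commute)
      qed
      finally show ?thesis unfolding dist_norm by (rule power2_less_imp_less) (use e in simp)
    qed
    then show "\<exists>M. \<forall>m\<ge>M. \<forall>n\<ge>M. dist (v m) (v n) < e" by blast
  qed
  then obtain u where u: "v \<longlonglongrightarrow> u" using Cauchy_convergent convergent_def by blast
  have uV: "u \<in> V" using closed_sequentially[OF cl _ u] v(1) by blast
  have "norm (x - u) \<le> d"
  proof (rule LIMSEQ_le)
    show "(\<lambda>n. norm (x - v n)) \<longlonglongrightarrow> norm (x - u)" by (intro tendsto_intros u)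
    show "(\<lambda>n. d + 1 / Suc n) \<longlonglongrightarrow> d" using LIMSEQ_inverse_real_of_nat_add[of d]
      by (simp add: inverse_eq_divide)
    show "\<exists>N. \<forall>n\<ge>N. norm (x - v n) \<le> d + 1 / Suc n" using v(2) less_imp_le by blast
  qed
  then have min: "norm (x - u) \<le> norm (x - w)" if "w \<in> V" for w
    using dle[OF that] by linarith
  have "inner (x - u) w = 0" if w: "w \<in> V" for w
  proof (cases "w = 0")
    case False
    \<comment> \<open>The minimizer of the quadratic that sends \<open>t\<close> to the squared norm
      of \<open>x - u - t *\<^sub>R w\<close>.\<close>
    define t where "t = inner (x - u) w / inner w w"
    have ww: "inner w w > 0" using False by simp
    have "u + t *\<^sub>R w \<in> V" using sub w uV by (intro subspace_add subspace_scale)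
    then have "(norm (x - u))\<^sup>2 \<le> (norm (x - u - t *\<^sub>R w))\<^sup>2"
      using min by (intro power_mono) (auto simp: algebra_simps)
    also have "\<dots> = (norm (x - u))\<^sup>2 - 2 * t * inner (x - u) w + t\<^sup>2 * inner w w"
      unfolding power2_norm_eq_inner
      by (simp add: inner_commute algebra_simps power2_eq_square)
    also have "\<dots> = (norm (x - u))\<^sup>2 - (inner (x - u) w)\<^sup>2 / inner w w"
      using ww by (simp add: t_def power2_eq_square field_simps)
    finally have "(inner (x - u) w)\<^sup>2 \<le> 0" using ww by (simp add: divide_le_0_iff)
    then show ?thesis by simp
  qed simp
  then show ?thesis using that uV by blast
qed

definition proj :: "'a::{real_inner, complete_space} set \<Rightarrow> 'a \<Rightarrow> 'a"
  where "proj V x = (SOME v. v \<in> V \<and> (\<forall>w\<in>V. inner (x - v) w = 0))"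

lemma
  fixes V :: "'a::{real_inner, complete_space} set"
  assumes "subspace V" "closed V"
  shows proj_in: "proj V x \<in> V"
    and proj_orthogonal: "w \<in> V \<Longrightarrow> inner (x - proj V x) w = 0"
proof -
  have "\<exists>v. v \<in> V \<and> (\<forall>w\<in>V. inner (x - v) w = 0)"
    by (rule closed_subspace_decomposition[OF assms, of x]) blast
  from someI_ex[OF this]
  have "proj V x \<in> V \<and> (\<forall>w\<in>V. inner (x - proj V x) w = 0)"
    unfolding proj_def .
  then show "proj V x \<in> V" "w \<in> V \<Longrightarrow> inner (x - proj V x) w = 0" by simp_all
qed

lemma proj_unique:
  fixes V :: "'a::{real_inner, complete_space} set"
  assumes V: "subspace V" "closed V" and v: "v \<in> V" "\<And>w. w \<in> V \<Longrightarrow> inner (x - v) w = 0"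
  shows "proj V x = v"
proof -
  let ?u = "proj V x - v"
  have u: "?u \<in> V" using subspace_diff[OF V(1) proj_in[OF V] v(1)] .
  have "inner ?u ?u = inner (x - v) ?u - inner (x - proj V x) ?u"
    by (simp add: inner_diff_left)
  also have "\<dots> = 0" using v(2)[OF u] proj_orthogonal[OF V u] by simp
  finally show ?thesis by simp
qed

lemma proj_id:
  fixes V :: "'a::{real_inner, complete_space} set"
  assumes "subspace V" "closed V" "v \<in> V"
  shows "proj V v = v"
  by (rule proj_unique) (use assms in auto)

lemma inner_proj_left:
  fixes V :: "'a::{real_inner, complete_space} set"
  assumes "subspace V" "closed V" "w \<in> V"
  shows "inner (proj V x) w = inner x w"
  using proj_orthogonal[OF assms, of x] by (simp add: inner_diff_left)

lemma norm_proj_squared: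
  fixes V :: "'a::{real_inner, complete_space} set"
  assumes V: "subspace V" "closed V"
  shows "(norm (proj V x))\<^sup>2 = inner x (proj V x)"
  using inner_proj_left[OF V proj_in[OF V], of x x] by (simp add: power2_norm_eq_inner)

lemma norm_proj_le:
  fixes V :: "'a::{real_inner, complete_space} set"
  assumes V: "subspace V" "closed V"
  shows "norm (proj V x) \<le> norm x"
proof (cases "proj V x = 0")
  case False
  have "(norm (proj V x))\<^sup>2 \<le> norm x * norm (proj V x)"
    unfolding norm_proj_squared[OF V] by (rule norm_cauchy_schwarz)
  then show ?thesis using False by (simp add: power2_eq_square)
qed simp

lemma bounded_linear_proj:
  fixes V :: "'a::{real_inner, complete_space} set"
  assumes V: "subspace V" "closed V"
  shows "bounded_linear (proj V)"
proof (rule bounded_linear_intro[where K = 1])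
  fix x y and r :: real
  show "proj V (x + y) = proj V x + proj V y"
    by (rule proj_unique[OF V])
      (simp_all add: subspace_add V proj_in inner_proj_left inner_add_left inner_diff_left)
  show "proj V (r *\<^sub>R x) = r *\<^sub>R proj V x"
    by (rule proj_unique[OF V])
      (simp_all add: subspace_scale V proj_in inner_proj_left inner_diff_left)
  show "norm (proj V x) \<le> norm x * 1" using norm_proj_le[OF V] by simp
qed

text \<open>An operator that preserves \<open>V\<close> together with its adjoint also preserves the
  orthogonal complement. Scalars, left and right multiplication and conjugation are all handled by
  this.\<close>

lemma proj_commute:
  fixes V :: "'a::{real_inner, complete_space} set"
  assumes V: "subspace V" "closed V"
    and U: "\<And>v. v \<in> V \<Longrightarrow> U v \<in> V" and U': "\<And>v. v \<in> V \<Longrightarrow> U' v \<in> V"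
    and adjoint: "\<And>v w. inner (U v) w = inner v (U' w)"
  shows "proj V (U x) = U (proj V x)"
  by (rule proj_unique[OF V])
    (simp_all add: U V proj_in inner_diff_left adjoint inner_proj_left U')

lemma riesz_representation:
  fixes \<phi> :: "'a::{real_inner, complete_space} \<Rightarrow> real"
  assumes \<phi>: "bounded_linear \<phi>"
  obtains u where "\<And>x. \<phi> x = inner x u"
proof (cases "\<forall>x. \<phi> x = 0")
  case True
  then show ?thesis using that[of 0] by simp
next
  case False
  interpret bounded_linear \<phi> by (rule \<phi>)
  define K where "K = {x. \<phi> x = 0}"
  obtain x0 where x0: "\<phi> x0 \<noteq> 0" using False by blast
  have V: "subspace K" "closed K"
    unfolding K_def
    by (auto simp: subspace_def add scaleR zero intro!: closed_Collect_eq continuous_intros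
        linear_continuous_on \<phi>)
  define u where "u = x0 - proj K x0"
  have u: "\<phi> u \<noteq> 0" using proj_in[OF V, of x0] x0 by (simp add: u_def diff K_def)
  then have uu: "inner u u \<noteq> 0" using zero by auto
  have "\<phi> x = inner x ((\<phi> u / inner u u) *\<^sub>R u)" for x
  proof -
    have "x - (\<phi> x / \<phi> u) *\<^sub>R u \<in> K" using u by (simp add: K_def diff scaleR)
    then have "inner u (x - (\<phi> x / \<phi> u) *\<^sub>R u) = 0"
      using proj_orthogonal[OF V] by (simp add: u_def)
    then have "inner x u = (\<phi> x / \<phi> u) * inner u u"
      by (simp add: inner_diff_right inner_commute)
    then show ?thesis using u uu by simp
  qed
  then show ?thesis by (rule that)
qed

section \<open>The space of square-summable functions\<close>

lemma ell2_apply_zero [simp]: "ell2_apply 0 x = 0" by (simp add: zero_ell2.rep_eq)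
lemma ell2_apply_plus [simp]: "ell2_apply (f + g) x = ell2_apply f x + ell2_apply g x"
  by (simp add: plus_ell2.rep_eq)
lemma ell2_apply_minus [simp]: "ell2_apply (f - g) x = ell2_apply f x - ell2_apply g x"
  by (simp add: minus_ell2_def uminus_ell2.rep_eq del: add_uminus_conv_diff)
lemma ell2_apply_scale [simp]: "ell2_apply (c \<cdot>\<^sub>C f) x = c * ell2_apply f x"
  by (simp add: scale_ell2.rep_eq)
lemma ell2_apply_scaleR [simp]: "ell2_apply (r *\<^sub>R f) x = of_real r * ell2_apply f x"
  by (simp add: scaleR_ell2_def)
lemma ell2_apply_delta: "ell2_apply (delta x) y = of_bool (y = x)"
  by (simp add: delta.rep_eq)

lemma square_summable: "(\<lambda>x. (cmod (ell2_apply f x))\<^sup>2) summable_on A"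
  using ell2_apply[of f] by (auto intro: summable_on_subset_banach)

lemma cinner_add_right: "cinner f (g + h) = cinner f g + cinner f h"
  using cinner_add_left[of g h f] by (metis cinner_commute complex_cnj_add)

lemma cinner_scale_right: "cinner f (c \<cdot>\<^sub>C g) = cnj c * cinner f g"
  using cinner_scale_left[of c g f] by (metis cinner_commute complex_cnj_mult)

lemma cinner_zero [simp]: "cinner 0 f = 0" "cinner f 0 = 0"
  by (simp_all add: cinner.rep_eq)

lemma cinner_diff_left: "cinner (f - g) h = cinner f h - cinner g h"
  using cinner_add_left[of "f - g" g h] by simp

lemma cinner_diff_right: "cinner f (g - h) = cinner f g - cinner f h"
  using cinner_add_right[of f "g - h" h] by simp

lemma cinner_sum_left: "cinner (sum f A) g = (\<Sum>i\<in>A. cinner (f i) g)"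
  by (induction A rule: infinite_finite_induct) (simp_all add: cinner_add_left)

lemma inner_ell2: "inner f g = Re (cinner f g)"
  by (simp add: inner_ell2_def)

lemma cinner_self_norm: "cinner f f = of_real ((norm f)\<^sup>2)"
  unfolding power2_norm_eq_inner inner_ell2 by (simp add: cinner_self)

lemma norm_squared: "(norm f)\<^sup>2 = (\<Sum>\<^sub>\<infinity>x. (cmod (ell2_apply f x))\<^sup>2)"
  using cinner_self_norm[of f] unfolding cinner_self of_real_eq_iff by simp

text \<open>Transfers statements about real orthogonal projections to the complex form when the
  subspace is closed under multiplication by \<open>\<i>\<close>.\<close>

lemma cinner_eq_inner: "cinner f g = Complex (inner f g) (inner f (\<i> \<cdot>\<^sub>C g))"
  by (simp add: inner_ell2 cinner_scale_right complex_eq_iff)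

lemma cmod_cinner_le: "cmod (cinner f g) \<le> norm f * norm g"
proof (cases "cinner f g = 0")
  case False
  define c where "c = cnj (cinner f g) / cmod (cinner f g)"
  have c: "cmod c = 1" using False by (simp add: c_def norm_divide)
  have "cinner (c \<cdot>\<^sub>C f) g = cnj (cinner f g) * cinner f g / cmod (cinner f g)"
    by (simp add: cinner_scale_left c_def)
  also have "\<dots> = cmod (cinner f g)"
    using False complex_norm_square[of "cinner f g"]
    by (simp add: mult.commute[of "cnj _"] power2_eq_square divide_eq_eq)
  finally have "cmod (cinner f g) = inner (c \<cdot>\<^sub>C f) g" by (simp add: inner_ell2)
  also have "\<dots> \<le> norm (c \<cdot>\<^sub>C f) * norm g" by (rule norm_cauchy_schwarz)
  also have "\<dots> = norm f * norm g" by (simp add: norm_scale_ell2 c)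
  finally show ?thesis .
qed simp

lemma cinner_delta_right: "cinner f (delta x) = ell2_apply f x"
proof -
  have "cinner f (delta x) = (\<Sum>\<^sub>\<infinity>y\<in>{x}. ell2_apply f y)"
    unfolding cinner.rep_eq by (rule infsum_cong_neutral) (auto simp: ell2_apply_delta)
  then show ?thesis by simp
qed

lemma cinner_delta_left: "cinner (delta x) f = cnj (ell2_apply f x)"
  by (subst cinner_commute) (simp add: cinner_delta_right)

lemma norm_delta [simp]: "norm (delta x) = 1"
proof -
  have "complex_of_real ((norm (delta x))\<^sup>2) = 1"
    unfolding cinner_self_norm[symmetric] cinner_delta_right by (simp add: ell2_apply_delta)
  then have "(norm (delta x))\<^sup>2 = 1" by (simp only: of_real_eq_1_iff)
  then show ?thesis by (simp add: power2_eq_1_iff) (metis norm_ge_zero neg_0_le_iff_le not_one_le_zero)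
qed

lemma cmod_apply_le: "cmod (ell2_apply f x) \<le> norm f"
  using cmod_cinner_le[of f "delta x"] by (simp add: cinner_delta_right)

lemma bounded_linear_apply: "bounded_linear (\<lambda>f. ell2_apply f x)"
  by (rule bounded_linear_intro[where K = 1])
    (simp_all add: scaleR_conv_of_real cmod_apply_le)

lemma finite_sum_le_norm:
  "finite F \<Longrightarrow> (\<Sum>x\<in>F. (cmod (ell2_apply f x))\<^sup>2) \<le> (norm f)\<^sup>2"
  unfolding norm_squared by (rule finite_sum_le_infsum) (auto intro: square_summable)

lemma square_summableI:
  assumes "\<And>F. finite F \<Longrightarrow> (\<Sum>x\<in>F. (cmod (f x))\<^sup>2) \<le> B"
  shows "(\<lambda>x. (cmod (f x))\<^sup>2) summable_on UNIV"
  by (rule nonneg_bdd_above_summable_on) (auto intro!: bdd_aboveI[of _ B] assms)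

lemma Abs_ell2_apply:
  "(\<lambda>x. (cmod (f x))\<^sup>2) summable_on UNIV \<Longrightarrow> ell2_apply (Abs_ell2 f) = f"
  by (rule Abs_ell2_inverse) simp

lemma norm_leI:
  assumes "\<And>F. finite F \<Longrightarrow> (\<Sum>x\<in>F. (cmod (ell2_apply f x))\<^sup>2) \<le> B\<^sup>2" "0 \<le> B"
  shows "norm f \<le> B"
proof -
  have "(norm f)\<^sup>2 \<le> B\<^sup>2"
    unfolding norm_squared by (rule infsum_le_finite_sums[OF square_summable assms(1)]) auto
  then show ?thesis using assms(2) by (rule power2_le_imp_le)
qed

instance ell2 :: (type) complete_space
proof
  fix X :: "nat \<Rightarrow> 'a ell2" assume X: "Cauchy X"
  have "Cauchy (\<lambda>n. ell2_apply (X n) x)" for x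
    using bounded_linear.Cauchy[OF bounded_linear_apply X] .
  then have "\<exists>l. (\<lambda>n. ell2_apply (X n) x) \<longlonglongrightarrow> l" for x
    by (simp add: Cauchy_convergent_iff convergent_def)
  then obtain l where l: "\<And>x. (\<lambda>n. ell2_apply (X n) x) \<longlonglongrightarrow> l x" by metis
  \<comment> \<open>Bounds are kept on finite sums, where the limit in \<open>m\<close> can be taken
    coordinate by coordinate.\<close>
  have tail: "(\<Sum>x\<in>F. (cmod (l x - ell2_apply (X n) x))\<^sup>2) \<le> e\<^sup>2"
    if "finite F" "e > 0" "\<And>m. m \<ge> n \<Longrightarrow> norm (X m - X n) \<le> e" for F n e
  proof (rule LIMSEQ_le_const2)
    show "(\<lambda>m. \<Sum>x\<in>F. (cmod (ell2_apply (X m) x - ell2_apply (X n) x))\<^sup>2)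
      \<longlonglongrightarrow> (\<Sum>x\<in>F. (cmod (l x - ell2_apply (X n) x))\<^sup>2)"
      by (intro tendsto_intros l)
    have "(\<Sum>x\<in>F. (cmod (ell2_apply (X m) x - ell2_apply (X n) x))\<^sup>2) \<le> e\<^sup>2" if "m \<ge> n" for m
    proof -
      have "(\<Sum>x\<in>F. (cmod (ell2_apply (X m - X n) x))\<^sup>2) \<le> (norm (X m - X n))\<^sup>2"
        by (rule finite_sum_le_norm) fact
      also have "\<dots> \<le> e\<^sup>2"
        using \<open>\<And>m. m \<ge> n \<Longrightarrow> norm (X m - X n) \<le> e\<close>[OF \<open>m \<ge> n\<close>] by (intro power_mono) auto
      finally show ?thesis by simp
    qed
    then show "\<exists>N. \<forall>m\<ge>N. (\<Sum>x\<in>F. (cmod (ell2_apply (X m) x - ell2_apply (X n) x))\<^sup>2) \<le> e\<^sup>2"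
      by blast
  qed
  have Xe: "\<exists>n. \<forall>m\<ge>n. \<forall>k\<ge>n. norm (X m - X k) \<le> e" if "e > 0" for e
    using metric_CauchyD[OF X that] by (auto simp: dist_norm intro: less_imp_le)
  obtain n1 where n1: "\<forall>m\<ge>n1. \<forall>k\<ge>n1. norm (X m - X k) \<le> 1" using Xe[of 1] by auto
  have s1: "(\<lambda>x. (cmod (l x - ell2_apply (X n1) x))\<^sup>2) summable_on UNIV"
    by (rule square_summableI, rule tail[of _ 1 n1]) (use n1 in auto)
  have s2: "(\<lambda>x. (cmod (l x))\<^sup>2) summable_on UNIV"
    using square_summable_add[OF s1 square_summable[of "X n1"]] by simp
  define L where "L = Abs_ell2 l"
  have L: "ell2_apply L x = l x" for x by (simp add: L_def Abs_ell2_apply s2)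
  have "X \<longlonglongrightarrow> L"
  proof (rule metric_LIMSEQ_I)
    fix r :: real assume r: "0 < r"
    then obtain n where n: "\<forall>m\<ge>n. \<forall>k\<ge>n. norm (X m - X k) \<le> r / 2" using Xe[of "r/2"] by auto
    have "norm (L - X k) \<le> r / 2" if "k \<ge> n" for k
      by (rule norm_leI) (use tail[of _ "r/2" k] n that r in \<open>auto simp: L\<close>)
    then have "dist (X k) L < r" if "k \<ge> n" for k
      using that r by (fastforce simp: dist_norm norm_minus_commute)
    then show "\<exists>no. \<forall>n\<ge>no. dist (X n) L < r" by blast
  qed
  then show "convergent X" by (rule convergentI)
qed

subsection \<open>Operators induced by maps of the index sets\<close>

text \<open>For an injection, \<open>push\<close> is the induced isometry and \<open>pull\<close>
  its adjoint. Injections into a product give direct sums, bijections of a group give translations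
  and conjugations.\<close>

definition pull :: "('a \<Rightarrow> 'b) \<Rightarrow> 'b ell2 \<Rightarrow> 'a ell2"
  where "pull \<pi> f = Abs_ell2 (\<lambda>x. ell2_apply f (\<pi> x))"

lemma ell2_apply_pull: "inj \<pi> \<Longrightarrow> ell2_apply (pull \<pi> f) x = ell2_apply f (\<pi> x)"
  unfolding pull_def
  using square_summable[of f "range \<pi>"] by (subst Abs_ell2_apply) (auto simp: summable_on_reindex o_def)

definition push :: "('a \<Rightarrow> 'b) \<Rightarrow> 'a ell2 \<Rightarrow> 'b ell2"
  where "push \<pi> f = Abs_ell2 (\<lambda>y. if y \<in> range \<pi> then ell2_apply f (inv_into UNIV \<pi> y) else 0)"

lemma ell2_apply_push:
  assumes "inj \<pi>"
  shows "ell2_apply (push \<pi> f) y = (if y \<in> range \<pi> then ell2_apply f (inv_into UNIV \<pi> y) else 0)"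
proof -
  have "(\<lambda>y. (cmod (ell2_apply f (inv_into UNIV \<pi> y)))\<^sup>2) summable_on range \<pi>"
    using square_summable[of f UNIV] assms by (subst summable_on_reindex) (auto simp: o_def)
  then have "(\<lambda>y. (cmod (if y \<in> range \<pi> then ell2_apply f (inv_into UNIV \<pi> y) else 0))\<^sup>2) summable_on UNIV"
    by (rule summable_on_cong_neutral[THEN iffD1, rotated -1]) auto
  then show ?thesis unfolding push_def by (subst Abs_ell2_apply) auto
qed

lemma cinner_push_left:
  assumes "inj \<pi>"
  shows "cinner (push \<pi> f) g = cinner f (pull \<pi> g)"
proof -
  have "cinner (push \<pi> f) g = (\<Sum>\<^sub>\<infinity>y\<in>range \<pi>. ell2_apply f (inv_into UNIV \<pi> y) * cnj (ell2_apply g y))"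
    unfolding cinner.rep_eq
    by (rule infsum_cong_neutral) (auto simp: ell2_apply_push assms)
  also have "\<dots> = cinner f (pull \<pi> g)"
    unfolding cinner.rep_eq by (subst infsum_reindex) (auto simp: assms o_def ell2_apply_pull)
  finally show ?thesis .
qed

lemma pull_push: "inj \<pi> \<Longrightarrow> pull \<pi> (push \<pi> f) = f"
  by (rule ell2_eqI) (simp add: ell2_apply_pull ell2_apply_push)

lemma pull_push_disjoint:
  "inj \<pi> \<Longrightarrow> inj \<sigma> \<Longrightarrow> range \<pi> \<inter> range \<sigma> = {} \<Longrightarrow> pull \<pi> (push \<sigma> f) = 0"
  by (rule ell2_eqI) (auto simp: ell2_apply_pull ell2_apply_push)

lemma norm_push: "inj \<pi> \<Longrightarrow> norm (push \<pi> f) = norm f"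
  using cinner_self_norm[of "push \<pi> f"] cinner_self_norm[of f]
  by (simp only: cinner_push_left pull_push of_real_eq_iff)
    (metis norm_ge_zero power2_eq_imp_eq)

lemma norm_pull_le:
  assumes "inj \<pi>" shows "norm (pull \<pi> f) \<le> norm f"
proof -
  have "(norm (pull \<pi> f))\<^sup>2 = inner (push \<pi> (pull \<pi> f)) f"
    by (simp add: power2_norm_eq_inner inner_ell2 cinner_push_left assms)
  also have "\<dots> \<le> norm (push \<pi> (pull \<pi> f)) * norm f" by (rule norm_cauchy_schwarz)
  finally have "norm (pull \<pi> f) * norm (pull \<pi> f) \<le> norm (pull \<pi> f) * norm f"
    by (simp add: norm_push assms power2_eq_square)
  then show ?thesis by (cases "norm (pull \<pi> f) = 0") auto
qed

lemma
  assumes "inj \<pi>"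
  shows pull_add: "pull \<pi> (f + g) = pull \<pi> f + pull \<pi> g"
    and pull_scale: "pull \<pi> (c \<cdot>\<^sub>C f) = c \<cdot>\<^sub>C pull \<pi> f"
    and pull_scaleR: "pull \<pi> (r *\<^sub>R f) = r *\<^sub>R pull \<pi> f"
  by (rule ell2_eqI, simp add: ell2_apply_pull assms)+

lemma
  assumes "inj \<pi>"
  shows push_add: "push \<pi> (f + g) = push \<pi> f + push \<pi> g"
    and push_scale: "push \<pi> (c \<cdot>\<^sub>C f) = c \<cdot>\<^sub>C push \<pi> f"
    and push_scaleR: "push \<pi> (r *\<^sub>R f) = r *\<^sub>R push \<pi> f"
  by (rule ell2_eqI, simp add: ell2_apply_push assms)+

lemma bounded_linear_pull: "inj \<pi> \<Longrightarrow> bounded_linear (pull \<pi>)"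
  by (rule bounded_linear_intro[where K = 1]) (simp_all add: pull_add pull_scaleR norm_pull_le)

lemma bounded_linear_push: "inj \<pi> \<Longrightarrow> bounded_linear (push \<pi>)"
  by (rule bounded_linear_intro[where K = 1]) (simp_all add: push_add push_scaleR norm_push)

lemma cinner_pull_pull:
  assumes "bij \<pi>" shows "cinner (pull \<pi> f) (pull \<pi> g) = cinner f g"
  unfolding cinner.rep_eq ell2_apply_pull[OF bij_is_inj[OF assms]]
  by (rule infsum_reindex_bij_betw[OF assms, of "\<lambda>x. ell2_apply f x * cnj (ell2_apply g x)"])

lemma norm_pull:
  assumes "bij \<pi>" shows "norm (pull \<pi> f) = norm f"
  by (simp add: norm_ell2_def inner_ell2 cinner_pull_pull assms)

definition cnj_ell2 :: "'a ell2 \<Rightarrow> 'a ell2"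
  where "cnj_ell2 f = Abs_ell2 (\<lambda>x. cnj (ell2_apply f x))"

lemma ell2_apply_cnj [simp]: "ell2_apply (cnj_ell2 f) x = cnj (ell2_apply f x)"
  unfolding cnj_ell2_def using square_summable[of f UNIV] by (subst Abs_ell2_apply) auto

lemma cinner_cnj: "cinner (cnj_ell2 f) (cnj_ell2 g) = cnj (cinner f g)"
  unfolding cinner.rep_eq infsum_cnj[symmetric] by simp

lemma norm_cnj: "norm (cnj_ell2 f) = norm f"
  by (simp add: norm_ell2_def inner_ell2 cinner_cnj)

lemma bounded_linear_cnj: "bounded_linear cnj_ell2"
  by (rule bounded_linear_intro[where K = 1]) (auto intro!: ell2_eqI simp: norm_cnj)

definition trunc :: "'a set \<Rightarrow> 'a ell2 \<Rightarrow> 'a ell2"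
  where "trunc S f = Abs_ell2 (\<lambda>x. if x \<in> S then ell2_apply f x else 0)"

lemma ell2_apply_trunc: "ell2_apply (trunc S f) x = (if x \<in> S then ell2_apply f x else 0)"
proof -
  have "(\<lambda>x. (cmod (if x \<in> S then ell2_apply f x else 0))\<^sup>2) summable_on UNIV"
    by (rule summable_on_comparison_test[OF square_summable[of f UNIV]]) auto
  then show ?thesis unfolding trunc_def by (subst Abs_ell2_apply) auto
qed

lemma norm_trunc_le: "norm (trunc S f) \<le> norm f"
proof (rule norm_leI)
  fix F :: "'a set" assume "finite F"
  have "(\<Sum>x\<in>F. (cmod (ell2_apply (trunc S f) x))\<^sup>2) \<le> (\<Sum>x\<in>F. (cmod (ell2_apply f x))\<^sup>2)"
    by (intro sum_mono) (simp add: ell2_apply_trunc)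
  also have "\<dots> \<le> (norm f)\<^sup>2" by (rule finite_sum_le_norm) fact
  finally show "(\<Sum>x\<in>F. (cmod (ell2_apply (trunc S f) x))\<^sup>2) \<le> (norm f)\<^sup>2" .
qed simp

text \<open>The estimate holds for all larger \<open>T\<close> as well, because the finite set is
  later enlarged by a prescribed point.\<close>

lemma trunc_approximates:
  assumes "0 < e"
  obtains S where "finite S" "\<And>T. S \<subseteq> T \<Longrightarrow> norm (f - trunc T f) < e"
proof -
  let ?h = "\<lambda>x. (cmod (ell2_apply f x))\<^sup>2"
  have "(?h has_sum (norm f)\<^sup>2) UNIV"
    using square_summable[of f UNIV] by (simp add: norm_squared)
  then have "\<forall>\<^sub>F F in finite_subsets_at_top UNIV. dist (sum ?h F) ((norm f)\<^sup>2) < e\<^sup>2 / 4"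
    using assms unfolding has_sum_def by (intro tendstoD) auto
  then obtain S where S: "finite S" "\<And>F. finite F \<Longrightarrow> S \<subseteq> F \<Longrightarrow> dist (sum ?h F) ((norm f)\<^sup>2) < e\<^sup>2 / 4"
    unfolding eventually_finite_subsets_at_top by auto
  have half: "norm (f - trunc T f) \<le> e / 2" if T: "S \<subseteq> T" for T
  proof (rule norm_leI)
    fix F :: "'a set" assume F: "finite F"
    have "(\<Sum>x\<in>F. (cmod (ell2_apply (f - trunc T f) x))\<^sup>2) = sum ?h (F - T)"
      using F by (auto simp: ell2_apply_trunc intro!: sum.mono_neutral_cong_right)
    also have "\<dots> \<le> sum ?h (F - S)" by (rule sum_mono2) (use F T in auto)
    also have "\<dots> = sum ?h (F \<union> S) - sum ?h S"
      using F S(1) by (simp add: sum_diff[symmetric] Un_Diff)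
    also have "\<dots> \<le> (norm f)\<^sup>2 - sum ?h S"
      using finite_sum_le_norm[of "F \<union> S" f] F S(1) by simp
    also have "\<dots> \<le> (e / 2)\<^sup>2"
    proof -
      have "\<bar>sum ?h S - (norm f)\<^sup>2\<bar> < e\<^sup>2 / 4" using S(2)[OF S(1)] by (simp add: dist_real_def)
      moreover have "(e / 2)\<^sup>2 = e\<^sup>2 / 4" by (simp add: power_divide)
      ultimately show ?thesis by linarith
    qed
    finally show "(\<Sum>x\<in>F. (cmod (ell2_apply (f - trunc T f) x))\<^sup>2) \<le> (e / 2)\<^sup>2" .
  qed (use assms in auto)
  show ?thesis
  proof (rule that[OF S(1)])
    fix T assume "S \<subseteq> T"
    from half[OF this] show "norm (f - trunc T f) < e" using assms by linarith
  qed
qed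

section \<open>Operators\<close>

lemma bounded_opsD: "T \<in> bounded_ops \<Longrightarrow> blinfun_apply T (c \<cdot>\<^sub>C f) = c \<cdot>\<^sub>C blinfun_apply T f"
  by (simp add: bounded_ops_def)

text \<open>\<open>adj\<close> is a definite description, so an adjoint has to be constructed first.
  Riesz representation yields one for the real inner product, and complex linearity of
  \<open>T\<close> makes it an adjoint for \<open>cinner\<close>.\<close>

lemma cinner_adj_exists:
  assumes T: "T \<in> bounded_ops"
  obtains S where "\<And>f g. cinner (blinfun_apply T f) g = cinner f (blinfun_apply S g)"
proof -
  have "\<exists>u. \<forall>f. inner (blinfun_apply T f) g = inner f u" for g
    by (rule riesz_representation[of "\<lambda>f. inner (blinfun_apply T f) g"])
      (auto intro!: bounded_linear_intros)
  then obtain S where S: "\<And>f g. inner (blinfun_apply T f) g = inner f (S g)" by metis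
  have cS: "cinner (blinfun_apply T f) g = cinner f (S g)" for f g
  proof -
    have "inner (blinfun_apply T f) (\<i> \<cdot>\<^sub>C g) = inner (blinfun_apply T (- \<i> \<cdot>\<^sub>C f)) g" for f g
      by (simp only: inner_ell2 cinner_scale_right bounded_opsD[OF T] cinner_scale_left) simp
    also have "inner (blinfun_apply T (- \<i> \<cdot>\<^sub>C f)) g = inner f (\<i> \<cdot>\<^sub>C S g)" for f g
      unfolding S by (simp add: inner_ell2 cinner_scale_right cinner_scale_left)
    finally show ?thesis by (simp add: cinner_eq_inner S)
  qed
  have "bounded_linear S"
  proof (rule bounded_linear_intro[where K = "norm T"])
    fix f g :: "'a ell2" and r :: real
    show "S (f + g) = S f + S g"
      by (rule cinner_eqI) (simp add: cS[symmetric] cinner_add_right)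
    show "S (r *\<^sub>R f) = r *\<^sub>R S f"
      by (rule cinner_eqI) (simp add: cS[symmetric] cinner_scale_right scaleR_ell2_def)
    have "norm (S f) * norm (S f) = inner (blinfun_apply T (S f)) f"
      by (simp add: S power2_norm_eq_inner[symmetric] power2_eq_square)
    also have "\<dots> \<le> norm (blinfun_apply T (S f)) * norm f" by (rule norm_cauchy_schwarz)
    also have "\<dots> \<le> (norm T * norm (S f)) * norm f"
      by (intro mult_right_mono norm_blinfun) simp
    finally show "norm (S f) \<le> norm f * norm T"
      by (cases "norm (S f) = 0") (auto simp: mult_ac)
  qed
  then have S': "blinfun_apply (Blinfun S) = S" by (rule bounded_linear_Blinfun_apply)
  show ?thesis by (rule that[of "Blinfun S"]) (simp add: S' cS)
qed

lemma cinner_adj: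
  assumes T: "T \<in> bounded_ops"
  shows "cinner (blinfun_apply T f) g = cinner f (blinfun_apply (adj T) g)"
proof -
  obtain S where S: "\<And>f g. cinner (blinfun_apply T f) g = cinner f (blinfun_apply S g)"
    using cinner_adj_exists[OF T] by blast
  then have "adj T = S" by (intro adjI)
  then show ?thesis using S by simp
qed

text \<open>Moving the operator to the other side of the inner product avoids interchanging it with
  an infinite sum.\<close>

lemma ell2_apply_blinfun:
  assumes T: "T \<in> bounded_ops"
  shows "ell2_apply (blinfun_apply T f) x = (\<Sum>\<^sub>\<infinity>y. ell2_apply f y * ell2_apply (blinfun_apply T (delta y)) x)"
proof -
  have "ell2_apply (blinfun_apply T f) x = cinner f (blinfun_apply (adj T) (delta x))"
    by (simp add: cinner_delta_right[symmetric] cinner_adj[OF T])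
  also have "\<dots> = (\<Sum>\<^sub>\<infinity>y. ell2_apply f y * ell2_apply (blinfun_apply T (delta y)) x)"
    unfolding cinner.rep_eq
  proof (rule infsum_cong)
    fix y
    have "cnj (ell2_apply (blinfun_apply (adj T) (delta x)) y)
        = cinner (delta y) (blinfun_apply (adj T) (delta x))" by (simp add: cinner_delta_left)
    also have "\<dots> = ell2_apply (blinfun_apply T (delta y)) x"
      by (simp add: cinner_adj[OF T, symmetric] cinner_delta_right)
    finally show "ell2_apply f y * cnj (ell2_apply (blinfun_apply (adj T) (delta x)) y)
      = ell2_apply f y * ell2_apply (blinfun_apply T (delta y)) x" by simp
  qed
  finally show ?thesis .
qed

lemma bounded_ops_eqI:
  assumes "S \<in> bounded_ops" "T \<in> bounded_ops"
    and "\<And>x. blinfun_apply S (delta x) = blinfun_apply T (delta x)"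
  shows "S = T"
proof (intro blinfun_eqI ell2_eqI)
  fix f x
  show "ell2_apply (blinfun_apply S f) x = ell2_apply (blinfun_apply T f) x"
    using ell2_apply_blinfun[OF assms(1), of f x] ell2_apply_blinfun[OF assms(2), of f x]
    by (simp only: assms(3))
qed

lemma bounded_ops_compose: "S \<in> bounded_ops \<Longrightarrow> T \<in> bounded_ops \<Longrightarrow> S o\<^sub>L T \<in> bounded_ops"
  by (simp add: bounded_ops_def)

lemma topspace_wot: "topspace weak_operator_topology = bounded_ops"
  by (simp add: weak_operator_topology_def topspace_pullback_topology)

lemma continuous_map_coefficient:
  "continuous_map weak_operator_topology euclidean (\<lambda>T. cinner (blinfun_apply T f) g)"
proof -
  have "continuous_map weak_operator_topology euclidean
      ((\<lambda>c. c (f, g)) \<circ> (\<lambda>T (f, g). cinner (blinfun_apply T f) g))"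
    unfolding weak_operator_topology_def
    by (intro continuous_map_pullback) (auto intro: continuous_intros)
  then show ?thesis by (simp add: o_def)
qed

lemma closedin_coefficients_eq:
  "closedin weak_operator_topology
    {T \<in> bounded_ops. cinner (blinfun_apply T f) g = cinner (blinfun_apply T f') g'}"
proof -
  have "closedin weak_operator_topology
    {T \<in> topspace weak_operator_topology. cinner (blinfun_apply T f) g = cinner (blinfun_apply T f') g'}"
    by (rule closedin_continuous_maps_eq[OF _ continuous_map_coefficient continuous_map_coefficient])
      simp
  then show ?thesis by (simp add: topspace_wot)
qed

lemma strong_approximation_in_wot_closure:
  assumes T: "T \<in> bounded_ops"
    and approx: "\<And>I e. finite I \<Longrightarrow> e > 0 \<Longrightarrow>
      \<exists>S\<in>A. \<forall>f\<in>I. norm (blinfun_apply S f - blinfun_apply T f) < e"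
    and A: "A \<subseteq> bounded_ops"
  shows "T \<in> weak_operator_topology closure_of A"
  unfolding in_closure_of topspace_wot
proof (intro conjI allI impI T, elim conjE)
  let ?c = "\<lambda>T (f, g). cinner (blinfun_apply T f) g"
  fix W :: "('a ell2 \<Rightarrow>\<^sub>L 'a ell2) set"
  assume TW: "T \<in> W" and "openin weak_operator_topology W"
  then obtain U where U: "open U" "W = ?c -` U \<inter> bounded_ops"
    by (auto simp: weak_operator_topology_def openin_pullback_topology)
  have "openin (product_topology (\<lambda>i. euclidean) UNIV) U"
    using U(1) by (simp add: euclidean_product_topology)
  from product_topology_open_contains_basis[OF this, of "?c T"] TW U(2)
  obtain X where X: "?c T \<in> Pi\<^sub>E UNIV X" "\<And>i. open (X i)" "finite {i. X i \<noteq> UNIV}" "Pi\<^sub>E UNIV X \<subseteq> U"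
    by auto
  define J where "J = {i. X i \<noteq> UNIV}"
  have "\<exists>e>0. \<forall>z. dist z (?c T i) < e \<longrightarrow> z \<in> X i" for i
    using X(1,2) open_dist by (metis (no_types, lifting) PiE_mem UNIV_I)
  then obtain e where e: "\<And>i. e i > 0" "\<And>i z. dist z (?c T i) < e i \<Longrightarrow> z \<in> X i" by metis
  \<comment> \<open>By Cauchy-Schwarz the coefficient at \<open>(f, g)\<close> moves by at most
    \<open>d * norm g\<close>. The \<open>+ 1\<close> keeps the divisor positive, and the inserted 1
    keeps the set nonempty when \<open>J\<close> is empty.\<close>
  define d where "d = Min (insert 1 ((\<lambda>i. e i / (norm (snd i) + 1)) ` J))"
  have J: "finite J" using X(3) by (simp add: J_def)
  have d: "d > 0" using J e(1) by (auto simp: d_def intro!: divide_pos_pos add_nonneg_pos)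
  obtain S where S: "S \<in> A" "\<And>f. f \<in> fst ` J \<Longrightarrow> norm (blinfun_apply S f - blinfun_apply T f) < d"
    using approx[of "fst ` J" d] J d by auto
  have "?c S i \<in> X i" for i
  proof (cases "i \<in> J")
    case True
    obtain f g where i: "i = (f, g)" by (cases i)
    have "f \<in> fst ` J" using True i by force
    have "e i / (norm (snd i) + 1) \<in> insert 1 ((\<lambda>i. e i / (norm (snd i) + 1)) ` J)"
      using True by blast
    then have "Min (insert 1 ((\<lambda>i. e i / (norm (snd i) + 1)) ` J)) \<le> e i / (norm (snd i) + 1)"
      using J by (intro Min_le) simp_all
    then have "d \<le> e i / (norm g + 1)" by (simp only: d_def i snd_conv)
    then have dg: "d * (norm g + 1) \<le> e i" by (simp add: pos_le_divide_eq add_nonneg_pos)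
    have "dist (?c S i) (?c T i) = cmod (cinner (blinfun_apply S f - blinfun_apply T f) g)"
      by (simp add: i dist_norm cinner_diff_left)
    also have "\<dots> \<le> norm (blinfun_apply S f - blinfun_apply T f) * norm g" by (rule cmod_cinner_le)
    also have "\<dots> \<le> d * norm g" using S(2)[OF \<open>f \<in> fst ` J\<close>] by (intro mult_right_mono) auto
    also have "\<dots> < e i" using dg d by (simp add: algebra_simps)
    finally show ?thesis by (rule e(2))
  qed (simp add: J_def)
  then have "?c S \<in> U" using X(4) by (blast intro: PiE_I)
  then show "\<exists>y. y \<in> A \<and> y \<in> W" using S(1) A U(2) by auto
qed

subsection \<open>The double commutant theorem\<close>

lemma closure_invariant:
  assumes "continuous_on (closure W) g" "\<And>w. w \<in> W \<Longrightarrow> g w \<in> closure W" "v \<in> closure W"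
  shows "g v \<in> closure W"
  using image_closure_subset[OF assms(1) closed_closure] assms(2,3) by blast

lemma subspace_closure:
  fixes W :: "'a::real_normed_vector set"
  assumes W: "subspace W" shows "subspace (closure W)"
  unfolding subspace_def
proof (intro conjI ballI allI)
  show "0 \<in> closure W" using subspace_0[OF W] closure_subset by blast
  fix x assume x: "x \<in> closure W"
  show "c *\<^sub>R x \<in> closure W" for c
    by (rule closure_invariant[OF _ _ x])
      (use closure_subset[of W] subspace_scale[OF W] in \<open>auto intro!: continuous_intros\<close>)
  fix y assume y: "y \<in> closure W"
  obtain a b where "\<And>n. a n \<in> W" "a \<longlonglongrightarrow> x" "\<And>n. b n \<in> W" "b \<longlonglongrightarrow> y"
    using x y unfolding closure_sequential by blast
  then show "x + y \<in> closure W"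
    unfolding closure_sequential using W
    by (intro exI[of _ "\<lambda>n. a n + b n"]) (auto intro: subspace_add tendsto_add)
qed

lemma scale_add_right: "c \<cdot>\<^sub>C (f + g) = c \<cdot>\<^sub>C f + c \<cdot>\<^sub>C g"
  by (rule ell2_eqI) (simp add: algebra_simps)

lemma scale_sum_right: "c \<cdot>\<^sub>C sum f I = (\<Sum>i\<in>I. c \<cdot>\<^sub>C f i)"
  by (rule linear_sum[OF bounded_linear.linear[OF bounded_linear_scale_ell2]])

text \<open>Approximation at finitely many vectors is reduced to one vector of a direct sum. The
  projection onto the closed orbit of that vector has matrix entries commuting with
  \<open>A\<close>, hence with \<open>T\<close>, so the amplified \<open>T\<close> maps the vector
  into the closed orbit.\<close>

theorem double_commutant:
  fixes A :: "('a ell2 \<Rightarrow>\<^sub>L 'a ell2) set"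
  assumes A: "A \<subseteq> bounded_ops" "id_blinfun \<in> A" "ops.subspace A"
    and mult: "\<And>S T. S \<in> A \<Longrightarrow> T \<in> A \<Longrightarrow> S o\<^sub>L T \<in> A"
    and adjoint: "\<And>T. T \<in> A \<Longrightarrow> adj T \<in> A"
    and closed: "closedin weak_operator_topology A"
    and T: "T \<in> bounded_ops"
    and commute: "\<And>S. S \<in> bounded_ops \<Longrightarrow> (\<And>a. a \<in> A \<Longrightarrow> S o\<^sub>L a = a o\<^sub>L S) \<Longrightarrow> S o\<^sub>L T = T o\<^sub>L S"
  shows "T \<in> A"
proof -
  have "\<exists>a\<in>A. \<forall>f\<in>I. norm (blinfun_apply a f - blinfun_apply T f) < e"
    if I: "finite I" and e: "e > 0" for I :: "'a ell2 set" and e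
  proof -
    \<comment> \<open>The direct sum of copies of the space, one for each vector of \<open>I\<close>.\<close>
    define V where "V = (\<lambda>i :: 'a ell2. push (\<lambda>x :: 'a. (x, i)))"
    define C where "C = (\<lambda>i :: 'a ell2. pull (\<lambda>x :: 'a. (x, i)))"
    have inj: "inj (\<lambda>x :: 'a. (x, i))" for i :: "'a ell2" by (auto intro: injI)
    have CV: "C i (V j f) = (if i = j then f else 0)" for i j f
      unfolding C_def V_def by (cases "i = j") (simp_all add: inj pull_push, auto intro: pull_push_disjoint inj)
    have blV: "bounded_linear (V i)" and blC: "bounded_linear (C i)" for i
      unfolding V_def C_def by (auto intro: bounded_linear_push bounded_linear_pull inj)
    note [continuous_intros] = bounded_linear.continuous_on[OF blV] bounded_linear.continuous_on[OF blC]
      bounded_linear.continuous_on[OF bounded_linear_scale_ell2]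
    note V_sum = linear_sum[OF bounded_linear.linear[OF blV]]
    note C_sum = linear_sum[OF bounded_linear.linear[OF blC]]
    note C_diff = linear_diff[OF bounded_linear.linear[OF blC]]
    have V_scale: "V i (c \<cdot>\<^sub>C f) = c \<cdot>\<^sub>C V i f" for i c f by (simp add: V_def push_scale inj)
    have C_scale: "C i (c \<cdot>\<^sub>C f) = c \<cdot>\<^sub>C C i f" for i c f by (simp add: C_def pull_scale inj)
    have VC: "cinner (V i f) g = cinner f (C i g)" for i f g
      by (simp add: V_def C_def cinner_push_left inj)
    have CV': "cinner (C i g) f = cinner g (V i f)" for i f g
      by (subst (1 2) cinner_commute) (simp add: VC)
    \<comment> \<open>The index type provides a copy of the space for every vector;
      \<open>amp\<close> kills the copies outside \<open>I\<close>, so \<open>amp id_blinfun\<close>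
      is the identity on \<open>W\<close> but not everywhere.\<close>
    define amp where "amp = (\<lambda>S F. \<Sum>i\<in>I. V i (blinfun_apply S (C i F)))"
    define vec where "vec = (\<lambda>S. \<Sum>i\<in>I. V i (blinfun_apply S i))"
    have C_amp: "C i (amp S F) = blinfun_apply S (C i F)" if "i \<in> I" for i S F
      unfolding amp_def C_sum using that I by (simp add: CV if_distrib if_distribR sum.delta cong: if_cong)
    have C_vec: "C i (vec S) = blinfun_apply S i" if "i \<in> I" for i S
      unfolding vec_def C_sum using that I by (simp add: CV sum.delta)
    have amp_V: "amp S (V j f) = V j (blinfun_apply S f)" if "j \<in> I" for S j f
    proof -
      have "amp S (V j f) = (\<Sum>i\<in>I. if i = j then V j (blinfun_apply S f) else 0)"
        unfolding amp_def by (rule sum.cong) (auto simp: CV linear_0[OF bounded_linear.linear[OF blV]])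
      then show ?thesis using that I by simp
    qed
    have amp_vec: "amp S (vec R) = vec (S o\<^sub>L R)" for S R
    proof -
      have "amp S (vec R) = (\<Sum>i\<in>I. V i (blinfun_apply S (blinfun_apply R i)))"
        unfolding amp_def by (simp add: C_vec)
      then show ?thesis by (simp add: vec_def)
    qed
    have cont_amp: "continuous_on X (amp S)" for X S
      unfolding amp_def by (intro continuous_intros)
    have amp_adj: "inner (amp S F) G = inner F (amp (adj S) G)" if "S \<in> bounded_ops" for S F G
    proof -
      have "cinner (amp S F) G = (\<Sum>i\<in>I. cinner F (V i (blinfun_apply (adj S) (C i G))))"
        unfolding amp_def cinner_sum_left
        by (simp add: VC cinner_adj[OF that] CV')
      also have "\<dots> = cinner F (amp (adj S) G)"
        unfolding amp_def by (subst cinner_commute) (simp add: cinner_sum_left cinner_commute[of F])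
      finally show ?thesis by (simp add: inner_ell2)
    qed
    define W where "W = closure (vec ` A)"
    have vec_add: "vec (S + R) = vec S + vec R" for S R
      by (simp add: vec_def blinfun.add_left linear_add[OF bounded_linear.linear[OF blV]] sum.distrib)
    have vec_scale: "vec (scale_op c S) = c \<cdot>\<^sub>C vec S" for c S
      by (simp add: vec_def scale_op_apply V_scale scale_sum_right)
    have sub0: "subspace (vec ` A)"
    proof -
      have "0 = vec 0" by (simp add: vec_def linear_0[OF bounded_linear.linear[OF blV]])
      moreover have "c *\<^sub>R vec a = vec (scale_op (of_real c) a)" for c a
        by (simp add: vec_scale scaleR_ell2_def)
      ultimately show ?thesis
        using ops.subspace_0[OF A(3)] ops.subspace_scale[OF A(3)] ops.subspace_add[OF A(3)]
        unfolding subspace_def by (auto simp: vec_add[symmetric] intro!: imageI)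
    qed
    have W: "subspace W" "closed W"
      unfolding W_def by (auto intro: subspace_closure sub0)
    have W_amp: "amp a w \<in> W" if a: "a \<in> A" and w: "w \<in> W" for a w
      unfolding W_def
    proof (rule closure_invariant[OF cont_amp _ w[unfolded W_def]])
      fix v assume "v \<in> vec ` A"
      then show "amp a v \<in> closure (vec ` A)"
        using a mult closure_subset by (fastforce simp: amp_vec)
    qed
    have W_scale: "c \<cdot>\<^sub>C w \<in> W" if w: "w \<in> W" for c w
      unfolding W_def
    proof (rule closure_invariant[OF _ _ w[unfolded W_def]])
      fix v assume "v \<in> vec ` A"
      then show "c \<cdot>\<^sub>C v \<in> closure (vec ` A)"
        using ops.subspace_scale[OF A(3)] closure_subset by (fastforce simp: vec_scale[symmetric])
    qed (intro continuous_intros)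
    have W_id: "amp id_blinfun w = w" if w: "w \<in> W" for w
    proof -
      have "closed {w. amp id_blinfun w = w}"
        by (intro closed_Collect_eq cont_amp continuous_intros)
      moreover have "vec ` A \<subseteq> {w. amp id_blinfun w = w}" by (auto simp: amp_vec) (simp add: vec_def)
      ultimately have "W \<subseteq> {w. amp id_blinfun w = w}" unfolding W_def by (rule closure_minimal[rotated])
      then show ?thesis using w by blast
    qed
    define P where "P = proj W"
    have blP: "bounded_linear P" unfolding P_def by (rule bounded_linear_proj[OF W])
    have P_amp: "P (amp a F) = amp a (P F)" if "a \<in> A" for a F
      unfolding P_def
      by (rule proj_commute[OF W, where U' = "amp (adj a)"])
        (use that A(1) adjoint in \<open>auto intro: W_amp amp_adj\<close>)
    have P_scale: "P (c \<cdot>\<^sub>C F) = c \<cdot>\<^sub>C P F" for c F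
      unfolding P_def
      by (rule proj_commute[OF W, where U' = "\<lambda>F. cnj c \<cdot>\<^sub>C F"])
        (auto intro: W_scale simp: inner_ell2 cinner_scale_left cinner_scale_right)
    \<comment> \<open>Matrix entries of the projection; they act on the original space, so the
      commutation hypothesis applies to them.\<close>
    define E where "E = (\<lambda>i j. Blinfun (\<lambda>f. C i (P (V j f))))"
    have E: "blinfun_apply (E i j) f = C i (P (V j f))" for i j f
      unfolding E_def
      by (subst bounded_linear_Blinfun_apply)
        (auto intro!: bounded_linear_compose[OF blC] bounded_linear_compose[OF blP] blV)
    have E_commute: "E i j o\<^sub>L T = T o\<^sub>L E i j" if ij: "i \<in> I" "j \<in> I" for i j
    proof (rule commute)
      show "E i j \<in> bounded_ops"
        unfolding bounded_ops_def by (simp add: E V_scale P_scale C_scale)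
      fix a assume a: "a \<in> A"
      show "E i j o\<^sub>L a = a o\<^sub>L E i j"
        by (rule blinfun_eqI) (simp add: E ij amp_V[symmetric] P_amp a C_amp)
    qed
    have T_E: "blinfun_apply T (C i (P (V j f))) = C i (P (V j (blinfun_apply T f)))"
      if "i \<in> I" "j \<in> I" for i j f
      using arg_cong[OF E_commute[OF that], of "\<lambda>S. blinfun_apply S f"] by (simp add: E)
    note P_sum = linear_sum[OF bounded_linear.linear[OF blP]]
    have id_W: "vec id_blinfun \<in> W" unfolding W_def by (rule subsetD[OF closure_subset imageI[OF A(2)]])
    have "vec T = amp T (vec id_blinfun)" by (simp add: amp_vec) (simp add: vec_def)
    also have "\<dots> = amp T (P (vec id_blinfun))"
      using id_W by (simp add: P_def proj_id[OF W])
    also have "\<dots> = (\<Sum>i\<in>I. V i (\<Sum>j\<in>I. blinfun_apply T (C i (P (V j j)))))"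
      unfolding amp_def vec_def P_sum C_sum by (simp add: blinfun.sum_right)
    also have "\<dots> = (\<Sum>i\<in>I. V i (\<Sum>j\<in>I. C i (P (V j (blinfun_apply T j)))))"
      by (simp add: T_E)
    also have "\<dots> = amp id_blinfun (P (vec T))"
      unfolding amp_def vec_def P_sum C_sum by simp
    also have "\<dots> = P (vec T)" by (rule W_id) (simp add: P_def proj_in[OF W])
    finally have "vec T \<in> closure (vec ` A)"
      using proj_in[OF W, of "vec T"] by (simp add: P_def W_def)
    then obtain a where a: "a \<in> A" "dist (vec a) (vec T) < e"
      using e unfolding closure_approachable by blast
    have "norm (blinfun_apply a i - blinfun_apply T i) < e" if "i \<in> I" for i
    proof -
      have "norm (blinfun_apply a i - blinfun_apply T i) = norm (C i (vec a - vec T))"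
        by (simp add: C_vec that C_diff)
      also have "\<dots> \<le> norm (vec a - vec T)" unfolding C_def by (rule norm_pull_le[OF inj])
      also have "\<dots> < e" using a(2) by (simp add: dist_norm)
      finally show ?thesis .
    qed
    then show ?thesis using a(1) by blast
  qed
  then have "T \<in> weak_operator_topology closure_of A"
    by (intro strong_approximation_in_wot_closure[OF T _ A(1)]) auto
  then show ?thesis using closure_of_closedin[OF closed] by simp
qed

section \<open>Vectors of a group von Neumann algebra\<close>

lemma bounded_bilinear_cinner: "bounded_bilinear cinner"
proof
  show "\<exists>K. \<forall>f g. norm (cinner f g) \<le> norm f * norm g * K"
    by (rule exI[of _ 1]) (simp add: cmod_cinner_le)
qed (simp_all add: cinner_add_left cinner_add_right scaleR_ell2_def cinner_scale_left
    cinner_scale_right scaleR_conv_of_real)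

lemmas continuous_on_cinner [continuous_intros] =
  bounded_bilinear.continuous_on[OF bounded_bilinear_cinner]

lemma constant_on_infinite_eq_0:
  assumes "infinite K" "\<And>k. k \<in> K \<Longrightarrow> ell2_apply f k = c"
  shows "c = 0"
proof (rule ccontr)
  assume "c \<noteq> 0"
  then have c: "0 < (cmod c)\<^sup>2" by simp
  obtain n :: nat where n: "(norm f)\<^sup>2 / (cmod c)\<^sup>2 < n" using reals_Archimedean2 by blast
  obtain F where F: "F \<subseteq> K" "finite F" "card F = n" using infinite_arbitrarily_large[OF assms(1)] by blast
  have "(\<Sum>x\<in>F. (cmod (ell2_apply f x))\<^sup>2) = (\<Sum>x\<in>F. (cmod c)\<^sup>2)"
    using F(1) assms(2) by (intro sum.cong) auto
  then have "real n * (cmod c)\<^sup>2 \<le> (norm f)\<^sup>2" using finite_sum_le_norm[OF F(2), of f] F(3) by simp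
  then show False using n c by (simp add: divide_less_eq)
qed

lemma supported_at_point:
  "(\<And>y. y \<noteq> x \<Longrightarrow> ell2_apply f y = 0) \<Longrightarrow> f = ell2_apply f x \<cdot>\<^sub>C delta x"
  by (rule ell2_eqI) (auto simp: ell2_apply_delta)

lemma trunc_eq_sum: "finite S \<Longrightarrow> trunc S f = (\<Sum>x\<in>S. ell2_apply f x \<cdot>\<^sub>C delta x)"
proof (rule ell2_eqI)
  fix y assume S: "finite S"
  have "ell2_apply (\<Sum>x\<in>S. ell2_apply f x \<cdot>\<^sub>C delta x) y = (\<Sum>x\<in>S. ell2_apply f x * of_bool (y = x))"
    by (simp add: linear_sum[OF bounded_linear.linear[OF bounded_linear_apply]] ell2_apply_delta)
  also have "\<dots> = (if y \<in> S then ell2_apply f y else 0)"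
    using S by (simp add: of_bool_def if_distrib sum.delta cong: if_cong)
  finally show "ell2_apply (trunc S f) y = ell2_apply (\<Sum>x\<in>S. ell2_apply f x \<cdot>\<^sub>C delta x) y"
    by (simp add: ell2_apply_trunc)
qed

locale full_group = group G for G :: "('a, 'b) monoid_scheme" (structure) +
  assumes carrier_UNIV [simp]: "carrier G = UNIV"
begin

lemma solve_left: "x \<otimes> y = z \<longleftrightarrow> y = inv x \<otimes> z"
  by (metis UNIV_I carrier_UNIV inv_closed l_inv l_one m_assoc r_inv)

lemma solve_right: "x \<otimes> y = z \<longleftrightarrow> x = z \<otimes> inv y"
  by (metis UNIV_I carrier_UNIV inv_closed l_inv r_one m_assoc r_inv)

lemma cancel [simp]: "x \<otimes> (inv x \<otimes> y) = y" "inv x \<otimes> (x \<otimes> y) = y"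
  by (simp_all add: m_assoc[symmetric])

lemma bij_left: "bij (\<lambda>y. x \<otimes> y)"
  by (rule o_bij[where g = "\<lambda>y. inv x \<otimes> y"]) (auto simp: fun_eq_iff)

lemma bij_right: "bij (\<lambda>y. y \<otimes> x)"
  by (rule o_bij[where g = "\<lambda>y. y \<otimes> inv x"]) (auto simp: fun_eq_iff m_assoc)

lemma bij_inv: "bij (\<lambda>y. inv y)"
  by (rule o_bij[where g = "\<lambda>y. inv y"]) (auto simp: fun_eq_iff)

lemma bij_conjugate: "bij (\<lambda>y. inv t \<otimes> y \<otimes> t)"
  using bij_comp[OF bij_left[of "inv t"] bij_right[of t]] by (simp add: o_def)

lemma bij_left_inv: "bij (\<lambda>y. x \<otimes> inv y)"
  using bij_comp[OF bij_inv bij_left[of x]] by (simp add: o_def)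

text \<open>Only a function: the convolution of two vectors is bounded but need not be
  square-summable. For \<open>f = hat T\<close> it gives the coefficients of \<open>T\<close>
  applied to \<open>g\<close>.\<close>

definition conv :: "'a ell2 \<Rightarrow> 'a ell2 \<Rightarrow> 'a \<Rightarrow> complex"
  where "conv f g x = (\<Sum>\<^sub>\<infinity>y. ell2_apply f (x \<otimes> inv y) * ell2_apply g y)"

text \<open>Turns \<open>conv f g x\<close> into an inner product of \<open>g\<close> with an
  isometric image of \<open>f\<close>, so bounds and continuity in either argument are
  immediate.\<close>

definition twist :: "'a \<Rightarrow> 'a ell2 \<Rightarrow> 'a ell2"
  where "twist x f = cnj_ell2 (pull (\<lambda>y. x \<otimes> inv y) f)"

definition star :: "'a ell2 \<Rightarrow> 'a ell2"
  where "star f = cnj_ell2 (pull (\<lambda>y. inv y) f)"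

definition Ad :: "'a \<Rightarrow> 'a ell2 \<Rightarrow> 'a ell2"
  where "Ad t = pull (\<lambda>y. inv t \<otimes> y \<otimes> t)"

definition hat :: "('a ell2 \<Rightarrow>\<^sub>L 'a ell2) \<Rightarrow> 'a ell2"
  where "hat T = blinfun_apply T (delta \<one>)"

abbreviation lam :: "'a \<Rightarrow> 'a ell2 \<Rightarrow> 'a ell2"
  where "lam g \<equiv> blinfun_apply (left_reg G g)"

lemma twist_apply [simp]: "ell2_apply (twist x f) y = cnj (ell2_apply f (x \<otimes> inv y))"
  by (simp add: twist_def ell2_apply_pull bij_is_inj[OF bij_left_inv])

lemma star_apply [simp]: "ell2_apply (star f) y = cnj (ell2_apply f (inv y))"
  by (simp add: star_def ell2_apply_pull bij_is_inj[OF bij_inv])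

lemma Ad_apply [simp]: "ell2_apply (Ad t f) y = ell2_apply f (inv t \<otimes> y \<otimes> t)"
  by (simp add: Ad_def ell2_apply_pull bij_is_inj[OF bij_conjugate])

lemma lam_apply [simp]: "ell2_apply (lam g f) h = ell2_apply f (inv g \<otimes> h)"
  by (rule left_reg_apply[OF is_group carrier_UNIV])

lemma lam_delta [simp]: "lam g (delta h) = delta (g \<otimes> h)"
  by (rule left_reg_delta[OF is_group carrier_UNIV])

lemma bounded_linear_twist: "bounded_linear (twist x)"
  unfolding twist_def
  by (intro bounded_linear_compose[OF bounded_linear_cnj] bounded_linear_pull bij_is_inj bij_left_inv)

lemma bounded_linear_star: "bounded_linear star"
  unfolding star_def
  by (intro bounded_linear_compose[OF bounded_linear_cnj] bounded_linear_pull bij_is_inj bij_inv)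

lemma bounded_linear_Ad: "bounded_linear (Ad t)"
  unfolding Ad_def by (intro bounded_linear_pull bij_is_inj bij_conjugate)

lemma norm_twist: "norm (twist x f) = norm f"
  by (simp add: twist_def norm_cnj norm_pull bij_left_inv)

lemma norm_Ad: "norm (Ad t f) = norm f"
  by (simp add: Ad_def norm_pull bij_conjugate)

lemma star_star [simp]: "star (star f) = f"
  by (rule ell2_eqI) simp

lemma inner_star: "inner (star f) g = inner f (star g)"
proof -
  have "cinner (star f) (star (star g)) = cnj (cinner f (star g))"
    by (simp add: star_def cinner_cnj cinner_pull_pull bij_inv)
  then show ?thesis by (simp add: inner_ell2)
qed

lemma inner_Ad: "inner (Ad t f) g = inner f (Ad (inv t) g)"
proof -
  have "g = Ad t (Ad (inv t) g)" by (rule ell2_eqI) (simp add: m_assoc)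
  then have "cinner (Ad t f) g = cinner (Ad t f) (Ad t (Ad (inv t) g))" by simp
  also have "\<dots> = cinner f (Ad (inv t) g)" by (simp only: Ad_def cinner_pull_pull bij_conjugate)
  finally show ?thesis by (simp add: inner_ell2)
qed

lemma Ad_delta: "Ad t (delta g) = delta (t \<otimes> g \<otimes> inv t)"
  by (rule ell2_eqI) (auto simp: ell2_apply_delta m_assoc)

lemma inner_lam: "inner (lam g a) b = inner a (lam (inv g) b)"
  unfolding inner_ell2
  by (simp add: cinner_adj[OF left_reg_bounded_ops[OF is_group carrier_UNIV]]
      adj_left_reg[OF is_group carrier_UNIV])

lemma lam_lam: "lam g (lam h f) = lam (g \<otimes> h) f"
  by (rule ell2_eqI) (simp add: inv_mult_group m_assoc)

lemma conv_eq_cinner: "conv f g x = cinner g (twist x f)"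
  unfolding conv_def cinner.rep_eq by (simp add: mult.commute)

lemma cmod_conv_le: "cmod (conv f g x) \<le> norm f * norm g"
  using cmod_cinner_le[of g "twist x f"] by (simp add: conv_eq_cinner norm_twist mult.commute)

lemma conv_diff_left: "conv (f - f') g x = conv f g x - conv f' g x"
  by (simp add: conv_eq_cinner linear_diff[OF bounded_linear.linear[OF bounded_linear_twist]]
      cinner_diff_right)

lemma conv_diff_right: "conv f (g - g') x = conv f g x - conv f g' x"
  by (simp add: conv_eq_cinner cinner_diff_left)

lemma continuous_on_conv_left: "continuous_on X (\<lambda>f. conv f g x)"
  unfolding conv_eq_cinner
  by (intro continuous_intros bounded_linear.continuous_on[OF bounded_linear_twist])

lemma continuous_on_conv_right: "continuous_on X (\<lambda>g. conv f g x)"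
  unfolding conv_eq_cinner by (intro continuous_intros)

lemma conv_delta_left: "conv (delta w) f x = ell2_apply f (inv w \<otimes> x)"
proof -
  have "twist x (delta w) = delta (inv w \<otimes> x)"
    using solve_right[of x "inv _" w] solve_left[of w _ x]
    by (intro ell2_eqI) (auto simp: ell2_apply_delta)
  then show ?thesis by (simp add: conv_eq_cinner cinner_delta_right)
qed

text \<open>For fixed \<open>x\<close> and \<open>y\<close> the operators satisfying both claims
  form a weakly closed complex subspace that contains every \<open>left_reg G g\<close>. The
  identity says that the matrix of \<open>T\<close> is constant along right translations.\<close>

lemma group_vN_coefficient:
  assumes T: "T \<in> group_vN G"
  shows "T \<in> bounded_ops"
    and "ell2_apply (blinfun_apply T (delta y)) x = ell2_apply (hat T) (x \<otimes> inv y)"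
proof -
  define K where "K = {T \<in> bounded_ops.
    cinner (blinfun_apply T (delta y)) (delta x) = cinner (blinfun_apply T (delta \<one>)) (delta (x \<otimes> inv y))}"
  have "ops.span (left_reg G ` carrier G) \<subseteq> K"
  proof (rule ops.span_minimal)
    show "left_reg G ` carrier G \<subseteq> K"
      by (auto simp: K_def left_reg_bounded_ops[OF is_group carrier_UNIV] cinner_delta_right
          ell2_apply_delta solve_right[of x "inv y"])
    show "ops.subspace K"
      by (auto simp: ops.subspace_def K_def bounded_ops_def blinfun.add_left scale_op_apply
          cinner_add_left cinner_scale_left scale_add_right intro!: ell2_eqI)
  qed
  then have "group_vN G \<subseteq> K"
    unfolding group_vN_def by (rule closure_of_minimal) (simp add: K_def closedin_coefficients_eq)
  then show "T \<in> bounded_ops"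
    "ell2_apply (blinfun_apply T (delta y)) x = ell2_apply (hat T) (x \<otimes> inv y)"
    using T by (auto simp: K_def cinner_delta_right hat_def)
qed

lemma group_vN_apply:
  assumes T: "T \<in> group_vN G"
  shows "ell2_apply (blinfun_apply T f) x = conv (hat T) f x"
  unfolding conv_def ell2_apply_blinfun[OF group_vN_coefficient(1)[OF T], of f x]
  by (simp add: group_vN_coefficient(2)[OF T] mult.commute)

lemma left_reg_in_group_vN: "left_reg G g \<in> group_vN G"
proof -
  have "ops.span (left_reg G ` carrier G) \<subseteq> bounded_ops"
    by (rule ops.span_minimal)
      (auto simp: left_reg_bounded_ops[OF is_group carrier_UNIV] ops.subspace_def bounded_ops_def
        blinfun.add_left scale_op_apply scale_add_right intro!: ell2_eqI)
  then have "ops.span (left_reg G ` carrier G) \<subseteq> group_vN G"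
    unfolding group_vN_def by (intro closure_of_subset) (simp add: topspace_wot)
  then show ?thesis by (auto intro: ops.span_base)
qed

lemma hat_left_reg: "hat (left_reg G g) = delta g"
  by (simp add: hat_def)

lemma hat_adj:
  assumes T: "T \<in> group_vN G"
  shows "hat (adj T) = star (hat T)"
proof (rule ell2_eqI)
  fix x
  note T' = group_vN_coefficient(1)[OF T]
  have "ell2_apply (hat (adj T)) x = cnj (cinner (delta x) (blinfun_apply (adj T) (delta \<one>)))"
    by (simp add: cinner_delta_left hat_def)
  also have "\<dots> = cnj (ell2_apply (blinfun_apply T (delta x)) \<one>)"
    by (simp add: cinner_adj[OF T', symmetric] cinner_delta_right)
  finally show "ell2_apply (hat (adj T)) x = ell2_apply (star (hat T)) x"
    by (simp add: group_vN_coefficient(2)[OF T])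
qed

text \<open>An element of the group von Neumann algebra acts by convolution with its vector, which is continuous in
  the vector; so it commutes with everything that commutes with the subalgebra.\<close>

theorem vN_subalgebra_memI:
  assumes A: "vN_subalgebra G A" and T: "T \<in> group_vN G" and V: "hat T \<in> closure (hat ` A)"
  shows "T \<in> A"
proof (rule double_commutant)
  have sub: "A \<subseteq> group_vN G" using A by (simp add: vN_subalgebra_def)
  then show "A \<subseteq> bounded_ops" using group_vN_coefficient(1) by blast
  show T': "T \<in> bounded_ops" by (rule group_vN_coefficient(1)[OF T])
  fix S assume S: "S \<in> bounded_ops" and comm: "\<And>a. a \<in> A \<Longrightarrow> S o\<^sub>L a = a o\<^sub>L S"
  obtain a where a: "\<And>n. a n \<in> A" "(\<lambda>n. hat (a n)) \<longlonglongrightarrow> hat T"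
  proof -
    obtain v where v: "\<And>n. v n \<in> hat ` A" "v \<longlonglongrightarrow> hat T" using V unfolding closure_sequential by blast
    have "\<exists>b. b \<in> A \<and> hat b = v n" for n using v(1)[of n] by auto
    then obtain a where "\<And>n. a n \<in> A" "\<And>n. hat (a n) = v n" by metis
    then show ?thesis using v(2) by (intro that[of a]) simp_all
  qed
  have aG: "a n \<in> group_vN G" for n using a(1) sub by blast
  show "S o\<^sub>L T = T o\<^sub>L S"
  proof (rule bounded_ops_eqI)
    fix y
    \<comment> \<open>The value at \<open>delta y\<close> is a right translate of the vector, so
      convergence of vectors gives convergence at each basis vector, although the operator norms of
      \<open>a n\<close> may be unbounded.\<close>
    have pull_hat: "blinfun_apply R (delta y) = pull (\<lambda>x. x \<otimes> inv y) (hat R)" if "R \<in> group_vN G" for R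
      by (rule ell2_eqI) (simp add: group_vN_coefficient(2)[OF that] ell2_apply_pull bij_is_inj[OF bij_right])
    have "(\<lambda>n. blinfun_apply (a n) (delta y)) \<longlonglongrightarrow> blinfun_apply T (delta y)"
      unfolding pull_hat[OF aG] pull_hat[OF T]
      by (intro bounded_linear.tendsto[OF bounded_linear_pull] bij_is_inj bij_right a)
    then have "(\<lambda>n. blinfun_apply S (blinfun_apply (a n) (delta y))) \<longlonglongrightarrow> blinfun_apply S (blinfun_apply T (delta y))"
      by (rule bounded_linear.tendsto[OF blinfun.bounded_linear_right])
    then have l: "(\<lambda>n. ell2_apply (blinfun_apply S (blinfun_apply (a n) (delta y))) x)
        \<longlonglongrightarrow> ell2_apply (blinfun_apply S (blinfun_apply T (delta y))) x" for x
      by (rule bounded_linear.tendsto[OF bounded_linear_apply])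
    have r: "(\<lambda>n. ell2_apply (blinfun_apply (a n) (blinfun_apply S (delta y))) x)
        \<longlonglongrightarrow> ell2_apply (blinfun_apply T (blinfun_apply S (delta y))) x" for x
      unfolding group_vN_apply[OF aG] group_vN_apply[OF T] conv_eq_cinner
      by (intro bounded_bilinear.tendsto[OF bounded_bilinear_cinner] tendsto_const
          bounded_linear.tendsto[OF bounded_linear_twist] a)
    have Sa: "blinfun_apply S (blinfun_apply (a n) (delta y)) = blinfun_apply (a n) (blinfun_apply S (delta y))" for n
      using arg_cong[OF comm[OF a(1)], of "\<lambda>R. blinfun_apply R (delta y)"] by simp
    have "ell2_apply (blinfun_apply S (blinfun_apply T (delta y))) x
        = ell2_apply (blinfun_apply T (blinfun_apply S (delta y))) x" for x
      using LIMSEQ_unique[OF l[of x, unfolded Sa] r[of x]] .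
    then show "blinfun_apply (S o\<^sub>L T) (delta y) = blinfun_apply (T o\<^sub>L S) (delta y)"
      by (simp add: ell2_eqI)
  qed (simp_all add: bounded_ops_compose S T')
qed (use A in \<open>auto simp: vN_subalgebra_def\<close>)

end

section \<open>The projection onto the vectors of a von Neumann subalgebra\<close>

locale vN_sub = full_group +
  fixes A assumes A: "vN_subalgebra G A"
begin

definition V :: "'a ell2 set" where "V = closure (hat ` A)"

abbreviation P :: "'a ell2 \<Rightarrow> 'a ell2" where "P \<equiv> proj V"

lemma A_group_vN: "T \<in> A \<Longrightarrow> T \<in> group_vN G"
  using A by (auto simp: vN_subalgebra_def)

lemma A_bounded: "T \<in> A \<Longrightarrow> T \<in> bounded_ops"
  using group_vN_coefficient(1) A_group_vN by blast

lemma A_adj: "T \<in> A \<Longrightarrow> adj T \<in> A"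
  using A by (auto simp: vN_subalgebra_def)

lemma A_mult: "S \<in> A \<Longrightarrow> T \<in> A \<Longrightarrow> S o\<^sub>L T \<in> A"
  using A by (auto simp: vN_subalgebra_def)

lemma hat_in_V: "T \<in> A \<Longrightarrow> hat T \<in> V"
  unfolding V_def by (rule subsetD[OF closure_subset imageI])

lemma A_memI: "T \<in> group_vN G \<Longrightarrow> hat T \<in> V \<Longrightarrow> T \<in> A"
  unfolding V_def by (rule vN_subalgebra_memI[OF A])

lemma V_invariant:
  assumes "\<And>X. continuous_on X g" "\<And>T. T \<in> A \<Longrightarrow> g (hat T) \<in> V" "v \<in> V"
  shows "g v \<in> V"
  unfolding V_def
  by (rule closure_invariant) (use assms in \<open>auto simp: V_def\<close>)

lemma V_scale:
  assumes v: "v \<in> V" shows "c \<cdot>\<^sub>C v \<in> V"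
proof (rule V_invariant[where g = "\<lambda>v. c \<cdot>\<^sub>C v", OF _ _ v])
  fix T assume "T \<in> A"
  then have "scale_op c T \<in> A" using A ops.subspace_scale by (auto simp: vN_subalgebra_def)
  from hat_in_V[OF this] show "c \<cdot>\<^sub>C hat T \<in> V" by (simp add: hat_def scale_op_apply)
qed (rule bounded_linear.continuous_on[OF bounded_linear_scale_ell2 continuous_on_id])

lemma V: "subspace V" "closed V"
proof -
  have S: "ops.subspace A" using A by (simp add: vN_subalgebra_def)
  have "subspace (hat ` A)"
    unfolding subspace_def
  proof (intro conjI ballI allI; (elim imageE)?)
    show "0 \<in> hat ` A"
      by (rule image_eqI[OF _ ops.subspace_0[OF S]]) (simp add: hat_def)
  next
    fix x y R T assume "x = hat R" "R \<in> A" "y = hat T" "T \<in> A"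
    then show "x + y \<in> hat ` A"
      by (intro image_eqI[of _ _ "R + T"] ops.subspace_add[OF S]) (simp_all add: hat_def blinfun.add_left)
  next
    fix x c T assume "x = hat T" "T \<in> A"
    then show "c *\<^sub>R x \<in> hat ` A"
      by (intro image_eqI[of _ _ "scale_op (of_real c) T"] ops.subspace_scale[OF S])
        (simp_all add: hat_def scale_op_apply scaleR_ell2_def)
  qed
  then show "subspace V" "closed V" unfolding V_def by (auto intro: subspace_closure)
qed

lemma V_mult:
  assumes T: "T \<in> A" and v: "v \<in> V" shows "blinfun_apply T v \<in> V"
proof (rule V_invariant[where g = "blinfun_apply T", OF _ _ v])
  fix S assume "S \<in> A"
  from hat_in_V[OF A_mult[OF T this]] show "blinfun_apply T (hat S) \<in> V" by (simp add: hat_def)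
qed (intro continuous_intros)

lemma V_star:
  assumes v: "v \<in> V" shows "star v \<in> V"
proof (rule V_invariant[where g = star, OF _ _ v])
  fix T assume "T \<in> A"
  then show "star (hat T) \<in> V" using hat_in_V[OF A_adj] by (simp add: hat_adj A_group_vN)
qed (rule bounded_linear.continuous_on[OF bounded_linear_star continuous_on_id])

text \<open>Right multiplication by \<open>T\<close>, obtained from left multiplication by
  \<open>adj T\<close> through the involution; this makes it bounded and defined on every
  vector.\<close>

definition right :: "('a ell2 \<Rightarrow>\<^sub>L 'a ell2) \<Rightarrow> 'a ell2 \<Rightarrow> 'a ell2"
  where "right T f = star (blinfun_apply (adj T) (star f))"

lemma V_right: "T \<in> A \<Longrightarrow> v \<in> V \<Longrightarrow> right T v \<in> V"
  unfolding right_def by (intro V_star V_mult A_adj)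

lemma right_apply:
  assumes T: "T \<in> A" shows "ell2_apply (right T f) x = conv f (hat T) x"
proof -
  have "ell2_apply (right T f) x = (\<Sum>\<^sub>\<infinity>y. ell2_apply (hat T) (y \<otimes> x) * ell2_apply f (inv y))"
    unfolding right_def star_apply group_vN_apply[OF A_group_vN[OF A_adj[OF T]]]
      hat_adj[OF A_group_vN[OF T]] conv_def infsum_cnj[symmetric]
    by (simp add: inv_mult_group)
  also have "\<dots> = conv f (hat T) x"
    unfolding conv_def
    using infsum_reindex_bij_betw[OF bij_right[of x], of "\<lambda>y. ell2_apply f (x \<otimes> inv y) * ell2_apply (hat T) y"]
    by (simp add: inv_mult_group mult.commute)
  finally show ?thesis .
qed

lemma inner_adj: "T \<in> A \<Longrightarrow> inner (blinfun_apply T f) g = inner f (blinfun_apply (adj T) g)"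
  by (simp add: inner_ell2 cinner_adj A_bounded)

lemma inner_right: "T \<in> A \<Longrightarrow> inner (right T f) g = inner f (right (adj T) g)"
  by (simp add: right_def inner_star inner_adj A_adj)

text \<open>Together with \<open>P_right\<close> this is the bimodule property of the conditional
  expectation.\<close>

lemma P_mult: "T \<in> A \<Longrightarrow> P (blinfun_apply T f) = blinfun_apply T (P f)"
  by (rule proj_commute[OF V, where U' = "blinfun_apply (adj T)"])
    (auto intro: V_mult A_adj inner_adj)

lemma P_right: "T \<in> A \<Longrightarrow> P (right T f) = right T (P f)"
  by (rule proj_commute[OF V, where U' = "right (adj T)"])
    (auto intro: V_right A_adj inner_right)

text \<open>Real orthogonality to \<open>V\<close> implies complex orthogonality, as
  \<open>V\<close> is a complex subspace.\<close>

lemma cinner_P_left: "w \<in> V \<Longrightarrow> cinner (P f) w = cinner f w"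
  by (simp add: cinner_eq_inner inner_proj_left V V_scale)

lemma delta_in_V_iff: "delta g \<in> V \<longleftrightarrow> left_reg G g \<in> A"
  using A_memI[OF left_reg_in_group_vN, of g] hat_in_V[of "left_reg G g"] by (auto simp: hat_left_reg)

lemma delta_one_in_V: "delta \<one> \<in> V"
  using hat_in_V[of id_blinfun] A by (simp add: vN_subalgebra_def hat_def)

lemma P_delta_multiple:
  assumes "P (delta g) = c \<cdot>\<^sub>C delta g"
  shows "P (delta g) = 0 \<or> P (delta g) = delta g"
proof (cases "c = 0")
  case False
  have "(1 / c) \<cdot>\<^sub>C P (delta g) = delta g"
    unfolding assms using False by (intro ell2_eqI) simp
  then have "delta g \<in> V" using V_scale[OF proj_in[OF V]] by metis
  then show ?thesis using proj_id[OF V] by simp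
qed (use assms in \<open>auto intro!: ell2_eqI\<close>)

text \<open>For \<open>a = hat T\<close> the vector \<open>lam w a\<close> is \<open>delta w\<close>
  multiplied by \<open>T\<close> on the right. Moved to \<open>b\<close>, this multiplication stays
  inside \<open>V\<close>, where only \<open>P (delta w)\<close> is seen.\<close>

lemma lam_orthogonal:
  assumes w: "P (delta w) = 0" and a: "a \<in> V" and b: "b \<in> V"
  shows "inner (lam w a) b = 0"
proof -
  have "closed {a. inner (lam w a) b = 0}"
    by (intro closed_Collect_eq continuous_intros)
  moreover have "inner (lam w (hat T)) b = 0" if T: "T \<in> A" for T
  proof -
    have "lam w (hat T) = right T (delta w)"
      by (rule ell2_eqI) (simp add: right_apply[OF T] conv_delta_left)
    also have "inner \<dots> b = inner (P (delta w)) (right (adj T) b)"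
      by (simp add: inner_right[OF T] inner_proj_left[OF V] V_right A_adj T b)
    finally show ?thesis by (simp add: w)
  qed
  ultimately have "V \<subseteq> {a. inner (lam w a) b = 0}"
    unfolding V_def by (intro closure_minimal) auto
  then show ?thesis using a by blast
qed

end

section \<open>Subalgebras invariant under conjugation by a subgroup\<close>

locale vN_sub_invariant = vN_sub +
  fixes H assumes H: "subgroup H G"
    and invariant: "\<And>h. h \<in> H \<Longrightarrow>
      (\<lambda>T. left_reg G h o\<^sub>L T o\<^sub>L adj (left_reg G h)) ` A = A"
begin

lemma H_inv: "h \<in> H \<Longrightarrow> inv h \<in> H" by (rule subgroup.m_inv_closed[OF H])

lemma hat_conjugate:
  assumes "T \<in> A"
  shows "hat (left_reg G h o\<^sub>L T o\<^sub>L adj (left_reg G h)) = Ad h (hat T)"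
proof (rule ell2_eqI)
  fix x
  have "ell2_apply (hat (left_reg G h o\<^sub>L T o\<^sub>L adj (left_reg G h))) x
      = ell2_apply (blinfun_apply T (delta (inv h))) (inv h \<otimes> x)"
    by (simp add: hat_def adj_left_reg[OF is_group carrier_UNIV])
  then show "ell2_apply (hat (left_reg G h o\<^sub>L T o\<^sub>L adj (left_reg G h))) x = ell2_apply (Ad h (hat T)) x"
    by (simp add: group_vN_coefficient(2)[OF A_group_vN[OF assms]])
qed

lemma V_Ad:
  assumes h: "h \<in> H" and v: "v \<in> V" shows "Ad h v \<in> V"
proof (rule V_invariant[where g = "Ad h", OF _ _ v])
  fix T assume T: "T \<in> A"
  then have "left_reg G h o\<^sub>L T o\<^sub>L adj (left_reg G h) \<in> A" using invariant[OF h] by blast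
  from hat_in_V[OF this] show "Ad h (hat T) \<in> V" by (simp add: hat_conjugate T)
qed (rule bounded_linear.continuous_on[OF bounded_linear_Ad continuous_on_id])

lemma P_Ad: "h \<in> H \<Longrightarrow> P (Ad h f) = Ad h (P f)"
  by (rule proj_commute[OF V, where U' = "Ad (inv h)"]) (auto intro: V_Ad H_inv inner_Ad)

text \<open>In operator terms: \<open>\<lambda>(g) E(\<lambda>(g))\<^sup>*\<close> commutes with the subalgebra, because
  \<open>E(T \<lambda>(g)) = T E(\<lambda>(g))\<close> and \<open>T \<lambda>(g) = \<lambda>(g) T'\<close> with \<open>T'\<close> in the subalgebra.\<close>

lemma conv_commute:
  assumes g: "g \<in> H" and v: "v \<in> V"
  defines "\<eta> \<equiv> lam g (star (P (delta g)))"
  shows "conv v \<eta> x = conv \<eta> v x"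
proof -
  let ?\<xi> = "P (delta g)"
  have hat: "conv (hat T) \<eta> x = conv \<eta> (hat T) x" if T: "T \<in> A" for T
  proof -
    let ?T2 = "adj T"
    \<comment> \<open>Multiplying \<open>\<lambda>(g)\<close> by \<open>adj T\<close> on the left is
      the same as multiplying it by \<open>T1\<close> on the right. The adjoint is taken because
      \<open>\<eta>\<close> involves \<open>star\<close>, which reverses products.\<close>
    define T1 where "T1 = left_reg G (inv g) o\<^sub>L ?T2 o\<^sub>L adj (left_reg G (inv g))"
    have T2: "?T2 \<in> A" by (rule A_adj[OF T])
    have T1: "T1 \<in> A" unfolding T1_def using invariant[OF H_inv[OF g]] T2 by blast
    have hT2: "hat ?T2 = star (hat T)" by (rule hat_adj[OF A_group_vN[OF T]])
    have hT1: "hat T1 = Ad (inv g) (star (hat T))" unfolding T1_def hat_conjugate[OF T2] hT2 ..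
    have "blinfun_apply ?T2 (delta g) = right T1 (delta g)"
      by (rule ell2_eqI)
        (simp add: right_apply[OF T1] hT1 conv_delta_left group_vN_coefficient(2)[OF A_group_vN[OF T2]] hT2)
    then have "blinfun_apply ?T2 ?\<xi> = right T1 ?\<xi>"
      using P_mult[OF T2, of "delta g"] P_right[OF T1, of "delta g"] by simp
    then have *: "conv (star (hat T)) ?\<xi> z = conv ?\<xi> (Ad (inv g) (star (hat T))) z" for z
      by (metis group_vN_apply[OF A_group_vN[OF T2]] right_apply[OF T1] hT1 hT2)
    \<comment> \<open>Under \<open>star\<close>, the coefficients at \<open>x\<close> of the two
      products become conjugates of coefficients at \<open>inv x \<otimes> g\<close> of the two
      sides of \<open>*\<close>.\<close>
    define z where "z = inv x \<otimes> g"
    have "conv \<eta> (hat T) x = (\<Sum>\<^sub>\<infinity>y. cnj (ell2_apply ?\<xi> (y \<otimes> z)) * ell2_apply (hat T) y)"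
      unfolding conv_def \<eta>_def by (simp add: inv_mult_group m_assoc z_def)
    also have "\<dots> = (\<Sum>\<^sub>\<infinity>y. cnj (ell2_apply ?\<xi> y) * ell2_apply (hat T) (y \<otimes> inv z))"
      using infsum_reindex_bij_betw[OF bij_right[of "inv z"],
          of "\<lambda>y. cnj (ell2_apply ?\<xi> (y \<otimes> z)) * ell2_apply (hat T) y"]
      by (simp add: m_assoc)
    also have "\<dots> = cnj (conv (star (hat T)) ?\<xi> z)"
      unfolding conv_def infsum_cnj[symmetric] by (simp add: inv_mult_group mult.commute)
    also have "\<dots> = cnj (conv ?\<xi> (Ad (inv g) (star (hat T))) z)" by (simp only: *)
    also have "\<dots> = (\<Sum>\<^sub>\<infinity>y. cnj (ell2_apply ?\<xi> (z \<otimes> inv y)) * ell2_apply (hat T) (g \<otimes> inv y \<otimes> inv g))"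
      unfolding conv_def infsum_cnj[symmetric] by (simp add: inv_mult_group m_assoc)
    also have "\<dots> = (\<Sum>\<^sub>\<infinity>u. cnj (ell2_apply ?\<xi> (inv u \<otimes> g)) * ell2_apply (hat T) (x \<otimes> inv u))"
    proof -
      have "bij (\<lambda>y. g \<otimes> y \<otimes> (inv g \<otimes> x))"
        using bij_comp[OF bij_left[of g] bij_right[of "inv g \<otimes> x"]] by (simp add: o_def)
      from infsum_reindex_bij_betw[OF this,
          of "\<lambda>u. cnj (ell2_apply ?\<xi> (inv u \<otimes> g)) * ell2_apply (hat T) (x \<otimes> inv u)"]
      show ?thesis by (simp add: inv_mult_group m_assoc z_def)
    qed
    also have "\<dots> = conv (hat T) \<eta> x"
      unfolding conv_def \<eta>_def by (simp add: inv_mult_group mult.commute)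
    finally show ?thesis by simp
  qed
  have "closed {v. conv v \<eta> x = conv \<eta> v x}"
    by (intro closed_Collect_eq continuous_on_conv_left continuous_on_conv_right)
  then have "V \<subseteq> {v. conv v \<eta> x = conv \<eta> v x}"
    unfolding V_def by (intro closure_minimal) (auto simp: hat)
  then show ?thesis using v by blast
qed

end

section \<open>Vectors commuting with all conjugates of another vector\<close>

context full_group
begin

text \<open>Only finitely many coefficients matter up to a small error, and for those a suitable
  conjugation separates the two products.\<close>

lemma commuting_vectors_trivial:
  assumes mix: "\<And>S T k l. finite S \<Longrightarrow> finite T \<Longrightarrow> T \<subseteq> C \<Longrightarrow> k \<in> S \<Longrightarrow> l \<in> T \<Longrightarrow> k \<noteq> \<one> \<Longrightarrow> l \<noteq> \<one> \<Longrightarrow>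
      \<exists>t\<in>H. \<forall>k'\<in>S. \<forall>l'\<in>T.
        (k \<otimes> (t \<otimes> l \<otimes> inv t) = k' \<otimes> (t \<otimes> l' \<otimes> inv t) \<longrightarrow> k' = k \<and> l' = l) \<and>
        k \<otimes> (t \<otimes> l \<otimes> inv t) \<noteq> (t \<otimes> l' \<otimes> inv t) \<otimes> k'"
    and comm: "\<And>t x. t \<in> H \<Longrightarrow> conv (Ad t \<xi>) \<eta> x = conv \<eta> (Ad t \<xi>) x"
    and supp: "\<And>x. x \<notin> C \<Longrightarrow> ell2_apply \<xi> x = 0"
    and k: "k \<noteq> \<one>" "ell2_apply \<eta> k \<noteq> 0" and l: "l \<noteq> \<one>" "ell2_apply \<xi> l \<noteq> 0"
  shows False
proof -
  define d where "d = cmod (ell2_apply \<eta> k * ell2_apply \<xi> l)"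
  define b where "b = norm \<xi> + norm \<eta> + 1"
  \<comment> \<open>Truncation changes each of the two products by at most
    \<open>e * (norm \<xi> + norm \<eta>)\<close>, hence both together by less than
    \<open>4 * e * b = d\<close>. The \<open>+ 1\<close> in \<open>b\<close> makes the divisor
    positive.\<close>
  define e where "e = d / (4 * b)"
  have d: "d > 0" using k l by (simp add: d_def)
  have pos: "b > 0" by (simp add: b_def add_nonneg_pos)
  have e: "e > 0" using d pos by (simp add: e_def)
  obtain S0 where S0: "finite S0" "\<And>S. S0 \<subseteq> S \<Longrightarrow> norm (\<eta> - trunc S \<eta>) < e"
    by (rule trunc_approximates[OF e, of \<eta>]) blast
  obtain T0 where T0: "finite T0" "\<And>T. T0 \<subseteq> T \<Longrightarrow> norm (\<xi> - trunc T \<xi>) < e"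
    by (rule trunc_approximates[OF e, of \<xi>]) blast
  \<comment> \<open>Separation is available only for finite subsets of \<open>C\<close>; since
    \<open>\<xi>\<close> vanishes off \<open>C\<close>, intersecting with \<open>C\<close> does not
    change the truncation.\<close>
  define S T where "S = insert k S0" and "T = insert l T0 \<inter> C"
  have fin: "finite S" "finite T" using S0(1) T0(1) by (simp_all add: S_def T_def)
  have kS: "k \<in> S" and lT: "l \<in> T" using l supp by (auto simp: S_def T_def)
  have "trunc T \<xi> = trunc (insert l T0) \<xi>"
    by (rule ell2_eqI) (auto simp: ell2_apply_trunc T_def supp)
  then have Te: "norm (\<xi> - trunc T \<xi>) < e" using T0(2)[of "insert l T0"] by auto
  have Se: "norm (\<eta> - trunc S \<eta>) < e" using S0(2)[of S] by (auto simp: S_def)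
  obtain t where t: "t \<in> H"
    and inj: "\<And>k' l'. k' \<in> S \<Longrightarrow> l' \<in> T \<Longrightarrow> k \<otimes> (t \<otimes> l \<otimes> inv t) = k' \<otimes> (t \<otimes> l' \<otimes> inv t) \<Longrightarrow> k' = k \<and> l' = l"
    and ne: "\<And>k' l'. k' \<in> S \<Longrightarrow> l' \<in> T \<Longrightarrow> k \<otimes> (t \<otimes> l \<otimes> inv t) \<noteq> (t \<otimes> l' \<otimes> inv t) \<otimes> k'"
    using mix[OF fin _ kS lT k(1) l(1)] by (auto simp: T_def)
  \<comment> \<open>At \<open>z\<close> the truncated product in one order has the single term from
    \<open>(k, l)\<close>, by uniqueness of the factorization, and in the other order no
    term.\<close>
  define z where "z = k \<otimes> (t \<otimes> l \<otimes> inv t)"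
  define \<eta>S \<xi>T where "\<eta>S = trunc S \<eta>" and "\<xi>T = trunc T \<xi>"
  have tt: "t \<otimes> (inv t \<otimes> y \<otimes> t) \<otimes> inv t = y" for y by (simp add: m_assoc)
  have "conv \<eta>S (Ad t \<xi>T) z = (\<Sum>\<^sub>\<infinity>y\<in>{t \<otimes> l \<otimes> inv t}. ell2_apply \<eta> k * ell2_apply \<xi> l)"
    unfolding conv_def
  proof (rule infsum_cong_neutral)
    fix y assume "y \<in> UNIV - {t \<otimes> l \<otimes> inv t}"
    then have y: "inv t \<otimes> y \<otimes> t \<noteq> l" using tt[of y] by auto
    have "\<not> (z \<otimes> inv y \<in> S \<and> inv t \<otimes> y \<otimes> t \<in> T)"
    proof
      assume "z \<otimes> inv y \<in> S \<and> inv t \<otimes> y \<otimes> t \<in> T"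
      moreover have "k \<otimes> (t \<otimes> l \<otimes> inv t) = z \<otimes> inv y \<otimes> (t \<otimes> (inv t \<otimes> y \<otimes> t) \<otimes> inv t)"
        unfolding tt by (simp add: z_def m_assoc)
      ultimately show False using inj y by blast
    qed
    then show "ell2_apply \<eta>S (z \<otimes> inv y) * ell2_apply (Ad t \<xi>T) y = 0"
      by (auto simp: \<eta>S_def \<xi>T_def ell2_apply_trunc)
  next
    fix y assume "y \<in> UNIV \<inter> {t \<otimes> l \<otimes> inv t}"
    then have "y = t \<otimes> l \<otimes> inv t" by simp
    then have "z \<otimes> inv y = k" "inv t \<otimes> y \<otimes> t = l" by (simp_all add: z_def m_assoc inv_mult_group)
    then show "ell2_apply \<eta>S (z \<otimes> inv y) * ell2_apply (Ad t \<xi>T) y = ell2_apply \<eta> k * ell2_apply \<xi> l"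
      by (simp add: \<eta>S_def \<xi>T_def ell2_apply_trunc kS lT)
  qed auto
  then have c1: "conv \<eta>S (Ad t \<xi>T) z = ell2_apply \<eta> k * ell2_apply \<xi> l" by simp
  have c2: "conv (Ad t \<xi>T) \<eta>S z = 0"
    unfolding conv_def
  proof (rule infsum_0)
    fix y
    have "\<not> (y \<in> S \<and> inv t \<otimes> (z \<otimes> inv y) \<otimes> t \<in> T)"
    proof
      assume *: "y \<in> S \<and> inv t \<otimes> (z \<otimes> inv y) \<otimes> t \<in> T"
      have "k \<otimes> (t \<otimes> l \<otimes> inv t) = (t \<otimes> (inv t \<otimes> (z \<otimes> inv y) \<otimes> t) \<otimes> inv t) \<otimes> y"
        unfolding tt by (simp add: z_def m_assoc)
      then show False using ne * by blast
    qed
    then show "ell2_apply (Ad t \<xi>T) (z \<otimes> inv y) * ell2_apply \<eta>S y = 0"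
      by (auto simp: \<eta>S_def \<xi>T_def ell2_apply_trunc)
  qed
  note Ad_diff = linear_diff[OF bounded_linear.linear[OF bounded_linear_Ad]]
  have nAd: "norm (Ad t \<xi> - Ad t \<xi>T) \<le> e"
    using Te by (simp add: Ad_diff[symmetric] norm_Ad \<xi>T_def)
  have n\<eta>S: "norm (\<eta> - \<eta>S) \<le> e" "norm \<eta>S \<le> norm \<eta>"
    using Se norm_trunc_le by (simp_all add: \<eta>S_def)
  have b1: "cmod (conv \<eta> (Ad t \<xi>) z - conv \<eta>S (Ad t \<xi>T) z) \<le> e * norm \<xi> + norm \<eta> * e"
  proof -
    have "conv \<eta> (Ad t \<xi>) z - conv \<eta>S (Ad t \<xi>T) z
        = conv (\<eta> - \<eta>S) (Ad t \<xi>) z + conv \<eta>S (Ad t \<xi> - Ad t \<xi>T) z"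
      by (simp add: conv_diff_left conv_diff_right)
    also have "cmod \<dots> \<le> norm (\<eta> - \<eta>S) * norm (Ad t \<xi>) + norm \<eta>S * norm (Ad t \<xi> - Ad t \<xi>T)"
      by (intro order_trans[OF norm_triangle_ineq] add_mono cmod_conv_le)
    also have "\<dots> \<le> e * norm \<xi> + norm \<eta> * e"
      unfolding norm_Ad using nAd n\<eta>S e by (intro add_mono mult_mono) auto
    finally show ?thesis .
  qed
  have b2: "cmod (conv (Ad t \<xi>) \<eta> z - conv (Ad t \<xi>T) \<eta>S z) \<le> e * norm \<eta> + e * norm \<xi>"
  proof -
    have "conv (Ad t \<xi>) \<eta> z - conv (Ad t \<xi>T) \<eta>S z
        = conv (Ad t \<xi> - Ad t \<xi>T) \<eta>S z + conv (Ad t \<xi>) (\<eta> - \<eta>S) z"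
      by (simp add: conv_diff_left conv_diff_right)
    also have "cmod \<dots> \<le> norm (Ad t \<xi> - Ad t \<xi>T) * norm \<eta>S + norm (Ad t \<xi>) * norm (\<eta> - \<eta>S)"
      by (intro order_trans[OF norm_triangle_ineq] add_mono cmod_conv_le)
    also have "\<dots> \<le> e * norm \<eta> + norm \<xi> * e"
      unfolding norm_Ad using nAd n\<eta>S e by (intro add_mono mult_mono) auto
    finally show ?thesis by (simp add: mult.commute)
  qed
  have "d \<le> cmod (conv \<eta> (Ad t \<xi>) z - conv \<eta>S (Ad t \<xi>T) z) + cmod (conv (Ad t \<xi>) \<eta> z - conv (Ad t \<xi>T) \<eta>S z)"
    using norm_triangle_ineq4[of "conv (Ad t \<xi>) \<eta> z" "conv \<eta> (Ad t \<xi>) z - conv \<eta>S (Ad t \<xi>T) z"]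
      comm[OF t, of z]
    by (simp add: c1 c2 d_def add.commute)
  also have "\<dots> \<le> 2 * e * (norm \<xi> + norm \<eta>)"
    using b1 b2 by (simp add: algebra_simps)
  also have "\<dots> < 4 * e * b"
  proof -
    have "0 \<le> e * norm \<xi>" "0 \<le> e * norm \<eta>" using e by simp_all
    then show ?thesis using e unfolding b_def distrib_left by linarith
  qed
  also have "\<dots> = d" using pos by (simp add: e_def)
  finally show False by simp
qed

end

text \<open>The role of \<open>H\<close> and \<open>C\<close> is played by the commutator subgroup of Thompson's group and by the
  elements that are the identity near both end points.\<close>

locale rigid_group = full_group +
  fixes H C
  assumes H: "subgroup H G"
    and derived_le: "derived G (carrier G) \<subseteq> H"
    and relatively_icc: "g \<noteq> \<one> \<Longrightarrow> infinite ((\<lambda>h. h \<otimes> g \<otimes> inv h) ` H)"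
    and centralizer_orbit: "g \<in> H \<Longrightarrow> x \<notin> C \<Longrightarrow>
      infinite ((\<lambda>s. s \<otimes> x \<otimes> inv s) ` {s \<in> H. s \<otimes> g = g \<otimes> s})"
    and mixing: "finite S \<Longrightarrow> finite T \<Longrightarrow> T \<subseteq> C \<Longrightarrow> k \<in> S \<Longrightarrow> l \<in> T \<Longrightarrow> k \<noteq> \<one> \<Longrightarrow> l \<noteq> \<one> \<Longrightarrow>
      \<exists>t\<in>H. \<forall>k'\<in>S. \<forall>l'\<in>T.
        (k \<otimes> (t \<otimes> l \<otimes> inv t) = k' \<otimes> (t \<otimes> l' \<otimes> inv t) \<longrightarrow> k' = k \<and> l' = l) \<and>
        k \<otimes> (t \<otimes> l \<otimes> inv t) \<noteq> (t \<otimes> l' \<otimes> inv t) \<otimes> k'"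
    and invariant_subgroup: "subgroup N G \<Longrightarrow> (\<And>h n. h \<in> H \<Longrightarrow> n \<in> N \<Longrightarrow> h \<otimes> n \<otimes> inv h \<in> N) \<Longrightarrow>
      n \<in> N \<Longrightarrow> n \<in> H \<Longrightarrow> n \<noteq> \<one> \<Longrightarrow> H \<subseteq> N"
begin

lemma commutator_in_H: "g \<otimes> h \<otimes> inv g \<otimes> inv h \<in> H"
proof -
  have "g \<otimes> h \<otimes> inv g \<otimes> inv h \<in> derived G (carrier G)"
    unfolding derived_def by (rule generate.incl) auto
  then show ?thesis using derived_le by blast
qed

text \<open>A conjugate differs from the element itself by a commutator, which lies in
  \<open>H\<close>.\<close>

lemma normal_if_contains_H:
  assumes N: "subgroup N G" and HN: "H \<subseteq> N" shows "N \<lhd> G"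
  unfolding normal_inv_iff
proof (intro conjI N ballI)
  fix x n assume "n \<in> N"
  then have "(x \<otimes> n \<otimes> inv x \<otimes> inv n) \<otimes> n \<in> N"
    by (rule subgroup.m_closed[OF N subsetD[OF HN commutator_in_H]])
  then show "x \<otimes> n \<otimes> inv x \<in> N" by (simp add: m_assoc)
qed

theorem invariant_vN_subalgebra:
  assumes A: "vN_subalgebra G A"
    and inv: "\<And>h. h \<in> H \<Longrightarrow> (\<lambda>T. left_reg G h o\<^sub>L T o\<^sub>L adj (left_reg G h)) ` A = A"
  shows "\<exists>N. N \<lhd> G \<and> A = subgroup_vN G N"
proof -
  interpret vN_sub_invariant G A H
    by (intro vN_sub_invariant.intro vN_sub.intro vN_sub_axioms.intro vN_sub_invariant_axioms.intro
        full_group_axioms A H inv)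
  have P_conj: "P (delta (h \<otimes> g \<otimes> inv h)) = Ad h (P (delta g))" if "h \<in> H" for h g
    using P_Ad[OF that, of "delta g"] by (simp add: Ad_delta)
  have inH: "P (delta g) = 0 \<or> P (delta g) = delta g" if g: "g \<in> H" "g \<noteq> \<one>" for g
  proof -
    define \<xi> where "\<xi> = P (delta g)"
    define \<eta> where "\<eta> = lam g (star \<xi>)"
    have supp: "ell2_apply \<xi> x = 0" if x: "x \<notin> C" for x
    proof (rule constant_on_infinite_eq_0[OF centralizer_orbit[OF g(1) x]])
      fix y assume "y \<in> (\<lambda>s. s \<otimes> x \<otimes> inv s) ` {s \<in> H. s \<otimes> g = g \<otimes> s}"
      then obtain s where s: "y = s \<otimes> x \<otimes> inv s" "s \<in> H" "s \<otimes> g = g \<otimes> s" by blast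
      have "s \<otimes> g \<otimes> inv s = g" using s(3) by (simp add: m_assoc)
      then have "\<xi> = Ad s \<xi>" using P_conj[OF s(2), of g] by (simp add: \<xi>_def)
      from arg_cong[OF this, of "\<lambda>f. ell2_apply f y"]
      show "ell2_apply \<xi> y = ell2_apply \<xi> x" by (simp add: s(1) m_assoc)
    qed
    have comm: "conv (Ad t \<xi>) \<eta> x = conv \<eta> (Ad t \<xi>) x" if "t \<in> H" for t x
      unfolding \<eta>_def \<xi>_def by (rule conv_commute[OF g(1) V_Ad[OF that proj_in[OF V]]])
    consider "\<And>l. l \<noteq> \<one> \<Longrightarrow> ell2_apply \<xi> l = 0" | "\<And>k. k \<noteq> \<one> \<Longrightarrow> ell2_apply \<eta> k = 0"
      using commuting_vectors_trivial[OF mixing comm supp] by blast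
    then show ?thesis
    proof cases
      case 1
      \<comment> \<open>Only the coefficient at \<open>\<one>\<close> is left; it equals that of
        \<open>delta g\<close> because \<open>delta \<one>\<close> lies in \<open>V\<close>.\<close>
      have "ell2_apply \<xi> \<one> = cinner (delta g) (delta \<one>)"
        unfolding \<xi>_def cinner_delta_right[symmetric] by (rule cinner_P_left[OF delta_one_in_V])
      also have "\<dots> = 0" using g by (simp add: cinner_delta_right ell2_apply_delta)
      finally have "\<xi> = 0" using 1 by (intro ell2_eqI) (metis ell2_apply_zero)
      then show ?thesis by (simp add: \<xi>_def)
    next
      case 2
      \<comment> \<open>Up to conjugation, the coefficient of \<open>\<eta>\<close> at
        \<open>g \<otimes> inv x\<close> is that of \<open>\<xi>\<close> at \<open>x\<close>, so a
        scalar \<open>\<eta>\<close> means that \<open>\<xi>\<close> is supported at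
        \<open>g\<close>.\<close>
      have "ell2_apply \<xi> x = 0" if "x \<noteq> g" for x
      proof -
        have "ell2_apply \<eta> (g \<otimes> inv x) = 0"
          using that by (intro 2) (auto simp: solve_right)
        then show ?thesis by (simp add: \<eta>_def)
      qed
      from supported_at_point[OF this] show ?thesis
        unfolding \<xi>_def by (rule P_delta_multiple)
    qed
  qed
  define N where "N = {g. left_reg G g \<in> A}"
  have reg_mult: "left_reg G (g \<otimes> h) = left_reg G g o\<^sub>L left_reg G h" for g h
    by (rule blinfun_eqI) (simp add: lam_lam)
  have N: "subgroup N G"
  proof (rule subgroup.intro)
    have "left_reg G \<one> = id_blinfun"
      by (rule blinfun_eqI, rule ell2_eqI) simp
    then show "\<one> \<in> N" using A by (simp add: N_def vN_subalgebra_def)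
  qed (auto simp: N_def reg_mult A_mult adj_left_reg[OF is_group carrier_UNIV, symmetric] A_adj)
  have N_V: "g \<in> N \<longleftrightarrow> delta g \<in> V" for g by (simp add: N_def delta_in_V_iff)
  have N_conj: "h \<otimes> n \<otimes> inv h \<in> N" if "h \<in> H" "n \<in> N" for h n
    using V_Ad[OF that(1), of "delta n"] that(2) by (simp add: N_V Ad_delta)
  have "N \<lhd> G \<and> (\<forall>g. P (delta g) = 0 \<or> P (delta g) = delta g)"
  proof (cases "\<exists>n\<in>N. n \<in> H \<and> n \<noteq> \<one>")
    case True
    then have HN: "H \<subseteq> N" using invariant_subgroup[OF N N_conj] by blast
    have "P (delta g) = 0 \<or> P (delta g) = delta g" for g
    proof -
      define \<xi> where "\<xi> = P (delta g)"
      \<comment> \<open>The commutator \<open>w\<close> of \<open>inv u\<close> and \<open>g\<close>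
        lies in \<open>N\<close>, so left multiplication by \<open>\<lambda>(w)\<close> commutes
        with \<open>P\<close>, and it moves \<open>delta g\<close> exactly as conjugation by
        \<open>inv u\<close> does. Comparing the two shows that \<open>\<xi>\<close>, translated by
        \<open>g\<close>, is constant on \<open>H\<close>-conjugacy classes.\<close>
      have inv: "ell2_apply \<xi> (g \<otimes> (u \<otimes> z \<otimes> inv u)) = ell2_apply \<xi> (g \<otimes> z)" if u: "u \<in> H" for u z
      proof -
        define v where "v = inv u"
        have v: "v \<in> H" unfolding v_def by (rule H_inv[OF u])
        define w where "w = v \<otimes> g \<otimes> inv v \<otimes> inv g"
        have "w \<in> N" using commutator_in_H HN by (auto simp: w_def)
        then have "P (lam w (delta g)) = lam w \<xi>"
          unfolding \<xi>_def by (intro P_mult) (simp add: N_def)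
        moreover have "lam w (delta g) = delta (v \<otimes> g \<otimes> inv v)" by (simp add: w_def m_assoc)
        ultimately have "Ad v \<xi> = lam w \<xi>" using P_conj[OF v, of g] by (simp add: \<xi>_def)
        from arg_cong[OF this, of "\<lambda>f. ell2_apply f (v \<otimes> g \<otimes> inv v \<otimes> z)"]
        show ?thesis by (simp add: w_def v_def m_assoc inv_mult_group)
      qed
      have "ell2_apply \<xi> x = 0" if "x \<noteq> g" for x
      proof -
        define z where "z = inv g \<otimes> x"
        have z: "z \<noteq> \<one>" using that solve_left[of g \<one> x] by (auto simp: z_def)
        have "ell2_apply (pull (\<lambda>y. g \<otimes> y) \<xi>) y = ell2_apply \<xi> x" if "y \<in> (\<lambda>h. h \<otimes> z \<otimes> inv h) ` H" for y
          using that inv[of _ z] by (auto simp: ell2_apply_pull bij_is_inj[OF bij_left]) (simp add: z_def)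
        then show ?thesis by (rule constant_on_infinite_eq_0[OF relatively_icc[OF z]])
      qed
      from supported_at_point[OF this] show ?thesis
        unfolding \<xi>_def by (rule P_delta_multiple)
    qed
    then show ?thesis using normal_if_contains_H[OF N HN] by blast
  next
    case False
    have PH: "P (delta g) = 0" if g: "g \<in> H" "g \<noteq> \<one>" for g
      using inH[OF g] False g proj_in[OF V, of "delta g"] by (auto simp: N_V)
    have "P (delta g) = 0" if g: "g \<noteq> \<one>" for g
    proof (rule ccontr)
      assume "P (delta g) \<noteq> 0"
      define c where "c = (norm (P (delta g)))\<^sup>2"
      have c: "c > 0" using \<open>P (delta g) \<noteq> 0\<close> by (simp add: c_def)
      define K where "K = (\<lambda>h. h \<otimes> g \<otimes> inv h) ` H"
      define w where "w = (\<lambda>k. lam (inv k) (P (delta k)))"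
      have nK: "(norm (P (delta k)))\<^sup>2 = c" if "k \<in> K" for k
        using that by (auto simp: K_def P_conj norm_Ad c_def)
      have w1: "inner (w k) (delta \<one>) = c" if "k \<in> K" for k
      proof -
        have "inner (w k) (delta \<one>) = inner (P (delta k)) (lam (inv (inv k)) (delta \<one>))"
          unfolding w_def by (rule inner_lam)
        also have "\<dots> = (norm (P (delta k)))\<^sup>2"
          by (simp add: norm_proj_squared[OF V] inner_commute)
        finally show ?thesis using nK[OF that] by simp
      qed
      \<comment> \<open>Distinct \<open>k\<close> and \<open>k'\<close> are both congruent to
        \<open>g\<close> modulo \<open>H\<close>, so \<open>k \<otimes> inv k'\<close> is a
        nontrivial element of \<open>H\<close>, which \<open>P\<close> kills; orthogonality
        follows.\<close>
      have ww: "inner (w k) (w k') = (if k = k' then c else 0)" if k: "k \<in> K" "k' \<in> K" for k k'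
      proof -
        have w: "inner (w k) (w k') = inner (P (delta k)) (lam (k \<otimes> inv k') (P (delta k')))"
          unfolding w_def by (subst inner_lam) (simp add: lam_lam)
        show ?thesis
        proof (cases "k = k'")
          case True
          have "lam \<one> f = f" for f by (rule ell2_eqI) simp
          then show ?thesis using True w nK[OF k(1)] by (simp add: power2_norm_eq_inner)
        next
          case False
          have kg: "k \<otimes> inv g \<in> H" if "k \<in> K" for k
            using that commutator_in_H by (auto simp: K_def)
          have "k \<otimes> inv k' = (k \<otimes> inv g) \<otimes> inv (k' \<otimes> inv g)" by (simp add: inv_mult_group m_assoc)
          also have "\<dots> \<in> H" by (intro subgroup.m_closed[OF H] H_inv kg k)
          finally have "P (delta (k \<otimes> inv k')) = 0"
            using False by (intro PH) (auto simp: solve_right)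
          from lam_orthogonal[OF this proj_in[OF V] proj_in[OF V], of "delta k'" "delta k"]
          show ?thesis using False by (simp add: w) (simp add: inner_commute)
        qed
      qed
      \<comment> \<open>A sum of more than \<open>1 / c\<close> of these vectors has squared norm
        \<open>n * c\<close> and inner product \<open>n * c > 1\<close> with a unit vector, against
        Cauchy-Schwarz.\<close>
      obtain n :: nat where n: "1 / c < n" using reals_Archimedean2 by blast
      have "infinite K" unfolding K_def by (rule relatively_icc[OF g])
      then obtain F where F: "F \<subseteq> K" "finite F" "card F = n"
        using infinite_arbitrarily_large by blast
      define s where "s = (\<Sum>k\<in>F. w k)"
      have "inner s (delta \<one>) = n * c"
        using F w1 by (simp add: s_def inner_sum_left subset_iff)
      moreover have "inner s s = n * c"
      proof -
        have "inner s s = (\<Sum>k\<in>F. \<Sum>k'\<in>F. if k = k' then c else 0)"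
          unfolding s_def inner_sum_left inner_sum_right
          using F(1) by (intro sum.cong refl) (auto simp: ww subset_iff)
        then show ?thesis using F by simp
      qed
      ultimately have "(n * c)\<^sup>2 \<le> n * c"
        using Cauchy_Schwarz_ineq[of s "delta \<one>"] by (simp add: power2_norm_eq_inner[symmetric, of "delta \<one>"])
      moreover have "1 < n * c" using n c by (simp add: divide_less_eq)
      ultimately show False using power_strict_increasing[of 1 2 "n * c"] by simp
    qed
    moreover have "N = {\<one>}"
    proof -
      have "n = \<one>" if "n \<in> N" for n
      proof (rule ccontr)
        assume "n \<noteq> \<one>"
        then have "P (delta n) = 0" by fact
        moreover have "P (delta n) = delta n" using that by (simp add: N_V proj_id[OF V])
        ultimately show False using norm_delta[of n] by simp
      qed
      then show ?thesis using subgroup.one_closed[OF N] by blast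
    qed
    moreover have "P (delta \<one>) = delta \<one>" using delta_one_in_V by (simp add: proj_id[OF V])
    ultimately show ?thesis using one_is_normal by metis
  qed
  then have normal: "N \<lhd> G" and P: "\<And>g. P (delta g) = 0 \<or> P (delta g) = delta g" by blast+
  \<comment> \<open>\<open>A\<close> is one of the algebras intersected in
    \<open>subgroup_vN\<close>. It lies in all others because its vectors are supported on
    \<open>N\<close>, hence are limits of combinations of \<open>delta x\<close> with
    \<open>x \<in> N\<close>.\<close>
  have "A \<subseteq> B" if B: "vN_subalgebra G B" "left_reg G ` N \<subseteq> B" for B
  proof
    interpret B: vN_sub G B by (intro vN_sub.intro vN_sub_axioms.intro full_group_axioms B)
    fix T assume T: "T \<in> A"
    have zero: "ell2_apply (hat T) g = 0" if "g \<notin> N" for g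
    proof -
      have "P (delta g) \<in> V" by (rule proj_in[OF V])
      then have "P (delta g) = 0" using P[of g] that by (auto simp: N_V)
      then have "cinner (delta g) (hat T) = 0" using cinner_P_left[OF hat_in_V[OF T], of "delta g"] by simp
      then show ?thesis by (simp add: cinner_delta_left)
    qed
    have trunc: "trunc S (hat T) \<in> B.V" if "finite S" for S
      unfolding trunc_eq_sum[OF that]
    proof (rule subspace_sum[OF B.V(1)])
      fix x
      show "ell2_apply (hat T) x \<cdot>\<^sub>C delta x \<in> B.V"
      proof (cases "x \<in> N")
        case True
        then show ?thesis using B(2) by (intro B.V_scale) (auto simp: B.delta_in_V_iff)
      next
        case False
        then have "ell2_apply (hat T) x \<cdot>\<^sub>C delta x = 0" by (intro ell2_eqI) (simp add: zero)
        then show ?thesis using subspace_0[OF B.V(1)] by simp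
      qed
    qed
    have "hat T \<in> closure B.V"
      unfolding closure_approachable
    proof (intro allI impI)
      fix e :: real assume "0 < e"
      then obtain S where S: "finite S" "\<And>T'. S \<subseteq> T' \<Longrightarrow> norm (hat T - trunc T' (hat T)) < e"
        by (rule trunc_approximates[of e "hat T"]) blast
      then show "\<exists>y\<in>B.V. dist y (hat T) < e"
        using trunc[OF S(1)] S(2)[OF order_refl] by (auto simp: dist_norm norm_minus_commute[of _ "hat T"])
    qed
    then have "hat T \<in> B.V" using B.V(2) by simp
    then show "T \<in> B" by (rule B.A_memI[OF A_group_vN[OF T]])
  qed
  moreover have "left_reg G ` N \<subseteq> A" by (auto simp: N_def)
  ultimately have "A = subgroup_vN G N" unfolding subgroup_vN_def using A by blast
  then show ?thesis using normal by blast
qed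

end

section \<open>Groups of homeomorphisms of the interval\<close>

text \<open>The maps \<open>\<chi>\<^sub>0\<close> and \<open>\<chi>\<^sub>1\<close> abstract the logarithms of the slopes at the two end points.\<close>

locale interval_group = full_group +
  fixes act :: "'a \<Rightarrow> real \<Rightarrow> real" and \<chi>\<^sub>0 \<chi>\<^sub>1 :: "'a \<Rightarrow> int"
  assumes act_mult: "act (g \<otimes> h) x = act g (act h x)"
    and act_eqI: "(\<And>x. act g x = act h x) \<Longrightarrow> g = h"
    and act_strict_mono: "x < y \<Longrightarrow> act g x < act g y"
    and act_outside: "x \<le> 0 \<or> 1 \<le> x \<Longrightarrow> act g x = x"
    and bump: "0 \<le> a \<Longrightarrow> a < x \<Longrightarrow> x < b \<Longrightarrow> b \<le> 1 \<Longrightarrow>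
      \<exists>h a' b'. a < a' \<and> b' < b \<and> (\<forall>y. y \<le> a' \<or> b' \<le> y \<longrightarrow> act h y = y) \<and> x < act h x"
    and \<chi>\<^sub>0_mult: "\<chi>\<^sub>0 (g \<otimes> h) = \<chi>\<^sub>0 g + \<chi>\<^sub>0 h"
    and \<chi>\<^sub>1_mult: "\<chi>\<^sub>1 (g \<otimes> h) = \<chi>\<^sub>1 g + \<chi>\<^sub>1 h"
    and \<chi>\<^sub>0_eq_0_iff: "\<chi>\<^sub>0 g = 0 \<longleftrightarrow> (\<exists>a>0. \<forall>x\<le>a. act g x = x)"
    and \<chi>\<^sub>1_eq_0_iff: "\<chi>\<^sub>1 g = 0 \<longleftrightarrow> (\<exists>b<1. \<forall>x\<ge>b. act g x = x)"
    and \<chi>\<^sub>0_one: "0 < r \<Longrightarrow> r < 1 \<Longrightarrow> \<exists>p. \<chi>\<^sub>0 p = 1 \<and> (\<forall>x\<ge>r. act p x = x)"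
    and \<chi>\<^sub>1_one: "0 < r \<Longrightarrow> r < 1 \<Longrightarrow> \<exists>p. \<chi>\<^sub>1 p = 1 \<and> (\<forall>x\<le>r. act p x = x)"
begin

lemma act_less_iff [simp]: "act g x < act g y \<longleftrightarrow> x < y"
  using act_strict_mono[of x y g] act_strict_mono[of y x g] by (cases x y rule: linorder_cases) auto

lemma act_le_iff [simp]: "act g x \<le> act g y \<longleftrightarrow> x \<le> y"
  by (simp add: not_less[symmetric])

lemma act_eq_iff [simp]: "act g x = act g y \<longleftrightarrow> x = y"
  by (simp add: order_eq_iff)

lemma act_one [simp]: "act \<one> x = x"
  using act_mult[of \<one> \<one> x] by simp

lemma act_inv [simp]: "act (inv g) (act g x) = x" "act g (act (inv g) x) = x"
  by (simp_all add: act_mult[symmetric])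

lemma act_unit [simp]: "0 < act g x \<longleftrightarrow> 0 < x" "act g x < 1 \<longleftrightarrow> x < 1"
  using act_less_iff[of g 0 x] act_less_iff[of g x 1] by (simp_all add: act_outside)

section \<open>Elements with prescribed support\<close>

definition rist :: "real \<Rightarrow> real \<Rightarrow> 'a set"
  where "rist a b = {g. \<forall>x. x \<le> a \<or> b \<le> x \<longrightarrow> act g x = x}"

text \<open>Unlike in \<open>rist\<close>, the support stays away from both ends, so finitely many
  such elements share a strictly smaller interval.\<close>

definition comp_supp :: "real \<Rightarrow> real \<Rightarrow> 'a set"
  where "comp_supp a b = {g. \<exists>a' b'. a < a' \<and> b' < b \<and> g \<in> rist a' b'}"

lemma ristI: "(\<And>x. x \<le> a \<Longrightarrow> act g x = x) \<Longrightarrow> (\<And>x. b \<le> x \<Longrightarrow> act g x = x) \<Longrightarrow> g \<in> rist a b"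
  by (auto simp: rist_def)

lemma ristD: "g \<in> rist a b \<Longrightarrow> x \<le> a \<or> b \<le> x \<Longrightarrow> act g x = x"
  by (auto simp: rist_def)

lemma rist_mono: "g \<in> rist a b \<Longrightarrow> a' \<le> a \<Longrightarrow> b \<le> b' \<Longrightarrow> g \<in> rist a' b'"
  by (auto simp: rist_def)

lemma subgroupI_UNIV:
  assumes "\<one> \<in> K" "\<And>g h. g \<in> K \<Longrightarrow> h \<in> K \<Longrightarrow> g \<otimes> h \<in> K" "\<And>g. g \<in> K \<Longrightarrow> inv g \<in> K"
  shows "subgroup K G"
  by (rule subgroup.intro) (use assms in auto)

lemma subgroup_fixing: "subgroup {g. \<forall>x\<in>X. act g x = x} G"
proof (rule subgroupI_UNIV)
  fix g assume "g \<in> {g. \<forall>x\<in>X. act g x = x}"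
  then show "inv g \<in> {g. \<forall>x\<in>X. act g x = x}" by simp (metis act_inv(1))
qed (simp_all add: act_mult)

lemma rist_subgroup: "subgroup (rist a b) G"
  using subgroup_fixing[of "{x. x \<le> a \<or> b \<le> x}"] by (simp add: rist_def)

lemma comp_supp_subset: "g \<in> comp_supp a b \<Longrightarrow> g \<in> rist a b"
  by (auto simp: comp_supp_def intro: rist_mono)

lemma comp_supp_mono: "g \<in> comp_supp a b \<Longrightarrow> a' \<le> a \<Longrightarrow> b \<le> b' \<Longrightarrow> g \<in> comp_supp a' b'"
  unfolding comp_supp_def by (blast intro: le_less_trans less_le_trans)

lemma comp_supp_common:
  assumes "finite T" "T \<subseteq> comp_supp a b" "a < b"
  shows "\<exists>a' b'. a < a' \<and> a' < b' \<and> b' < b \<and> T \<subseteq> rist a' b'"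
  using assms(1,2)
proof (induction T)
  case empty
  obtain a' where "a < a'" "a' < b" using dense[OF assms(3)] by blast
  moreover from dense[OF this(2)] obtain b' where "a' < b'" "b' < b" by blast
  ultimately show ?case by blast
next
  case (insert t T)
  then obtain a' b' where 1: "a < a'" "a' < b'" "b' < b" "T \<subseteq> rist a' b'" by auto
  obtain c d where 2: "a < c" "d < b" "t \<in> rist c d" using insert by (auto simp: comp_supp_def)
  have "insert t T \<subseteq> rist (min a' c) (max b' d)" using 1 2 by (auto intro: rist_mono)
  then show ?case using 1 2 by (intro exI[of _ "min a' c"] exI[of _ "max b' d"]) auto
qed

lemma comp_supp_subgroup:
  assumes "a < b" shows "subgroup (comp_supp a b) G"
proof (rule subgroupI_UNIV)
  show "\<one> \<in> comp_supp a b"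
    using comp_supp_common[of "{}" a b] assms subgroup.one_closed[OF rist_subgroup]
    by (auto simp: comp_supp_def)
next
  fix g h assume "g \<in> comp_supp a b" "h \<in> comp_supp a b"
  then obtain a' b' where "a < a'" "b' < b" "g \<in> rist a' b'" "h \<in> rist a' b'"
    using comp_supp_common[of "{g, h}" a b] assms by auto
  then show "g \<otimes> h \<in> comp_supp a b"
    unfolding comp_supp_def using subgroup.m_closed[OF rist_subgroup] by blast
next
  fix g assume "g \<in> comp_supp a b"
  then show "inv g \<in> comp_supp a b"
    unfolding comp_supp_def using subgroup.m_inv_closed[OF rist_subgroup] by blast
qed

lemma conjugate_rist: "g \<in> rist a b \<Longrightarrow> t \<otimes> g \<otimes> inv t \<in> rist (act t a) (act t b)"
proof (rule ristI)
  fix x assume g: "g \<in> rist a b"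
  show "act (t \<otimes> g \<otimes> inv t) x = x" if "x \<le> act t a"
    using ristD[OF g, of "act (inv t) x"] act_le_iff[of t "act (inv t) x" a] that
    by (simp add: act_mult del: act_le_iff)
  show "act (t \<otimes> g \<otimes> inv t) x = x" if "act t b \<le> x"
    using ristD[OF g, of "act (inv t) x"] act_le_iff[of t b "act (inv t) x"] that
    by (simp add: act_mult del: act_le_iff)
qed

lemma rist_image: "g \<in> rist a b \<Longrightarrow> a \<le> act g x \<longleftrightarrow> a \<le> x" "g \<in> rist a b \<Longrightarrow> act g x \<le> b \<longleftrightarrow> x \<le> b"
  using act_le_iff[of g a x] act_le_iff[of g x b] ristD[of g a b a] ristD[of g a b b] by simp_all

lemma rist_image_strict: "g \<in> rist a b \<Longrightarrow> a < act g x \<longleftrightarrow> a < x" "g \<in> rist a b \<Longrightarrow> act g x < b \<longleftrightarrow> x < b"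
  using act_less_iff[of g a x] act_less_iff[of g x b] ristD[of g a b a] ristD[of g a b b] by simp_all

text \<open>\<open>w\<close> may act nontrivially outside the interval: it preserves each of the two
  outer sides, and there \<open>g\<close> is the identity.\<close>

lemma commute_fixing:
  assumes g: "g \<in> rist a b" and w: "\<And>x. a \<le> x \<Longrightarrow> x \<le> b \<Longrightarrow> act w x = x" and "a \<le> b"
  shows "g \<otimes> w = w \<otimes> g"
proof (rule act_eqI)
  fix x
  have wab: "act w a = a" "act w b = b" using w \<open>a \<le> b\<close> by auto
  consider "x \<le> a" | "a \<le> x" "x \<le> b" | "b \<le> x" by linarith
  then show "act (g \<otimes> w) x = act (w \<otimes> g) x"
  proof cases
    case 1
    then have "act w x \<le> a" using act_le_iff[of w x a] wab by simp
    then show ?thesis using ristD[OF g] 1 by (simp add: act_mult)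
  next
    case 2
    then show ?thesis using w rist_image[OF g] by (simp add: act_mult)
  next
    case 3
    then have "b \<le> act w x" using act_le_iff[of w b x] wab by simp
    then show ?thesis using ristD[OF g] 3 by (simp add: act_mult)
  qed
qed

lemma rist_trivial: "g \<in> rist a b \<Longrightarrow> b \<le> a \<Longrightarrow> g = \<one>"
  by (rule act_eqI) (metis act_one linear order_trans ristD)

lemma disjoint_commute:
  assumes g: "g \<in> rist a b" and h: "h \<in> rist c d" and "b \<le> c \<or> d \<le> a"
  shows "g \<otimes> h = h \<otimes> g"
proof (cases "a \<le> b")
  case True
  then show ?thesis using assms by (intro commute_fixing[OF g]) (auto intro!: ristD[OF h])
next
  case False
  then show ?thesis using rist_trivial[OF g] by simp
qed

text \<open>Lets \<open>u\<close> and \<open>v\<close> be multiplied by factors with disjoint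
  supports without changing their commutator. The factors are chosen so that the modified elements
  lie in a given subgroup.\<close>

lemma commutator_cancel:
  assumes "a \<otimes> v = v \<otimes> a" "b \<otimes> u = u \<otimes> b" "a \<otimes> b = b \<otimes> a"
  shows "(u \<otimes> a) \<otimes> (v \<otimes> b) \<otimes> inv (u \<otimes> a) \<otimes> inv (v \<otimes> b) = u \<otimes> v \<otimes> inv u \<otimes> inv v"
proof -
  have "(u \<otimes> v \<otimes> inv u \<otimes> inv v) \<otimes> ((v \<otimes> b) \<otimes> (u \<otimes> a)) = u \<otimes> v \<otimes> inv u \<otimes> (b \<otimes> u) \<otimes> a"
    by (simp add: m_assoc)
  also have "\<dots> = u \<otimes> v \<otimes> (b \<otimes> a)" unfolding assms(2) by (simp add: m_assoc)
  also have "\<dots> = u \<otimes> (v \<otimes> a) \<otimes> b" unfolding assms(3)[symmetric] by (simp add: m_assoc)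
  also have "\<dots> = (u \<otimes> a) \<otimes> (v \<otimes> b)" unfolding assms(1)[symmetric] by (simp add: m_assoc)
  finally have "(u \<otimes> a) \<otimes> (v \<otimes> b) = (u \<otimes> v \<otimes> inv u \<otimes> inv v) \<otimes> ((v \<otimes> b) \<otimes> (u \<otimes> a))" by simp
  then show ?thesis by (simp add: solve_right inv_mult_group m_assoc)
qed

section \<open>Moving points towards the ends of an interval\<close>

lemma push_down:
  assumes ab: "0 \<le> a" "b \<le> 1" and x: "a < x" "x < b" and y: "a < y"
  shows "\<exists>t\<in>comp_supp a b. act t x < y"
proof (rule ccontr)
  assume "\<not> ?thesis"
  then have ge: "y \<le> act t x" if "t \<in> comp_supp a b" for t using that by (auto simp: not_less)
  note sub = comp_supp_subgroup[OF less_trans[OF x]]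
  define S where "S = (\<lambda>t. act t x) ` comp_supp a b"
  have S: "bdd_below S" unfolding S_def using ge by (intro bdd_belowI[of _ y]) auto
  have "act \<one> x \<in> S" unfolding S_def by (rule imageI[OF subgroup.one_closed[OF sub]])
  then have xS: "x \<in> S" by simp
  define i where "i = Inf S"
  \<comment> \<open>The infimum \<open>i\<close> of the orbit would be an interior point. A bump
    \<open>h\<close> lifts it to \<open>act h i\<close>; some orbit point lies below that value, and
    \<open>inv h\<close> carries this point below \<open>i\<close>.\<close>
  have "y \<le> i" unfolding i_def using xS ge by (intro cInf_greatest) (auto simp: S_def)
  moreover have "i \<le> x" unfolding i_def by (rule cInf_lower[OF xS S])
  ultimately have "a < i" "i < b" using x y by auto
  from bump[OF ab(1) this ab(2)] obtain h where h: "h \<in> comp_supp a b" "i < act h i"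
    by (auto simp: comp_supp_def rist_def)
  obtain t where t: "t \<in> comp_supp a b" "act t x < act h i"
    using cInf_lessD[of S "act h i"] xS h(2) by (auto simp: i_def S_def)
  have "inv h \<otimes> t \<in> comp_supp a b"
    by (intro subgroup.m_closed[OF sub] subgroup.m_inv_closed[OF sub] h t)
  then have "i \<le> act (inv h \<otimes> t) x" unfolding i_def by (intro cInf_lower[OF _ S]) (auto simp: S_def)
  moreover have "act (inv h \<otimes> t) x < i"
    using t(2) act_less_iff[of "inv h" "act t x" "act h i"] by (simp add: act_mult del: act_less_iff)
  ultimately show False by simp
qed

lemma push_up:
  assumes "0 \<le> a" "b \<le> 1" "a < x" "y < b" "a < b"
  shows "\<exists>t\<in>comp_supp a b. y < act t x"
proof -
  \<comment> \<open>If \<open>t\<close> sends \<open>z\<close> below \<open>x\<close>, then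
    \<open>inv t\<close> sends \<open>x\<close> above \<open>z\<close>, hence above
    \<open>y\<close>.\<close>
  obtain z where z: "max a y < z" "z < b" using dense[of "max a y" b] assms by auto
  obtain t where t: "t \<in> comp_supp a b" "act t z < x" using push_down[of a b z x] assms z by auto
  have "act (inv t) (act t z) < act (inv t) x" using t(2) by (simp only: act_less_iff)
  then have "y < act (inv t) x" using z by simp
  moreover have "inv t \<in> comp_supp a b"
    by (rule subgroup.m_inv_closed[OF comp_supp_subgroup[OF assms(5)] t(1)])
  ultimately show ?thesis by blast
qed

section \<open>Commutators and compactly supported elements\<close>

abbreviation H :: "'a set" where "H \<equiv> derived G (carrier G)"

abbreviation C :: "'a set" where "C \<equiv> comp_supp 0 1"

lemma C_subgroup: "subgroup C G" by (rule comp_supp_subgroup) simp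

lemma H_subgroup: "subgroup H G" by (rule derived_is_subgroup) simp

lemma commutator_in_H: "g \<otimes> h \<otimes> inv g \<otimes> inv h \<in> H"
  unfolding derived_def by (rule generate.incl) auto

lemma C_iff: "g \<in> C \<longleftrightarrow> \<chi>\<^sub>0 g = 0 \<and> \<chi>\<^sub>1 g = 0"
  unfolding \<chi>\<^sub>0_eq_0_iff \<chi>\<^sub>1_eq_0_iff comp_supp_def rist_def by auto

lemma \<chi>_one [simp]: "\<chi>\<^sub>0 \<one> = 0" "\<chi>\<^sub>1 \<one> = 0"
  using \<chi>\<^sub>0_mult[of \<one> \<one>] \<chi>\<^sub>1_mult[of \<one> \<one>] by simp_all

lemma \<chi>_inv [simp]: "\<chi>\<^sub>0 (inv g) = - \<chi>\<^sub>0 g" "\<chi>\<^sub>1 (inv g) = - \<chi>\<^sub>1 g"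
  using \<chi>\<^sub>0_mult[of g "inv g"] \<chi>\<^sub>1_mult[of g "inv g"] by simp_all

text \<open>\<open>C\<close> is the common kernel of two homomorphisms into an abelian group, so it
  contains every commutator.\<close>

lemma H_subset_C: "H \<subseteq> C"
  unfolding derived_def
  by (rule generate_subgroup_incl[OF _ C_subgroup]) (auto simp: C_iff \<chi>\<^sub>0_mult \<chi>\<^sub>1_mult)

text \<open>The commutator of \<open>g\<close> with an element pushing its support to the right of \<open>d\<close> still acts
  like \<open>g\<close> to the left of \<open>d\<close>; in this way elements of \<open>C\<close> are replaced by commutators.\<close>

lemma act_commutator:
  assumes g: "g \<in> rist a b" and d: "x \<le> act t a"
  shows "act (g \<otimes> t \<otimes> inv g \<otimes> inv t) x = act g x"
proof -
  have "t \<otimes> inv g \<otimes> inv t \<in> rist (act t a) (act t b)"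
    by (intro conjugate_rist subgroup.m_inv_closed[OF rist_subgroup] g)
  then have "act (t \<otimes> inv g \<otimes> inv t) x = x" using d by (intro ristD) auto
  moreover have "g \<otimes> t \<otimes> inv g \<otimes> inv t = g \<otimes> (t \<otimes> inv g \<otimes> inv t)" by (simp add: m_assoc)
  ultimately show ?thesis by (simp only: act_mult[of g])
qed

lemma H_approximates_C:
  assumes g: "g \<in> C" and d: "d < 1"
  obtains h where "h \<in> H" "\<And>x. x \<le> d \<Longrightarrow> act h x = act g x"
proof -
  obtain a b where g: "0 < a" "b < 1" "g \<in> rist a b" using g by (auto simp: comp_supp_def)
  obtain t where t: "d < act t a" using push_up[of 0 1 a d] g d by auto
  show ?thesis
    by (rule that[OF commutator_in_H[of g t]]) (use act_commutator[OF g(3)] t in auto)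
qed

text \<open>Both entries of the commutator are supported between \<open>a\<close> and
  \<open>b\<close>, so the bump becomes an element of \<open>H\<close> without its support
  spreading.\<close>

lemma H_moves:
  assumes "0 \<le> a" "a < x" "x < b" "b \<le> 1"
  obtains h where "h \<in> H" "h \<in> rist a b" "x < act h x"
proof -
  obtain g a' b' where g: "a < a'" "b' < b" "g \<in> rist a' b'" "x < act g x"
    using bump[OF assms] by (auto simp: rist_def)
  obtain t where t: "t \<in> comp_supp a b" "x < act t a'" using push_up[of a b a' x] assms g by auto
  have gr: "g \<in> rist a b" by (rule rist_mono[OF g(3)]) (use g in auto)
  have tr: "t \<in> rist a b" by (rule comp_supp_subset[OF t(1)])
  show ?thesis
  proof (rule that[OF commutator_in_H[of g t]])
    show "g \<otimes> t \<otimes> inv g \<otimes> inv t \<in> rist a b"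
      by (intro subgroup.m_closed[OF rist_subgroup] subgroup.m_inv_closed[OF rist_subgroup] gr tr)
    show "x < act (g \<otimes> t \<otimes> inv g \<otimes> inv t) x"
      using act_commutator[OF g(3), of x t] t(2) g(4) by simp
  qed
qed

text \<open>Otherwise the midpoint would have a finite orbit, whose largest point can still be
  pushed up.\<close>

lemma infinite_H_rist:
  assumes ab: "0 \<le> a" "a < b" "b \<le> 1"
  shows "infinite (H \<inter> rist a b)"
proof
  assume fin: "finite (H \<inter> rist a b)"
  define x where "x = (a + b) / 2"
  have x: "a < x" "x < b" using ab by (auto simp: x_def)
  define S where "S = (\<lambda>h. act h x) ` (H \<inter> rist a b)"
  have "\<one> \<in> H \<inter> rist a b"
    using subgroup.one_closed[OF H_subgroup] subgroup.one_closed[OF rist_subgroup] by blast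
  then have S: "finite S" "S \<noteq> {}" using fin by (auto simp: S_def)
  obtain h where h: "h \<in> H \<inter> rist a b" "Max S = act h x" using Max_in[OF S] by (auto simp: S_def)
  then have "a < Max S" "Max S < b" using rist_image_strict[of h a b x] x by auto
  then obtain k where k: "k \<in> H" "k \<in> rist a b" "Max S < act k (Max S)"
    using H_moves[of a "Max S" b] ab by blast
  have "k \<otimes> h \<in> H \<inter> rist a b"
    using k h(1) subgroup.m_closed[OF H_subgroup] subgroup.m_closed[OF rist_subgroup] by blast
  then have "act (k \<otimes> h) x \<in> S" unfolding S_def by (rule imageI)
  then have "act (k \<otimes> h) x \<le> Max S" using S(1) by simp
  then show False using k(3) h(2) by (simp add: act_mult)
qed

section \<open>Displaced intervals and infinite conjugacy classes\<close>

definition displaces :: "'a \<Rightarrow> real \<Rightarrow> real \<Rightarrow> bool"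
  where "displaces g a b \<longleftrightarrow> b \<le> act g a \<or> act g b \<le> a"

text \<open>\<open>u\<close> equals its own conjugate by \<open>g\<close>, so it is supported both
  on the interval and on an image of it that meets it at most in an end point.\<close>

lemma displaces_commute_trivial:
  assumes g: "displaces g a b" and u: "u \<in> rist a b" and ug: "u \<otimes> g = g \<otimes> u"
  shows "u = \<one>"
proof (rule act_eqI)
  fix x
  have "g \<otimes> u \<otimes> inv g = u" unfolding ug[symmetric] by (simp add: m_assoc)
  then have u': "u \<in> rist (act g a) (act g b)" using conjugate_rist[OF u, of g] by simp
  show "act u x = act \<one> x"
    using g ristD[OF u, of x] ristD[OF u', of x] by (cases "b \<le> x"; cases "x \<le> a") (auto simp: displaces_def)
qed

text \<open>Two elements of \<open>rist a b\<close> giving the same conjugate differ by one that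
  commutes with \<open>g\<close>, and displacement makes that one trivial.\<close>

lemma infinite_conjugates:
  assumes ab: "0 \<le> a" "a < b" "b \<le> 1" and g: "displaces g a b" and K: "H \<inter> rist a b \<subseteq> K"
  shows "infinite ((\<lambda>h. h \<otimes> g \<otimes> inv h) ` K)"
proof -
  have "inj_on (\<lambda>h. h \<otimes> g \<otimes> inv h) (H \<inter> rist a b)"
  proof (rule inj_onI)
    fix h k assume hk: "h \<in> H \<inter> rist a b" "k \<in> H \<inter> rist a b" "h \<otimes> g \<otimes> inv h = k \<otimes> g \<otimes> inv k"
    have "inv k \<otimes> h \<in> rist a b"
      using hk subgroup.m_closed[OF rist_subgroup] subgroup.m_inv_closed[OF rist_subgroup] by blast
    moreover have "inv k \<otimes> h \<otimes> g = g \<otimes> (inv k \<otimes> h)"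
    proof -
      have "inv k \<otimes> h \<otimes> g = inv k \<otimes> (h \<otimes> g \<otimes> inv h) \<otimes> h" by (simp add: m_assoc)
      also have "\<dots> = g \<otimes> (inv k \<otimes> h)" unfolding hk(3) by (simp add: m_assoc)
      finally show ?thesis .
    qed
    ultimately have "inv k \<otimes> h = \<one>" by (rule displaces_commute_trivial[OF g])
    then show "h = k" using solve_left[of "inv k" h \<one>] by simp
  qed
  then have "infinite ((\<lambda>h. h \<otimes> g \<otimes> inv h) ` (H \<inter> rist a b))"
    using infinite_H_rist[OF ab] by (simp add: finite_image_iff)
  then show ?thesis using K by (meson finite_subset image_mono)
qed

lemma ex_displaced:
  assumes "g \<noteq> \<one>"
  obtains a b where "0 < a" "a < b" "b < 1" "displaces g a b"
proof -
  obtain x where x: "act g x \<noteq> x" using act_eqI[of g \<one>] assms by auto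
  have x01: "0 < x" "x < 1" using act_outside[of x g] x by force+
  show ?thesis
  proof (cases "x < act g x")
    case True
    then show ?thesis using x01 by (intro that[of x "act g x"]) (auto simp: displaces_def)
  next
    case False
    then show ?thesis using x x01 by (intro that[of "act g x" x]) (auto simp: displaces_def)
  qed
qed

lemma relatively_icc:
  assumes "g \<noteq> \<one>" shows "infinite ((\<lambda>h. h \<otimes> g \<otimes> inv h) ` H)"
proof -
  obtain a b where "0 < a" "a < b" "b < 1" "displaces g a b" using ex_displaced[OF assms] .
  then show ?thesis by (intro infinite_conjugates[of a b]) auto
qed

lemma centralizer_orbit:
  assumes g: "g \<in> H" and x: "x \<notin> C"
  shows "infinite ((\<lambda>s. s \<otimes> x \<otimes> inv s) ` {s \<in> H. s \<otimes> g = g \<otimes> s})"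
proof -
  obtain c d where cd: "0 < c" "d < 1" "g \<in> rist c d" using g H_subset_C by (auto simp: comp_supp_def)
  have "\<exists>y. (0 < y \<and> y < c \<or> d < y \<and> y < 1) \<and> act x y \<noteq> y"
  proof (rule ccontr)
    assume n: "\<not> ?thesis"
    have "x \<in> rist (c / 2) ((d + 1) / 2)"
    proof (rule ristI)
      fix y :: real
      show "act x y = y" if "y \<le> c / 2" using n that cd act_outside[of y x] by (cases "0 < y") auto
      show "act x y = y" if y: "(d + 1) / 2 \<le> y"
      proof (cases "y < 1")
        case True
        moreover have "d < y" using y cd(2) by (simp add: field_simps)
        ultimately show ?thesis using n by blast
      qed (simp add: act_outside)
    qed
    moreover have "0 < c / 2" "(d + 1) / 2 < 1" using cd by simp_all
    ultimately have "x \<in> C" unfolding comp_supp_def by blast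
    then show False using \<open>x \<notin> C\<close> by simp
  qed
  then obtain y where y: "0 < y \<and> y < c \<or> d < y \<and> y < 1" "act x y \<noteq> y" by blast
  \<comment> \<open>The interval ends at \<open>y\<close> on the side facing the support of
    \<open>g\<close>. Its other end is the image of \<open>y\<close> under \<open>x\<close> or
    \<open>inv x\<close>, whichever lies nearer to the end point of the unit interval.\<close>
  have "\<exists>a b. 0 \<le> a \<and> a < b \<and> b \<le> 1 \<and> displaces x a b \<and> (b \<le> c \<or> d \<le> a)"
  proof (cases "0 < y \<and> y < c \<and> y < 1")
    case yc: True
    show ?thesis
    proof (cases "y < act x y")
      case True
      then have "act (inv x) y < y" using act_less_iff[of x "act (inv x) y" y] by (simp del: act_less_iff)
      then show ?thesis using yc
        by (intro exI[of _ "act (inv x) y"] exI[of _ y]) (auto simp: displaces_def intro: less_imp_le)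
    next
      case False
      then show ?thesis using yc y
        by (intro exI[of _ "act x y"] exI[of _ y]) (auto simp: displaces_def intro: less_imp_le)
    qed
  next
    case False
    then have yd: "d < y" "0 < y" "y < 1" using y act_outside[of y x] by force+
    show ?thesis
    proof (cases "y < act x y")
      case True
      then show ?thesis using yd
        by (intro exI[of _ y] exI[of _ "act x y"]) (auto simp: displaces_def intro: less_imp_le)
    next
      case False
      then have "y < act (inv x) y" using y act_less_iff[of x y "act (inv x) y"] by (simp del: act_less_iff)
      then show ?thesis using yd
        by (intro exI[of _ y] exI[of _ "act (inv x) y"]) (auto simp: displaces_def intro: less_imp_le)
    qed
  qed
  then obtain a b where ab: "0 \<le> a" "a < b" "b \<le> 1" "displaces x a b" "b \<le> c \<or> d \<le> a" by blast
  have "s \<otimes> g = g \<otimes> s" if "s \<in> rist a b" for s by (rule disjoint_commute[OF that cd(3) ab(5)])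
  then show ?thesis by (intro infinite_conjugates[OF ab(1-4)]) auto
qed

section \<open>Compression and separation of finitely many elements\<close>

lemma H_compresses:
  assumes T: "finite T" "T \<subseteq> C" and ab: "0 < a" "a < b" "b < 1"
  obtains t where "t \<in> H" "\<And>l. l \<in> T \<Longrightarrow> t \<otimes> l \<otimes> inv t \<in> rist a b"
proof -
  obtain c d where cd: "0 < c" "c < d" "d < 1" "T \<subseteq> rist c d"
    using comp_supp_common[OF T] by auto
  obtain t1 where t1: "t1 \<in> C" "a < act t1 c" using push_up[of 0 1 c a] cd ab by auto
  have d1: "a < act t1 d" "act t1 d < 1"
    using t1 cd act_less_iff[of t1 c d] by (simp_all del: act_less_iff)
  \<comment> \<open>Being supported to the right of \<open>a\<close>, \<open>t2\<close> lowers the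
    image of \<open>d\<close> below \<open>b\<close> without moving that of \<open>c\<close> back
    past \<open>a\<close>.\<close>
  obtain t2 where t2: "t2 \<in> comp_supp a 1" "act t2 (act t1 d) < b"
    using push_down[of a 1 "act t1 d" b] d1 ab by auto
  have "t2 \<in> C" using comp_supp_mono[OF t2(1)] ab by simp
  then have "t2 \<otimes> t1 \<in> C" by (intro subgroup.m_closed[OF C_subgroup] t1)
  \<comment> \<open>Only the images of \<open>c\<close> and \<open>d\<close> matter, so agreement up
    to \<open>d\<close> suffices for passing from \<open>C\<close> to \<open>H\<close>.\<close>
  then obtain t where t: "t \<in> H" "\<And>x. x \<le> d \<Longrightarrow> act t x = act (t2 \<otimes> t1) x"
    using H_approximates_C cd(3) by blast
  have "a < act t2 (act t1 c)"
    using rist_image_strict(1)[OF comp_supp_subset[OF t2(1)]] t1 by simp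
  then have "a \<le> act t c" "act t d \<le> b"
    using t(2)[of c] t(2)[of d] t2 cd by (simp_all add: act_mult)
  then have "t \<otimes> l \<otimes> inv t \<in> rist a b" if "l \<in> T" for l
    using rist_mono[OF conjugate_rist[of l c d t]] cd(4) that by blast
  then show ?thesis using that t(1) by blast
qed

text \<open>Induction over \<open>S\<close> with shrinking intervals: where \<open>s\<close> and
  \<open>k\<close> differ at a point, monotonicity makes the images of a small one-sided interval at
  that point disjoint. All conditions survive shrinking.\<close>

lemma ex_separating_interval:
  assumes S: "finite S" and k: "k \<noteq> \<one>"
  shows "\<exists>a b. 0 < a \<and> a < b \<and> b < 1 \<and> displaces k a b \<and>
    (\<forall>s\<in>S. (\<forall>x. a < x \<longrightarrow> x < b \<longrightarrow> act s x = act k x) \<or> act s b \<le> act k a \<or> act k b \<le> act s a)"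
  using S
proof (induction S)
  case empty
  then show ?case using ex_displaced[OF k] by (metis empty_iff)
next
  case (insert s S)
  then obtain a b where ab: "0 < a" "a < b" "b < 1" "displaces k a b"
    and sep: "\<And>s. s \<in> S \<Longrightarrow> (\<forall>x. a < x \<longrightarrow> x < b \<longrightarrow> act s x = act k x) \<or> act s b \<le> act k a \<or> act k b \<le> act s a"
    by blast
  show ?case
  proof (cases "\<forall>x. a < x \<longrightarrow> x < b \<longrightarrow> act s x = act k x")
    case True
    then show ?thesis using ab sep by (intro exI[of _ a] exI[of _ b]) auto
  next
    case False
    have shrink: ?thesis
      if cd: "a \<le> c" "c < d" "d \<le> b" "act s d \<le> act k c \<or> act k d \<le> act s c" for c d
    proof (intro exI conjI ballI)
      show "0 < c" "c < d" "d < 1" using cd ab by auto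
      have le: "act g a \<le> act g c" "act g d \<le> act g b" for g using cd by simp_all
      show "displaces k c d" using ab(4) le[of k] cd unfolding displaces_def by linarith
      fix r assume "r \<in> insert s S"
      then show "(\<forall>x. c < x \<longrightarrow> x < d \<longrightarrow> act r x = act k x) \<or> act r d \<le> act k c \<or> act k d \<le> act r c"
      proof
        assume "r \<in> S"
        from sep[OF this] show ?thesis
        proof (elim disjE)
          assume "\<forall>x. a < x \<longrightarrow> x < b \<longrightarrow> act r x = act k x"
          then show ?thesis using cd by auto
        qed (use le[of r] le[of k] in linarith)+
      qed (use cd in simp)
    qed
    obtain x where x: "a < x" "x < b" "act s x \<noteq> act k x" using False by blast
    \<comment> \<open>\<open>s\<close> sends \<open>act w x\<close> to \<open>act k x\<close>, so
      cutting the interval at \<open>act w x\<close> places its image under \<open>s\<close>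
      entirely on one side of \<open>act k x\<close>.\<close>
    define w where "w = inv s \<otimes> k"
    have sw: "act s (act w y) = act k y" for y by (simp add: w_def act_mult)
    show ?thesis
    proof (cases "act s x < act k x")
      case True
      then have "x < act w x" using act_less_iff[of s x "act w x"] by (simp add: sw del: act_less_iff)
      moreover have "act s (min b (act w x)) \<le> act k x" unfolding sw[of x, symmetric] by simp
      ultimately show ?thesis using x by (intro shrink[of x "min b (act w x)"]) auto
    next
      case False
      then have "act w x < x" using x act_less_iff[of s "act w x" x] by (simp add: sw del: act_less_iff)
      moreover have "act k x \<le> act s (max a (act w x))" unfolding sw[of x, symmetric] by simp
      ultimately show ?thesis using x by (intro shrink[of "max a (act w x)" x]) auto
    qed
  qed
qed

text \<open>Every conjugate by \<open>t\<close> is supported in an interval that \<open>k\<close>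
  displaces and on which each \<open>k'\<close> either agrees with \<open>k\<close> or has an image
  disjoint from that of \<open>k\<close>. Both claims are then tested at points of this
  interval.\<close>

lemma mixing:
  assumes S: "finite S" and T: "finite T" "T \<subseteq> C" and kl: "k \<in> S" "l \<in> T" "k \<noteq> \<one>" "l \<noteq> \<one>"
  shows "\<exists>t\<in>H. \<forall>k'\<in>S. \<forall>l'\<in>T.
    (k \<otimes> (t \<otimes> l \<otimes> inv t) = k' \<otimes> (t \<otimes> l' \<otimes> inv t) \<longrightarrow> k' = k \<and> l' = l) \<and>
    k \<otimes> (t \<otimes> l \<otimes> inv t) \<noteq> (t \<otimes> l' \<otimes> inv t) \<otimes> k'"
proof -
  obtain a b where ab: "0 < a" "a < b" "b < 1" "displaces k a b"
    and sep: "\<And>s. s \<in> S \<Longrightarrow> (\<forall>x. a < x \<longrightarrow> x < b \<longrightarrow> act s x = act k x) \<or> act s b \<le> act k a \<or> act k b \<le> act s a"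
    using ex_separating_interval[OF S kl(3)] by blast
  obtain t where t: "t \<in> H" "\<And>l. l \<in> T \<Longrightarrow> t \<otimes> l \<otimes> inv t \<in> rist a b"
    using H_compresses[OF T ab(1-3)] by blast
  define c where "c = (\<lambda>l. t \<otimes> l \<otimes> inv t)"
  have c: "c l \<in> rist a b" if "l \<in> T" for l using t(2)[OF that] by (simp add: c_def)
  have "inv t \<otimes> c x \<otimes> t = x" for x by (simp add: c_def m_assoc)
  then have c_eq: "l' = l''" if "c l' = c l''" for l' l'' using that by metis
  have "c l \<noteq> \<one>" using kl(4) c_eq[of l \<one>] by (auto simp: c_def)
  then obtain p where p: "act (c l) p \<noteq> p" using act_eqI[of "c l" \<one>] by auto
  then have pab: "a < p" "p < b" using ristD[OF c[OF kl(2)], of p] by force+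
  define q where "q = act (c l) p"
  have qab: "a < q" "q < b" unfolding q_def using rist_image_strict[OF c[OF kl(2)]] pab by auto
  have kx: "act k a < act k x \<and> act k x < act k b" if "a < x" "x < b" for x using that by simp
  have "k' = k \<and> l' = l" if k': "k' \<in> S" and l': "l' \<in> T" and eq: "k \<otimes> c l = k' \<otimes> c l'" for k' l'
  proof -
    \<comment> \<open>\<open>k\<close> is \<open>k'\<close> composed with an element supported in
      the interval, so both have the same image of it. This excludes disjoint images; agreement is
      left and forces \<open>w = \<one>\<close>.\<close>
    define w where "w = c l' \<otimes> inv (c l)"
    have w: "w \<in> rist a b"
      unfolding w_def
      by (intro subgroup.m_closed[OF rist_subgroup] subgroup.m_inv_closed[OF rist_subgroup] c l' kl)
    have kw: "k = k' \<otimes> w" using eq by (simp add: w_def solve_right m_assoc)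
    have wp: "a < act w p" "act w p < b" using rist_image_strict[OF w] pab by auto
    from sep[OF k'] have same: "act k' x = act k x" if "a < x" "x < b" for x
    proof (elim disjE)
      assume "act k' b \<le> act k a"
      then have "act k' (act w p) < act k p"
        using kx[OF pab] act_less_iff[of k' "act w p" b] wp by (simp del: act_less_iff)
      then show ?thesis by (simp add: kw act_mult)
    next
      assume "act k b \<le> act k' a"
      then have "act k p < act k' (act w p)"
        using kx[OF pab] act_less_iff[of k' a "act w p"] wp by (simp del: act_less_iff)
      then show ?thesis by (simp add: kw act_mult)
    qed (use that in auto)
    have "w = \<one>"
    proof (rule act_eqI)
      fix x
      show "act w x = act \<one> x"
      proof (cases "a < x \<and> x < b")
        case True
        then have "act k x = act k' x" using same by simp
        then have "act k' (act w x) = act k' x" unfolding kw by (simp add: act_mult)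
        then show ?thesis by simp
      qed (use ristD[OF w, of x] in auto)
    qed
    then show ?thesis using kw c_eq[of l' l] by (auto simp: w_def solve_right)
  qed
  moreover have "k \<otimes> c l \<noteq> c l' \<otimes> k'" if k': "k' \<in> S" and l': "l' \<in> T" for k' l'
  proof
    assume eq: "k \<otimes> c l = c l' \<otimes> k'"
    have fix_k: "act (c l') (act k x) = act k x" if "a < x" "x < b" for x
    proof (rule ristD[OF c[OF l']])
      show "act k x \<le> a \<or> b \<le> act k x" using kx[OF that] ab(4) unfolding displaces_def by linarith
    qed
    have eq': "act k (act (c l) x) = act (c l') (act k' x)" for x
      using arg_cong[OF eq, of "\<lambda>g. act g x"] by (simp add: act_mult)
    have k'x: "act k' a < act k' p \<and> act k' p < act k' b" using pab by simp
    \<comment> \<open>Evaluated at \<open>p\<close>, the left side lies in the image of the interval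
      under \<open>k\<close>, hence outside the interval. The right side lies in the interval or
      equals \<open>act k' p\<close>, which is outside that image if the images are
      disjoint.\<close>
    have inside: "a < act (c l') y \<and> act (c l') y < b \<or> act (c l') y = y" for y
      using rist_image_strict[OF c[OF l'], of y] ristD[OF c[OF l'], of y] by force
    from sep[OF k'] show False
    proof (elim disjE)
      assume "\<forall>x. a < x \<longrightarrow> x < b \<longrightarrow> act k' x = act k x"
      then have "act k (act (c l) p) = act k p" using eq'[of p] fix_k[OF pab] pab by simp
      then show False using p by simp
    next
      assume "act k' b \<le> act k a"
      then show False
        using eq'[of p] inside[of "act k' p"] kx[OF qab] k'x ab(4) unfolding q_def displaces_def by force
    next
      assume "act k b \<le> act k' a"
      then show False
        using eq'[of p] inside[of "act k' p"] kx[OF qab] k'x ab(4) unfolding q_def displaces_def by force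
    qed
  qed
  ultimately show ?thesis using t(1) unfolding c_def by blast
qed

subsection \<open>The commutator subgroup\<close>

lemma H_normal: "H \<lhd> G"
  unfolding normal_inv_iff
proof (intro conjI H_subgroup ballI)
  fix x h assume "h \<in> H"
  then have "(x \<otimes> h \<otimes> inv x \<otimes> inv h) \<otimes> h \<in> H"
    by (rule subgroup.m_closed[OF H_subgroup commutator_in_H])
  then show "x \<otimes> h \<otimes> inv x \<in> H" by (simp add: m_assoc)
qed

text \<open>The second commutator subgroup. It turns out to contain \<open>H\<close>, so
  \<open>H\<close> is perfect, as Higman's argument requires.\<close>

abbreviation D :: "'a set" where "D \<equiv> derived G H"

lemma D_normal: "D \<lhd> G" by (rule derived_is_normal[OF H_normal])

lemma D_subgroup: "subgroup D G" by (rule normal_imp_subgroup[OF D_normal])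

lemma D_conj: "d \<in> D \<Longrightarrow> g \<otimes> d \<otimes> inv g \<in> D"
  using D_normal unfolding normal_inv_iff by simp

text \<open>\<open>u\<close> and \<open>v\<close> need not lie in \<open>H\<close>, but they do
  after multiplication by far-away conjugates of their inverses, which makes them commutators. With
  three disjoint supports these factors cancel in the commutator.\<close>

lemma commutator_C_in_D:
  assumes "u \<in> C" "v \<in> C"
  shows "u \<otimes> v \<otimes> inv u \<otimes> inv v \<in> D"
proof -
  obtain c d where cd: "0 < c" "c < d" "d < 1" "u \<in> rist c d" "v \<in> rist c d"
    using comp_supp_common[of "{u, v}" 0 1] assms by auto
  obtain s where s: "d < act s c" using push_up[of 0 1 c d] cd by auto
  have sd: "act s d < 1" using cd by simp
  obtain t where t: "act s d < act t c" using push_up[of 0 1 c "act s d"] cd sd by auto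
  define a b where "a = s \<otimes> inv u \<otimes> inv s" and "b = t \<otimes> inv v \<otimes> inv t"
  have a: "a \<in> rist (act s c) (act s d)" and b: "b \<in> rist (act t c) (act t d)"
    unfolding a_def b_def by (intro conjugate_rist subgroup.m_inv_closed[OF rist_subgroup] cd)+
  have "act s c < act s d" using cd by simp
  then have dt: "d < act t c" using s t by linarith
  have "u \<otimes> a \<in> H" "v \<otimes> b \<in> H"
    using commutator_in_H[of u s] commutator_in_H[of v t] by (simp_all add: a_def b_def m_assoc)
  then have "(u \<otimes> a) \<otimes> (v \<otimes> b) \<otimes> inv (u \<otimes> a) \<otimes> inv (v \<otimes> b) \<in> D"
    unfolding derived_def[of G H] by (intro generate.incl) blast
  moreover have "(u \<otimes> a) \<otimes> (v \<otimes> b) \<otimes> inv (u \<otimes> a) \<otimes> inv (v \<otimes> b) = u \<otimes> v \<otimes> inv u \<otimes> inv v"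
    by (rule commutator_cancel; rule disjoint_commute[OF a] disjoint_commute[OF b])
      (use cd(4,5) a b s t dt in \<open>auto intro: less_imp_le\<close>)
  ultimately show ?thesis by simp
qed

lemma ex_\<chi>\<^sub>0:
  assumes r: "0 < r" "r < 1"
  shows "\<exists>p. \<chi>\<^sub>0 p = k \<and> (\<forall>x\<ge>r. act p x = x)"
proof -
  let ?K = "{g. \<forall>x\<in>{r..}. act g x = x}"
  obtain p where p: "\<chi>\<^sub>0 p = 1" "p \<in> ?K" using \<chi>\<^sub>0_one[OF r] by auto
  have "\<exists>q\<in>?K. \<chi>\<^sub>0 q = k"
  proof (induction k rule: int_induct[where k = 0])
    case base
    then show ?case by (intro bexI[of _ \<one>]) auto
  next
    case (step1 i)
    then obtain q where q: "q \<in> ?K" "\<chi>\<^sub>0 q = i" by blast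
    show ?case
      by (rule bexI[OF _ subgroup.m_closed[OF subgroup_fixing q(1) p(2)]]) (simp add: \<chi>\<^sub>0_mult q p)
  next
    case (step2 i)
    then obtain q where q: "q \<in> ?K" "\<chi>\<^sub>0 q = i" by blast
    show ?case
      by (rule bexI[OF _ subgroup.m_closed[OF subgroup_fixing q(1) subgroup.m_inv_closed[OF subgroup_fixing p(2)]]])
        (simp add: \<chi>\<^sub>0_mult q p)
  qed
  then show ?thesis by auto
qed

lemma ex_\<chi>\<^sub>1:
  assumes r: "0 < r" "r < 1"
  shows "\<exists>p. \<chi>\<^sub>1 p = k \<and> (\<forall>x\<le>r. act p x = x)"
proof -
  let ?K = "{g. \<forall>x\<in>{..r}. act g x = x}"
  obtain p where p: "\<chi>\<^sub>1 p = 1" "p \<in> ?K" using \<chi>\<^sub>1_one[OF r] by auto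
  have "\<exists>q\<in>?K. \<chi>\<^sub>1 q = k"
  proof (induction k rule: int_induct[where k = 0])
    case base
    then show ?case by (intro bexI[of _ \<one>]) auto
  next
    case (step1 i)
    then obtain q where q: "q \<in> ?K" "\<chi>\<^sub>1 q = i" by blast
    show ?case
      by (rule bexI[OF _ subgroup.m_closed[OF subgroup_fixing q(1) p(2)]]) (simp add: \<chi>\<^sub>1_mult q p)
  next
    case (step2 i)
    then obtain q where q: "q \<in> ?K" "\<chi>\<^sub>1 q = i" by blast
    show ?case
      by (rule bexI[OF _ subgroup.m_closed[OF subgroup_fixing q(1) subgroup.m_inv_closed[OF subgroup_fixing p(2)]]])
        (simp add: \<chi>\<^sub>1_mult q p)
  qed
  then show ?thesis by auto
qed

text \<open>The behaviour of \<open>g\<close> at the end points is cancelled by factors that are the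
  identity on the interval from \<open>c\<close> to \<open>d\<close>.\<close>

lemma C_approximates:
  assumes cd: "0 < c" "c < 1" "0 < d" "d < 1"
  obtains h where "h \<in> C" "\<And>x. c \<le> x \<Longrightarrow> x \<le> d \<Longrightarrow> act h x = act g x"
proof -
  obtain p where p: "\<chi>\<^sub>0 p = - \<chi>\<^sub>0 g" "\<And>x. c \<le> x \<Longrightarrow> act p x = x" using ex_\<chi>\<^sub>0[of c] cd by blast
  obtain q where q: "\<chi>\<^sub>1 q = - \<chi>\<^sub>1 g" "\<And>x. x \<le> d \<Longrightarrow> act q x = x" using ex_\<chi>\<^sub>1[of d] cd by blast
  have "\<chi>\<^sub>1 p = 0" "\<chi>\<^sub>0 q = 0" unfolding \<chi>\<^sub>0_eq_0_iff \<chi>\<^sub>1_eq_0_iff using p(2) q(2) cd by blast+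
  then have "g \<otimes> p \<otimes> q \<in> C" by (simp add: C_iff \<chi>\<^sub>0_mult \<chi>\<^sub>1_mult p q)
  then show ?thesis by (rule that) (simp add: act_mult p q)
qed

text \<open>The commutator with \<open>f\<close> depends only on how \<open>g\<close> acts on the
  support of \<open>f\<close>, so \<open>g\<close> can be replaced by an element of
  \<open>C\<close>.\<close>

lemma commutator_C_G_in_D:
  assumes f: "f \<in> C"
  shows "f \<otimes> g \<otimes> inv f \<otimes> inv g \<in> D"
proof -
  obtain c d where cd: "0 < c" "c < d" "d < 1" "f \<in> rist c d"
    using comp_supp_common[of "{f}" 0 1] f by auto
  obtain h where h: "h \<in> C" "\<And>x. c \<le> x \<Longrightarrow> x \<le> d \<Longrightarrow> act h x = act g x"
    by (rule C_approximates[of c d g]) (use cd in auto)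
  define w where "w = inv g \<otimes> h"
  have fw: "inv f \<otimes> w = w \<otimes> inv f"
    by (rule commute_fixing[OF subgroup.m_inv_closed[OF rist_subgroup cd(4)]])
      (use h cd in \<open>simp_all add: w_def act_mult\<close>)
  have "f \<otimes> h \<otimes> inv f \<otimes> inv h = f \<otimes> g \<otimes> (w \<otimes> inv f) \<otimes> inv w \<otimes> inv g"
    by (simp add: w_def m_assoc inv_mult_group)
  also have "\<dots> = f \<otimes> g \<otimes> inv f \<otimes> inv g"
    unfolding fw[symmetric] by (simp add: m_assoc)
  finally show ?thesis using commutator_C_in_D[OF f h(1)] by simp
qed

text \<open>\<open>C\<close> is the kernel of the pair of characters, and \<open>p\<close> and
  \<open>q\<close> map to the standard basis of the pairs of integers.\<close>

lemma subgroup_containing_C: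
  assumes N: "subgroup N G" "C \<subseteq> N"
    and p: "p \<in> N" "\<chi>\<^sub>0 p = 1" "\<chi>\<^sub>1 p = 0" and q: "q \<in> N" "\<chi>\<^sub>0 q = 0" "\<chi>\<^sub>1 q = 1"
  shows "g \<in> N"
proof -
  have "\<exists>r\<in>N. \<chi>\<^sub>0 r = i \<and> \<chi>\<^sub>1 r = 0" for i
  proof (induction i rule: int_induct[where k = 0])
    case base
    then show ?case using subgroup.one_closed[OF N(1)] by (intro bexI[of _ \<one>]) auto
  next
    case (step1 i)
    then obtain r where r: "r \<in> N" "\<chi>\<^sub>0 r = i" "\<chi>\<^sub>1 r = 0" by blast
    show ?case
      by (rule bexI[OF _ subgroup.m_closed[OF N(1) r(1) p(1)]]) (simp add: \<chi>\<^sub>0_mult \<chi>\<^sub>1_mult r p)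
  next
    case (step2 i)
    then obtain r where r: "r \<in> N" "\<chi>\<^sub>0 r = i" "\<chi>\<^sub>1 r = 0" by blast
    show ?case
      by (rule bexI[OF _ subgroup.m_closed[OF N(1) r(1) subgroup.m_inv_closed[OF N(1) p(1)]]])
        (simp add: \<chi>\<^sub>0_mult \<chi>\<^sub>1_mult r p)
  qed
  note p' = this
  have "\<exists>r\<in>N. \<chi>\<^sub>0 r = 0 \<and> \<chi>\<^sub>1 r = i" for i
  proof (induction i rule: int_induct[where k = 0])
    case base
    then show ?case using subgroup.one_closed[OF N(1)] by (intro bexI[of _ \<one>]) auto
  next
    case (step1 i)
    then obtain r where r: "r \<in> N" "\<chi>\<^sub>0 r = 0" "\<chi>\<^sub>1 r = i" by blast
    show ?case
      by (rule bexI[OF _ subgroup.m_closed[OF N(1) r(1) q(1)]]) (simp add: \<chi>\<^sub>0_mult \<chi>\<^sub>1_mult r q)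
  next
    case (step2 i)
    then obtain r where r: "r \<in> N" "\<chi>\<^sub>0 r = 0" "\<chi>\<^sub>1 r = i" by blast
    show ?case
      by (rule bexI[OF _ subgroup.m_closed[OF N(1) r(1) subgroup.m_inv_closed[OF N(1) q(1)]]])
        (simp add: \<chi>\<^sub>0_mult \<chi>\<^sub>1_mult r q)
  qed
  note q' = this
  obtain r s where rs: "r \<in> N" "\<chi>\<^sub>0 r = \<chi>\<^sub>0 g" "\<chi>\<^sub>1 r = 0" "s \<in> N" "\<chi>\<^sub>0 s = 0" "\<chi>\<^sub>1 s = \<chi>\<^sub>1 g"
    using p'[of "\<chi>\<^sub>0 g"] q'[of "\<chi>\<^sub>1 g"] by blast
  have "g \<otimes> inv r \<otimes> inv s \<in> C" by (simp add: C_iff \<chi>\<^sub>0_mult \<chi>\<^sub>1_mult rs)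
  then have "(g \<otimes> inv r \<otimes> inv s) \<otimes> s \<otimes> r \<in> N"
    using N(2) rs subgroup.m_closed[OF N(1)] by blast
  then show ?thesis by (simp add: m_assoc)
qed

text \<open>The preimage of a centralizer in the quotient by \<open>D\<close>, stated without the
  quotient.\<close>

lemma centralizer_mod_D: "subgroup {g. x \<otimes> g \<otimes> inv x \<otimes> inv g \<in> D} G"
proof (rule subgroupI_UNIV)
  show "\<one> \<in> {g. x \<otimes> g \<otimes> inv x \<otimes> inv g \<in> D}" using subgroup.one_closed[OF D_subgroup] by simp
next
  fix g h assume gh: "g \<in> {g. x \<otimes> g \<otimes> inv x \<otimes> inv g \<in> D}" "h \<in> {g. x \<otimes> g \<otimes> inv x \<otimes> inv g \<in> D}"
  have "(x \<otimes> g \<otimes> inv x \<otimes> inv g) \<otimes> (g \<otimes> (x \<otimes> h \<otimes> inv x \<otimes> inv h) \<otimes> inv g) \<in> D"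
    by (rule subgroup.m_closed[OF D_subgroup _ D_conj]) (use gh in auto)
  then show "g \<otimes> h \<in> {g. x \<otimes> g \<otimes> inv x \<otimes> inv g \<in> D}" by (simp add: m_assoc inv_mult_group)
next
  fix g assume "g \<in> {g. x \<otimes> g \<otimes> inv x \<otimes> inv g \<in> D}"
  then have "inv g \<otimes> inv (x \<otimes> g \<otimes> inv x \<otimes> inv g) \<otimes> inv (inv g) \<in> D"
    by (intro D_conj subgroup.m_inv_closed[OF D_subgroup]) auto
  then show "inv g \<in> {g. x \<otimes> g \<otimes> inv x \<otimes> inv g \<in> D}" by (simp add: m_assoc inv_mult_group)
qed

text \<open>Modulo \<open>D\<close>, the elements of \<open>C\<close> are central, and together with two commuting elements they
  generate everything.\<close>

lemma commutator_in_D: "f \<otimes> g \<otimes> inv f \<otimes> inv g \<in> D"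
proof -
  let ?Z = "\<lambda>x. {g. x \<otimes> g \<otimes> inv x \<otimes> inv g \<in> D}"
  have sym: "f \<in> ?Z g" if "g \<in> ?Z f" for f g
  proof -
    have "inv (f \<otimes> g \<otimes> inv f \<otimes> inv g) \<in> D" using that by (intro subgroup.m_inv_closed[OF D_subgroup]) simp
    then show ?thesis by (simp add: m_assoc inv_mult_group)
  qed
  have C: "C \<subseteq> ?Z x" for x using commutator_C_G_in_D sym by blast
  obtain p where p: "\<chi>\<^sub>0 p = 1" "\<And>x. 1/2 \<le> x \<Longrightarrow> act p x = x" using \<chi>\<^sub>0_one[of "1/2"] by auto
  obtain q where q: "\<chi>\<^sub>1 q = 1" "\<And>x. x \<le> 1/2 \<Longrightarrow> act q x = x" using \<chi>\<^sub>1_one[of "1/2"] by auto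
  have pq: "\<chi>\<^sub>1 p = 0" "\<chi>\<^sub>0 q = 0"
    unfolding \<chi>\<^sub>0_eq_0_iff \<chi>\<^sub>1_eq_0_iff using p(2) q(2) by (auto intro!: exI[of _ "1/2"])
  have "p \<in> rist 0 (1/2)" "q \<in> rist (1/2) 1"
    using p(2) q(2) by (auto simp: rist_def act_outside)
  then have comm: "p \<otimes> q = q \<otimes> p" by (rule disjoint_commute) simp
  have 1: "\<one> \<in> D" by (rule subgroup.one_closed[OF D_subgroup])
  have qp: "q \<in> ?Z p" unfolding mem_Collect_eq comm using 1 by (simp add: m_assoc)
  have refl: "x \<in> ?Z x" for x using 1 by (simp add: m_assoc)
  \<comment> \<open>Applied modulo \<open>D\<close> to the centralizers of \<open>p\<close>, of
    \<open>q\<close>, and finally of an arbitrary \<open>f\<close>.\<close>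
  note gen = subgroup_containing_C[OF centralizer_mod_D C _ p(1) pq(1) _ pq(2) q(1)]
  have Zp: "g \<in> ?Z p" and Zq: "g \<in> ?Z q" for g
    by (rule gen[OF refl qp], rule gen[OF sym[OF qp] refl])
  have "g \<in> ?Z f" by (rule gen[OF sym[OF Zp] sym[OF Zq]])
  then show ?thesis by simp
qed

text \<open>Perfectness puts \<open>H\<close> into \<open>D\<close>, and \<open>D\<close> is
  generated by the commutators of elements of \<open>H\<close>.\<close>

lemma commutators_subset_imp_H_subset:
  assumes N: "subgroup N G" and comm: "\<And>u v. u \<in> H \<Longrightarrow> v \<in> H \<Longrightarrow> u \<otimes> v \<otimes> inv u \<otimes> inv v \<in> N"
  shows "H \<subseteq> N"
proof -
  have H: "H = generate G (derived_set G (carrier G))" by (rule derived_def)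
  have "generate G (derived_set G (carrier G)) \<subseteq> D"
    by (rule generate_subgroup_incl[OF _ D_subgroup]) (use commutator_in_D in auto)
  then have "H \<subseteq> D" unfolding H[symmetric] .
  also have "D \<subseteq> N"
    unfolding derived_def[of G H]
    by (rule generate_subgroup_incl[OF _ N]) (use comm in auto)
  finally show ?thesis .
qed

text \<open>If \<open>n\<close> displaces \<open>(a, b)\<close>, then \<open>[[x, n], y] = [x, y]\<close> for \<open>x\<close> and \<open>y\<close> supported there.\<close>

lemma invariant_subgroup:
  assumes N: "subgroup N G" and conj: "\<And>h n. h \<in> H \<Longrightarrow> n \<in> N \<Longrightarrow> h \<otimes> n \<otimes> inv h \<in> N"
    and n: "n \<in> N" "n \<in> H" "n \<noteq> \<one>"
  shows "H \<subseteq> N"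
proof (rule commutators_subset_imp_H_subset[OF N])
  fix u v assume uv: "u \<in> H" "v \<in> H"
  obtain a b where ab: "0 < a" "a < b" "b < 1" "displaces n a b" using ex_displaced[OF n(3)] .
  have local: "x \<otimes> y \<otimes> inv x \<otimes> inv y \<in> N" if x: "x \<in> H" "x \<in> rist a b" and y: "y \<in> H" "y \<in> rist a b" for x y
  proof -
    define z where "z = n \<otimes> inv x \<otimes> inv n"
    have z: "z \<in> rist (act n a) (act n b)"
      unfolding z_def by (intro conjugate_rist subgroup.m_inv_closed[OF rist_subgroup] x)
    \<comment> \<open>The commutator of \<open>x\<close> and \<open>n\<close>; it lies in
      \<open>N\<close> because \<open>N\<close> is stable under conjugation by
      \<open>x\<close>.\<close>
    define w where "w = x \<otimes> z"
    have w: "w \<in> N"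
      using subgroup.m_closed[OF N conj[OF x(1) n(1)] subgroup.m_inv_closed[OF N n(1)]]
      by (simp add: w_def z_def m_assoc)
    have "w \<otimes> (y \<otimes> inv w \<otimes> inv y) \<in> N"
      by (intro subgroup.m_closed[OF N] w conj y subgroup.m_inv_closed[OF N])
    moreover have "w \<otimes> (y \<otimes> \<one>) \<otimes> inv w \<otimes> inv (y \<otimes> \<one>) = x \<otimes> y \<otimes> inv x \<otimes> inv y"
      unfolding w_def
      by (rule commutator_cancel[OF disjoint_commute[OF z y(2)]])
        (use ab(4) in \<open>auto simp: displaces_def\<close>)
    ultimately show ?thesis by (simp add: m_assoc)
  qed
  \<comment> \<open>Conjugating back by \<open>inv t\<close>, which preserves \<open>N\<close>,
    recovers the commutator of \<open>u\<close> and \<open>v\<close> from one supported in the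
    displaced interval.\<close>
  obtain t where t: "t \<in> H" "\<And>l. l \<in> {u, v} \<Longrightarrow> t \<otimes> l \<otimes> inv t \<in> rist a b"
    by (rule H_compresses[of "{u, v}" a b]) (use ab uv H_subset_C in auto)
  have tH: "t \<otimes> l \<otimes> inv t \<in> H" if "l \<in> H" for l
    using H_normal that unfolding normal_inv_iff by simp
  have "inv t \<in> H" by (rule subgroup.m_inv_closed[OF H_subgroup t(1)])
  from conj[OF this local[OF tH[OF uv(1)] t(2) tH[OF uv(2)] t(2)]]
  show "u \<otimes> v \<otimes> inv u \<otimes> inv v \<in> N" by (simp add: m_assoc inv_mult_group)
qed

theorem rigid: "rigid_group G H C"
  by (intro rigid_group.intro rigid_group_axioms.intro full_group_axioms H_subgroup order_refl
      relatively_icc centralizer_orbit mixing invariant_subgroup)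

end

section \<open>Thompson's group\<close>

lemma ex_dyadic_between:
  fixes x y :: real
  assumes "x < y" obtains d where "d \<in> dyadic_rationals" "x < d" "d < y"
proof -
  obtain n where n: "1 / (y - x) < 2 ^ n" using real_arch_pow[of 2 "1 / (y - x)"] by auto
  define d :: real where "d = of_int (\<lfloor>x * 2 ^ n\<rfloor> + 1) / 2 ^ n"
  have gap: "1 < (y - x) * 2 ^ n" using n assms by (simp add: divide_less_eq mult.commute)
  have d: "d * 2 ^ n = of_int \<lfloor>x * 2 ^ n\<rfloor> + 1" by (simp add: d_def)
  have "x * 2 ^ n < d * 2 ^ n" "d * 2 ^ n < y * 2 ^ n"
    unfolding d using gap unfolding left_diff_distrib by linarith+
  then have "x < d" "d < y" by simp_all
  moreover have "d \<in> dyadic_rationals" unfolding dyadic_rationals_def d_def by blast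
  ultimately show ?thesis using that by blast
qed

text \<open>On \<open>[a, b]\<close> the slopes are 2, 1 and 1/2, changing at
  \<open>(3 * a + b) / 4\<close> and \<open>(a + b) / 2\<close>; the outer maximum gives the
  identity elsewhere. In this form all comparisons are linear arithmetic.\<close>

definition bump_map :: "real \<Rightarrow> real \<Rightarrow> real \<Rightarrow> real"
  where "bump_map a b x = max x (min (2 * x - a) (min (x + (b - a) / 4) ((x + b) / 2)))"

lemmas min_max_le_iff = max.bounded_iff min_le_iff_disj le_max_iff_disj min.bounded_iff
lemmas min_max_less_iff = max_less_iff_conj min_less_iff_disj less_max_iff_disj min_less_iff_conj

lemma dyadic_average:
  assumes "a \<in> dyadic_rationals" "b \<in> dyadic_rationals"
  shows "(a + b) / 2 \<in> dyadic_rationals"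
  using dyadic_mult[OF dyadic_add[OF assms] dyadic_powi[of "-1"]] by (simp add: power_int_minus)

lemma bump_map_outside: "a < b \<Longrightarrow> x \<le> a \<or> b \<le> x \<Longrightarrow> bump_map a b x = x"
  unfolding bump_map_def order_eq_iff min_max_le_iff by argo

lemma bump_map_less: "x < y \<Longrightarrow> bump_map a b x < bump_map a b y"
  unfolding bump_map_def min_max_less_iff by argo

lemma bump_map_greater: "a < x \<Longrightarrow> x < b \<Longrightarrow> x < bump_map a b x"
  unfolding bump_map_def min_max_less_iff by argo

lemma bump_map_thompson:
  assumes ab: "a \<in> dyadic_rationals" "b \<in> dyadic_rationals" "0 \<le> a" "a < b" "b \<le> 1"
  shows "restrict (bump_map a b) {0..1} \<in> thompson_maps"
proof (rule thompson_mapsI)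
  \<comment> \<open>The inverse: each affine piece is inverted, and minimum and maximum change
    places. The equivalence \<open>galois\<close> then yields the inverse laws without treating the
    pieces separately.\<close>
  define h where "h = (\<lambda>y. min y (max ((y + a) / 2) (max (y - (b - a) / 4) (2 * y - b))))"
  have galois: "bump_map a b x \<le> y \<longleftrightarrow> x \<le> h y" for x y
    unfolding bump_map_def h_def min_max_le_iff by argo
  have h_less: "h x < h y" if "x < y" for x y
    using that unfolding h_def min_max_less_iff by argo
  have le: "bump_map a b x \<le> bump_map a b y \<longleftrightarrow> x \<le> y" for x y
    using bump_map_less[of x y a b] bump_map_less[of y x a b] by (cases x y rule: linorder_cases) auto
  have inverse: "h (bump_map a b x) = x" for x
  proof (rule order_antisym)
    show "h (bump_map a b x) \<le> x" by (rule le[THEN iffD1], rule galois[THEN iffD2]) simp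
    show "x \<le> h (bump_map a b x)" by (rule galois[THEN iffD1]) simp
  qed
  have inverse': "bump_map a b (h y) = y" for y
    using inverse[of "h y"] h_less[of "bump_map a b (h y)" y] h_less[of y "bump_map a b (h y)"]
    by (cases "bump_map a b (h y)" y rule: linorder_cases) linarith+
  have bounds: "bump_map a b x \<in> {0..1}" "h x \<in> {0..1}" if "x \<in> {0..1}" for x
    using that ab(3-5) unfolding bump_map_def h_def atLeastAtMost_iff min_max_le_iff by argo+
  show "homeomorphism {0..1} {0..1} (restrict (bump_map a b) {0..1}) h"
  proof (intro homeomorphism_restrict homeomorphismI)
    show "continuous_on {0..1} (bump_map a b)" unfolding bump_map_def by (intro continuous_intros) auto
    show "continuous_on {0..1} h" unfolding h_def by (intro continuous_intros) auto
    show "bump_map a b ` {0..1} \<subseteq> {0..1}" "h ` {0..1} \<subseteq> {0..1}" using bounds by blast+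
  qed (rule inverse inverse')+
  show "strict_mono_on {0..1} (restrict (bump_map a b) {0..1})"
  proof (rule strict_mono_onI)
    fix x y :: real assume "x \<in> {0..1}" "y \<in> {0..1}" "x < y"
    then show "restrict (bump_map a b) {0..1} x < restrict (bump_map a b) {0..1} y"
      by (simp add: bump_map_less)
  qed
  let ?m = "(a + b) / 2"
  let ?l = "(a + ?m) / 2"
  show "dyadic_affine_off {a, ?l, ?m, b} (restrict (bump_map a b) {0..1})"
    unfolding dyadic_affine_off_def
  proof (intro conjI allI impI)
    show "{a, ?l, ?m, b} \<subseteq> dyadic_rationals" using ab by (auto intro: dyadic_average)
    fix p q assume pq: "0 \<le> p \<and> p < q \<and> q \<le> 1 \<and> {p<..<q} \<inter> {a, ?l, ?m, b} = {}"
    then have "\<And>s. s \<in> {a, ?l, ?m, b} \<Longrightarrow> s \<le> p \<or> q \<le> s" by (auto simp: not_less)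
    then have "a \<le> p \<or> q \<le> a" "?l \<le> p \<or> q \<le> ?l" "?m \<le> p \<or> q \<le> ?m" "b \<le> p \<or> q \<le> b" by blast+
    then consider "q \<le> a \<or> b \<le> p" | "a \<le> p" "q \<le> ?l" | "?l \<le> p" "q \<le> ?m" | "?m \<le> p" "q \<le> b"
      using ab by linarith
    then have "\<exists>(k :: int) c. \<forall>x\<in>{p..q}. bump_map a b x = 2 powi k * x + c"
    proof cases
      case 1
      then have "\<forall>x\<in>{p..q}. bump_map a b x = 2 powi 0 * x + 0" using ab(4) by (auto intro: bump_map_outside)
      then show ?thesis by blast
    next
      case 2
      then have "bump_map a b x = 2 * x + - a" if "x \<in> {p..q}" for x
        using that ab(4) unfolding bump_map_def atLeastAtMost_iff order_eq_iff min_max_le_iff by argo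
      then show ?thesis by (intro exI[of _ 1] exI[of _ "- a"]) simp
    next
      case 3
      then have "bump_map a b x = x + (b - a) / 4" if "x \<in> {p..q}" for x
        using that ab(4) unfolding bump_map_def atLeastAtMost_iff order_eq_iff min_max_le_iff by argo
      then show ?thesis by (intro exI[of _ 0] exI[of _ "(b - a) / 4"]) simp
    next
      case 4
      then have "bump_map a b x = x / 2 + b / 2" if "x \<in> {p..q}" for x
        using that ab(4) unfolding bump_map_def atLeastAtMost_iff order_eq_iff min_max_le_iff by argo
      then show ?thesis by (intro exI[of _ "-1"] exI[of _ "b / 2"]) (simp add: power_int_minus)
    qed
    moreover have "{p..q} \<subseteq> {0..1}" using pq by auto
    ultimately show "\<exists>(k :: int) c. \<forall>x\<in>{p..q}. restrict (bump_map a b) {0..1} x = 2 powi k * x + c"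
      by (simp add: subset_iff)
  qed simp
qed simp

text \<open>\<open>Rep_thompson g\<close> is undefined off the unit interval; extension by the
  identity gives an increasing action on the whole line.\<close>

definition thompson_act :: "thompson \<Rightarrow> real \<Rightarrow> real"
  where "thompson_act g x = (if x \<in> {0..1} then Rep_thompson g x else x)"

lemma ex_thompson_bump:
  assumes "a \<in> dyadic_rationals" "b \<in> dyadic_rationals" "0 \<le> a" "a < b" "b \<le> 1"
  obtains g where "thompson_act g = bump_map a b"
proof
  show "thompson_act (Abs_thompson (restrict (bump_map a b) {0..1})) = bump_map a b"
    using assms
    by (auto simp: thompson_act_def fun_eq_iff Abs_thompson_inverse bump_map_thompson bump_map_outside)
qed

section \<open>Germs at the end points\<close>

lemma thompson_maps_endpoints:
  assumes g: "g \<in> thompson_maps"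
  shows "g 0 = 0" "g 1 = 1" "x \<in> {0..1} \<Longrightarrow> g x \<in> {0..1}"
proof -
  obtain h where h: "homeomorphism {0..1} {0..1} g h" and mono: "strict_mono_on {0..1} g"
    using g by (auto simp: thompson_maps_def)
  show "g 0 = 0" by (rule unit_homeomorphism_zero[OF h mono])
  have img: "g ` {0..1} = {0..1}" using h by (simp add: homeomorphism_def)
  then show in01: "g x \<in> {0..1}" if "x \<in> {0..1}" for x using that by blast
  then have "g 1 \<le> 1" by simp
  obtain x where "x \<in> {0..1}" "g x = 1" using img by (metis atLeastAtMost_iff imageE order_refl zero_le_one)
  then have "1 \<le> g 1" using strict_mono_onD[OF mono, of x 1] by (cases "x = 1") auto
  then show "g 1 = 1" using \<open>g 1 \<le> 1\<close> by simp
qed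

text \<open>One formula covers the right germ at 0 and the left germ at 1, since both points are
  fixed. Recording the exponent makes the chain rule additive.\<close>

definition end_slope :: "real \<Rightarrow> thompson \<Rightarrow> int \<Rightarrow> bool"
  where "end_slope e g k \<longleftrightarrow>
    (\<exists>d>0. \<forall>x\<in>{0..1}. \<bar>x - e\<bar> < d \<longrightarrow> thompson_act g x = e + 2 powi k * (x - e))"

definition log_slope :: "real \<Rightarrow> thompson \<Rightarrow> int"
  where "log_slope e g = (THE k. end_slope e g k)"

lemma ex_end_slope:
  assumes e: "e = 0 \<or> e = 1" shows "\<exists>k. end_slope e g k"
proof -
  let ?g = "Rep_thompson g"
  have g: "?g \<in> thompson_maps" by (rule Rep_thompson)
  obtain S where S: "dyadic_affine_off S ?g" using thompson_maps_imp_dyadic_affine_off[OF g] .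
  then have fin: "finite S" by (simp add: dyadic_affine_off_def)
  have "\<exists>a b. 0 \<le> a \<and> a < b \<and> b \<le> 1 \<and> {a<..<b} \<inter> S = {} \<and> e \<in> {a, b}"
    using e
  proof
    assume "e = 0"
    obtain b where "0 < b" "b \<le> 1" "{0<..<b} \<inter> S = {}" using right_gap[OF fin, of 0] by auto
    then show ?thesis using \<open>e = 0\<close> by (intro exI[of _ 0] exI[of _ b]) auto
  next
    assume "e = 1"
    obtain a where "0 \<le> a" "a < 1" "{a<..<1} \<inter> S = {}" using left_gap[OF fin, of 1] by auto
    then show ?thesis using \<open>e = 1\<close> by (intro exI[of _ a] exI[of _ 1]) auto
  qed
  then obtain a b where ab: "0 \<le> a" "a < b" "b \<le> 1" "{a<..<b} \<inter> S = {}" "e \<in> {a, b}" by blast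
  obtain k c where kc: "\<And>x. x \<in> {a..b} \<Longrightarrow> ?g x = 2 powi k * x + c"
    by (rule dyadic_affine_offD[OF S ab(1-4)]) blast
  have "?g e = e" using thompson_maps_endpoints[OF g] e by auto
  then have c: "c = e - 2 powi k * e" using kc[of e] ab by auto
  have "thompson_act g x = e + 2 powi k * (x - e)" if "x \<in> {0..1}" "\<bar>x - e\<bar> < b - a" for x
  proof -
    have "x \<in> {a..b}" using that e ab by auto
    then show ?thesis using kc[of x] c that by (simp add: thompson_act_def algebra_simps)
  qed
  then show ?thesis unfolding end_slope_def using ab by (intro exI[of _ k] exI[of _ "b - a"]) auto
qed

lemma end_slope_unique:
  assumes e: "e = 0 \<or> e = 1" and kl: "end_slope e g k" "end_slope e g l"
  shows "k = l"
proof -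
  obtain d1 where d1: "d1 > 0" "\<And>x. x \<in> {0..1} \<Longrightarrow> \<bar>x - e\<bar> < d1 \<Longrightarrow> thompson_act g x = e + 2 powi k * (x - e)"
    using kl(1) unfolding end_slope_def by blast
  obtain d2 where d2: "d2 > 0" "\<And>x. x \<in> {0..1} \<Longrightarrow> \<bar>x - e\<bar> < d2 \<Longrightarrow> thompson_act g x = e + 2 powi l * (x - e)"
    using kl(2) unfolding end_slope_def by blast
  \<comment> \<open>At most 1/2 so that a point at this distance from \<open>e\<close> stays in the
    unit interval, and halved to lie strictly below both radii.\<close>
  define d where "d = min (1 / 2) (min d1 d2 / 2)"
  have d: "0 < d" "d < 1" "d < d1" "d < d2" using d1(1) d2(1) by (auto simp: d_def)
  define x where "x = (if e = 0 then d else 1 - d)"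
  have "x \<in> {0..1}" "\<bar>x - e\<bar> = d" using e d by (auto simp: x_def)
  then have "2 powi k * (x - e) = 2 powi l * (x - e)" "x \<noteq> e" using d1(2)[of x] d2(2)[of x] d by auto
  then have "(2 :: real) powi k = 2 powi l" by simp
  then show ?thesis
    using power_int_strict_increasing[of k l "2 :: real"] power_int_strict_increasing[of l k "2 :: real"]
    by (cases k l rule: linorder_cases) auto
qed

lemma log_slope_eq: "e = 0 \<or> e = 1 \<Longrightarrow> end_slope e g k \<Longrightarrow> log_slope e g = k"
  unfolding log_slope_def using end_slope_unique by blast

lemma end_slope_log_slope: "e = 0 \<or> e = 1 \<Longrightarrow> end_slope e g (log_slope e g)"
  using ex_end_slope log_slope_eq by metis

lemma thompson_act_mult: "thompson_act (g \<otimes>\<^bsub>thompson_F\<^esub> h) x = thompson_act g (thompson_act h x)"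
  using thompson_maps_endpoints(3)[OF Rep_thompson, of x h]
  by (cases "x \<in> {0..1}") (simp_all add: thompson_act_def thompson_F_def thompson_mult.rep_eq compose_def del: atLeastAtMost_iff)

lemma log_slope_mult:
  assumes e: "e = 0 \<or> e = 1"
  shows "log_slope e (g \<otimes>\<^bsub>thompson_F\<^esub> h) = log_slope e g + log_slope e h"
proof (rule log_slope_eq[OF e])
  let ?k = "log_slope e g" and ?l = "log_slope e h"
  obtain d1 where d1: "d1 > 0" "\<And>x. x \<in> {0..1} \<Longrightarrow> \<bar>x - e\<bar> < d1 \<Longrightarrow> thompson_act g x = e + 2 powi ?k * (x - e)"
    using end_slope_log_slope[OF e, of g] unfolding end_slope_def by blast
  obtain d2 where d2: "d2 > 0" "\<And>x. x \<in> {0..1} \<Longrightarrow> \<bar>x - e\<bar> < d2 \<Longrightarrow> thompson_act h x = e + 2 powi ?l * (x - e)"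
    using end_slope_log_slope[OF e, of h] unfolding end_slope_def by blast
  \<comment> \<open>\<open>h\<close> stretches distances to \<open>e\<close> by
    \<open>2 powi ?l\<close>, so dividing by this factor keeps its values within \<open>d1\<close>
    of \<open>e\<close>.\<close>
  define d where "d = min d2 (d1 / 2 powi ?l)"
  have d: "d > 0" using d1(1) d2(1) by (simp add: d_def)
  have "thompson_act (g \<otimes>\<^bsub>thompson_F\<^esub> h) x = e + 2 powi (?k + ?l) * (x - e)"
    if x: "x \<in> {0..1}" "\<bar>x - e\<bar> < d" for x
  proof -
    have hx: "thompson_act h x = e + 2 powi ?l * (x - e)" using x by (intro d2) (auto simp: d_def)
    have "thompson_act h x \<in> {0..1}"
      using x thompson_maps_endpoints(3)[OF Rep_thompson, of x h] by (simp add: thompson_act_def)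
    moreover have "\<bar>thompson_act h x - e\<bar> < d1"
      using x by (simp add: hx abs_mult d_def pos_less_divide_eq mult.commute)
    ultimately have "thompson_act g (thompson_act h x) = e + 2 powi ?k * (thompson_act h x - e)" by (rule d1)
    then show ?thesis by (simp add: thompson_act_mult hx power_int_add)
  qed
  then show "end_slope e (g \<otimes>\<^bsub>thompson_F\<^esub> h) (?k + ?l)" unfolding end_slope_def using d by blast
qed

text \<open>The sign at 1 is chosen because a bump ending at 1 has slope 1/2 there, so that the
  second character takes the value 1 on it.\<close>

lemma interval_group_thompson:
  "interval_group thompson_F thompson_act (log_slope 0) (\<lambda>g. - log_slope 1 g)"
proof (intro interval_group.intro full_group.intro interval_group_axioms.intro full_group_axioms.intro)
  show "group thompson_F" by (rule group_thompson_F)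
  show "carrier thompson_F = UNIV" by (simp add: thompson_F_def)
  show outside: "thompson_act g x = x" if "x \<le> 0 \<or> 1 \<le> x" for g x
    using that thompson_maps_endpoints(1,2)[OF Rep_thompson[of g]] by (auto simp: thompson_act_def)
  show "g = h" if "\<And>x. thompson_act g x = thompson_act h x" for g h
  proof -
    have "Rep_thompson g x = Rep_thompson h x" for x
    proof (cases "x \<in> {0..1}")
      case True
      then show ?thesis using that[of x] by (simp add: thompson_act_def)
    next
      case False
      then show ?thesis using Rep_thompson[of g] Rep_thompson[of h]
        by (auto simp: thompson_maps_def extensional_def)
    qed
    then show ?thesis by (simp add: Rep_thompson_inject[symmetric] fun_eq_iff)
  qed
  show "thompson_act g x < thompson_act g y" if xy: "x < y" for g x y
  proof -
    have g: "Rep_thompson g \<in> thompson_maps" by (rule Rep_thompson)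
    then have "strict_mono_on {0..1} (Rep_thompson g)" by (simp add: thompson_maps_def)
    from strict_mono_onD[OF this, of x y] show ?thesis
      using xy thompson_maps_endpoints(3)[OF g, of x] thompson_maps_endpoints(3)[OF g, of y]
      by (auto simp: thompson_act_def)
  qed
  show "\<exists>h a' b'. a < a' \<and> b' < b \<and> (\<forall>y. y \<le> a' \<or> b' \<le> y \<longrightarrow> thompson_act h y = y) \<and> x < thompson_act h x"
    if ab: "0 \<le> a" "a < x" "x < b" "b \<le> 1" for a b x
  proof -
    obtain a' where a': "a' \<in> dyadic_rationals" "a < a'" "a' < x" using ex_dyadic_between[OF ab(2)] .
    obtain b' where b': "b' \<in> dyadic_rationals" "x < b'" "b' < b" using ex_dyadic_between[OF ab(3)] .
    obtain h where "thompson_act h = bump_map a' b'" using ex_thompson_bump[OF a'(1) b'(1)] ab a' b' by auto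
    then show ?thesis using a' b' bump_map_outside[of a' b'] bump_map_greater[of a' x b']
      by (intro exI[of _ h] exI[of _ a'] exI[of _ b']) auto
  qed
  show "(log_slope 0 g = 0) \<longleftrightarrow> (\<exists>a>0. \<forall>x\<le>a. thompson_act g x = x)" for g
  proof
    assume "log_slope 0 g = 0"
    then obtain d where d: "d > 0" "\<And>x. x \<in> {0..1} \<Longrightarrow> \<bar>x\<bar> < d \<Longrightarrow> thompson_act g x = x"
      using end_slope_log_slope[of 0 g] by (auto simp: end_slope_def)
    have "thompson_act g x = x" if "x \<le> d / 2" for x
      using d outside[of x g] that by (cases "x \<in> {0..1}") auto
    then show "\<exists>a>0. \<forall>x\<le>a. thompson_act g x = x" using d(1) half_gt_zero by blast
  next
    assume "\<exists>a>0. \<forall>x\<le>a. thompson_act g x = x"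
    then have "end_slope 0 g 0" by (force simp: end_slope_def)
    then show "log_slope 0 g = 0" by (intro log_slope_eq) auto
  qed
  show "(- log_slope 1 g = 0) \<longleftrightarrow> (\<exists>b<1. \<forall>x\<ge>b. thompson_act g x = x)" for g
  proof
    assume "- log_slope 1 g = 0"
    then obtain d where d: "d > 0" "\<And>x. x \<in> {0..1} \<Longrightarrow> \<bar>x - 1\<bar> < d \<Longrightarrow> thompson_act g x = x"
      using end_slope_log_slope[of 1 g] by (auto simp: end_slope_def)
    have "thompson_act g x = x" if "x \<ge> 1 - d / 2" for x
      using d outside[of x g] that by (cases "x \<in> {0..1}") auto
    then show "\<exists>b<1. \<forall>x\<ge>b. thompson_act g x = x" using d(1) by (intro exI[of _ "1 - d / 2"]) auto
  next
    assume "\<exists>b<1. \<forall>x\<ge>b. thompson_act g x = x"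
    then obtain b where b: "b < 1" "\<And>x. x \<ge> b \<Longrightarrow> thompson_act g x = x" by blast
    have "end_slope 1 g 0" unfolding end_slope_def using b by (intro exI[of _ "1 - b"]) auto
    then show "- log_slope 1 g = 0" using log_slope_eq[of 1 g 0] by simp
  qed
  show "\<exists>p. log_slope 0 p = 1 \<and> (\<forall>x\<ge>r. thompson_act p x = x)" if r: "0 < r" "r < 1" for r
  proof -
    obtain s where s: "s \<in> dyadic_rationals" "0 < s" "s < r" using ex_dyadic_between[OF r(1)] .
    obtain p where p: "thompson_act p = bump_map 0 s"
      using ex_thompson_bump[of 0 s] dyadic_of_int[of 0] s r by auto
    \<comment> \<open>\<open>s / 4\<close> is the first breakpoint after 0, where the slope drops
      from 2 to 1.\<close>
    have "bump_map 0 s x = 2 * x" if "x \<in> {0..1}" "\<bar>x\<bar> < s / 4" for x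
      using that s(2) abs_less_iff[of x] unfolding bump_map_def atLeastAtMost_iff order_eq_iff min_max_le_iff by argo
    then have "end_slope 0 p 1" unfolding end_slope_def p using s by (intro exI[of _ "s / 4"]) auto
    then have "log_slope 0 p = 1" by (intro log_slope_eq) auto
    moreover have "\<forall>x\<ge>r. thompson_act p x = x" using s r by (auto simp: p intro!: bump_map_outside)
    ultimately show ?thesis by blast
  qed
  show "\<exists>p. - log_slope 1 p = 1 \<and> (\<forall>x\<le>r. thompson_act p x = x)" if r: "0 < r" "r < 1" for r
  proof -
    obtain s where s: "s \<in> dyadic_rationals" "r < s" "s < 1" using ex_dyadic_between[OF r(2)] .
    obtain p where p: "thompson_act p = bump_map s 1"
      using ex_thompson_bump[of s 1] dyadic_of_int[of 1] s r by auto
    have "bump_map s 1 x = 1 + (x - 1) / 2" if "x \<in> {0..1}" "\<bar>x - 1\<bar> < (1 - s) / 4" for x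
      using that s(3) abs_less_iff[of "x - 1"] unfolding bump_map_def atLeastAtMost_iff order_eq_iff min_max_le_iff by argo
    then have "end_slope 1 p (-1)" unfolding end_slope_def p using s
      by (intro exI[of _ "(1 - s) / 4"]) (auto simp: power_int_minus)
    then have "- log_slope 1 p = 1" using log_slope_eq[of 1 p "-1"] by simp
    moreover have "\<forall>x\<le>r. thompson_act p x = x" using s r by (auto simp: p intro!: bump_map_outside)
    ultimately show ?thesis by blast
  qed
qed (simp_all add: thompson_act_mult log_slope_mult)

theorem theorem1p2:
  fixes M :: "(thompson ell2 \<Rightarrow>\<^sub>L thompson ell2) set"
  assumes "vN_subalgebra thompson_F M"
    and "\<And>g. g \<in> derived thompson_F (carrier thompson_F) \<Longrightarrow>
      (\<lambda>T. left_reg thompson_F g o\<^sub>L T o\<^sub>L adj (left_reg thompson_F g)) ` M = M"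
  shows "\<exists>N. N \<lhd> thompson_F \<and> M = subgroup_vN thompson_F N"
  using interval_group.rigid[OF interval_group_thompson] assms
  by (rule rigid_group.invariant_vN_subalgebra)

end
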